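(* Assume (A) and consider testing $H_0:\mathbf{G}\sim\mathsf{G}(n,p)$ versus $H_1:\mathbf{G}\sim\mathsf{RGG}(n,\mathbb{T}^d,\mathsf{Unif},\sigma^\infty_p,p)$. (1) The signed 4-cycle test $\mathsf{SC}_{C_4}$ succeeds if $d=\tilde o(np)$ and fails if $d=\tilde\omega(np)$. (2) The signed triangle test $\mathsf{SC}_{C_3}$ succeeds if $d=\tilde o((np)^{3/4})$ and fails if $d=\tilde\omega((np)^{3/4})$.
   Context: Torus $\mathbb{T}^d=\mathbb{R}^d/2\mathbb{Z}^d$ with uniform measure; circular distance $|x-y|_C\in[0,1]$ on a circle of circumference 2; $\|\mathbf{x}-\mathbf{y}\|_\infty=\max_i|x_i-y_i|_C$. $\tau^\infty_p$ satisfies $\mathbf{P}[\|\mathbf{x}-\mathbf{y}\|_\infty\le\tau^\infty_p]=p$ for $\mathbf{x},\mathbf{y}$ iid uniform. $\mathsf{RGG}(n,\mathbb{T}^d,\mathsf{Unif},\sigma^\infty_p,p)$: sample $\mathbf{x}^1,\dots,\mathbf{x}^n$ iid uniform on $\mathbb{T}^d$ and join $i,j$ iff $\|\mathbf{x}^i-\mathbf{x}^j\|_\infty\le\tau^\infty_p$. $\mathsf{G}(n,p)$ is Erdős–Rényi. Assumption (A): absolute constants $\delta,\epsilon>0$ with $n^{-1+\epsilon}\le p\le1/2$, $n^\delta\le d$. For a graph $H\subseteq K_n$ (given by an edge set) and a graph $G$ on $[n]$ with adjacency entries $G_{ij}\in\{0,1\}$, the signed weight is $\mathsf{SW}_H(G)=\prod_{(ij)\in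 E(H)}(G_{ij}-p)$, and the signed count is $\mathsf{SC}_H(G)=\sum_{H_1}\mathsf{SW}_{H_1}(G)$ over all subgraphs $H_1$ of $K_n$ isomorphic to $H$. The signed $H$-count test succeeds if $|\mathbf{E}_{\mathsf{RGG}}\mathsf{SC}_H|=\omega\big(\sqrt{\mathrm{Var}_{\mathsf{G}(n,p)}\mathsf{SC}_H+\mathrm{Var}_{\mathsf{RGG}}\mathsf{SC}_H}\big)$ and fails if the same quantity is $o(\cdot)$ of the right-hand side. $\tilde o,\tilde\omega$ hide polylogarithmic factors in $n$. *)

theory Defs
  imports "HOL-Probability.Probability" "HOL-Library.Landau_Symbols"
begin

text \<open>Circular distance on a circle of circumference 2 (distance to the nearest multiple of 2).\<close>
definition cdist :: "real \<Rightarrow> real \<Rightarrow> real" where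
  "cdist a b = \<bar>(a - b) - 2 * of_int (round ((a - b) / 2))\<bar>"

definition linf :: "nat \<Rightarrow> (nat \<Rightarrow> real) \<Rightarrow> (nat \<Rightarrow> real) \<Rightarrow> real" where
  "linf d x y = (MAX k\<in>{..<d}. cdist (x k) (y k))"

text \<open>Uniform measure on the torus R^d / 2Z^d, represented on the fundamental domain [0,2)^d.\<close>
definition torus :: "nat \<Rightarrow> (nat \<Rightarrow> real) measure" where
  "torus d = (\<Pi>\<^sub>M k\<in>{..<d}. uniform_measure lborel {0..<2::real})"

definition tau :: "nat \<Rightarrow> real \<Rightarrow> real" where
  "tau d p = (THE t. measure (torus d \<Otimes>\<^sub>M torus d)
       {z \<in> space (torus d \<Otimes>\<^sub>M torus d). linf d (fst z) (snd z) \<le> t} = p)"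

definition rgg_points :: "nat \<Rightarrow> nat \<Rightarrow> (nat \<Rightarrow> nat \<Rightarrow> real) measure" where
  "rgg_points n d = (\<Pi>\<^sub>M i\<in>{..<n}. torus d)"

definition rgg_graph :: "nat \<Rightarrow> real \<Rightarrow> (nat \<Rightarrow> nat \<Rightarrow> real) \<Rightarrow> nat set \<Rightarrow> real" where
  "rgg_graph d p x e =
     (if \<exists>i j. i \<noteq> j \<and> e = {i, j} \<and> linf d (x i) (x j) \<le> tau d p then 1 else 0)"

definition Kn_edges :: "nat \<Rightarrow> nat set set" where
  "Kn_edges n = {{i, j} | i j. i < n \<and> j < n \<and> i \<noteq> j}"

definition er :: "nat \<Rightarrow> real \<Rightarrow> (nat set \<Rightarrow> bool) pmf" where
  "er n p = Pi_pmf (Kn_edges n) False (\<lambda>_. bernoulli_pmf p)"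

definition cycle_copies :: "nat \<Rightarrow> nat \<Rightarrow> nat set set set" where
  "cycle_copies k n = {E. \<exists>v. inj_on v {..<k} \<and> v ` {..<k} \<subseteq> {..<n} \<and>
       E = (\<lambda>i. {v i, v (Suc i mod k)}) ` {..<k}}"

definition signed_weight :: "real \<Rightarrow> nat set set \<Rightarrow> (nat set \<Rightarrow> real) \<Rightarrow> real" where
  "signed_weight p H G = (\<Prod>e\<in>H. (G e - p))"

definition signed_count :: "nat \<Rightarrow> nat \<Rightarrow> real \<Rightarrow> (nat set \<Rightarrow> real) \<Rightarrow> real" where
  "signed_count k n p G = (\<Sum>H\<in>cycle_copies k n. signed_weight p H G)"

definition var_of :: "'a measure \<Rightarrow> ('a \<Rightarrow> real) \<Rightarrow> real" where
  "var_of M X = (\<integral>\<omega>. (X \<omega> - (\<integral>\<omega>'. X \<omega>' \<partial>M))\<^sup>2 \<partial>M)"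

definition E_rgg :: "nat \<Rightarrow> nat \<Rightarrow> nat \<Rightarrow> real \<Rightarrow> real" where
  "E_rgg k n d p = (\<integral>x. signed_count k n p (rgg_graph d p x) \<partial>rgg_points n d)"

definition Var_rgg :: "nat \<Rightarrow> nat \<Rightarrow> nat \<Rightarrow> real \<Rightarrow> real" where
  "Var_rgg k n d p = var_of (rgg_points n d) (\<lambda>x. signed_count k n p (rgg_graph d p x))"

definition Var_er :: "nat \<Rightarrow> nat \<Rightarrow> real \<Rightarrow> real" where
  "Var_er k n p = var_of (measure_pmf (er n p)) (\<lambda>\<omega>. signed_count k n p (\<lambda>e. of_bool (\<omega> e)))"

definition test_succeeds :: "nat \<Rightarrow> (nat \<Rightarrow> real) \<Rightarrow> (nat \<Rightarrow> nat) \<Rightarrow> bool" where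
  "test_succeeds k p d \<longleftrightarrow>
     (\<lambda>n. sqrt (Var_er k n (p n) + Var_rgg k n (d n) (p n))) \<in> o(\<lambda>n. \<bar>E_rgg k n (d n) (p n)\<bar>)"

definition test_fails :: "nat \<Rightarrow> (nat \<Rightarrow> real) \<Rightarrow> (nat \<Rightarrow> nat) \<Rightarrow> bool" where
  "test_fails k p d \<longleftrightarrow>
     (\<lambda>n. \<bar>E_rgg k n (d n) (p n)\<bar>) \<in> o(\<lambda>n. sqrt (Var_er k n (p n) + Var_rgg k n (d n) (p n)))"

definition assumption_A :: "real \<Rightarrow> real \<Rightarrow> (nat \<Rightarrow> real) \<Rightarrow> (nat \<Rightarrow> nat) \<Rightarrow> bool" where
  "assumption_A \<delta> \<epsilon> p d \<longleftrightarrow>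
     (\<forall>\<^sub>F n in sequentially. real n powr (-1 + \<epsilon>) \<le> p n \<and> p n \<le> 1/2 \<and> real n powr \<delta> \<le> real (d n))"

end

theory Submission
  imports Defs "HOL-Real_Asymp.Real_Asymp"
begin

text \<open>
  The edge \<open>ij\<close> is present iff in none of the \<open>d\<close> independent coordinates the points are
  at distance more than \<open>\<tau> = p^(1/d)\<close>, i.e. almost antipodal; this has probability
  \<open>\<lambda> = 1 - \<tau>\<close>, which is of order \<open>ln (1/p) / d\<close>. Within one coordinate these bad events are
  independent along forests, three of them never occur on a triangle, and all four occur on a
  4-cycle with probability of order \<open>\<lambda>^3\<close>. By inclusion-exclusion the probability that a coordinate
  admits all edges of a bounded graph \<open>S\<close> is \<open>\<tau>^|S| + O(\<lambda>^3)\<close>, and raising to the power \<open>d\<close> shows that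
  \<open>S\<close> is contained in the random graph with probability \<open>p^|S| (1 + O(d \<lambda>^3))\<close>. For the cycles
  \<open>C_k\<close> with \<open>k = 3, 4\<close> the correction is positive and of exact order \<open>d \<lambda>^3\<close>, so the mean of the signed
  count is \<open>(np)^k / d^2\<close> up to logarithms.

  By translation invariance two cycles sharing at most one vertex are uncorrelated; two distinct
  cycles on \<open>w \<le> 2k - 2\<close> vertices in total contribute \<open>O(d \<lambda>^3 p^w)\<close> to the variance. Hence the variance is
  at most \<open>(np)^k + (np)^(2k-2) / d^2\<close> up to logarithms, while it is of exact order \<open>(np)^k\<close>
  in the Erdos-Renyi graph. The threshold for both cycles is therefore \<open>d = (np)^(k/4)\<close>.
\<close>

section \<open>Circular distance and the uniform measure on the circle\<close>

text \<open>In one coordinate two points are far exactly when their difference is within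
  \<open>1 - tau\<close> of an odd integer, so cycles become a matter of parity. On a triangle two
  odd numbers would have to add up to an odd one; on a 4-cycle three odd numbers do add up to an odd
  one, so three very far edges force the fourth. Both effects are of third order, and
  inclusion-exclusion weighs them with \<open>(-1) ^ k\<close>, which makes both corrections
  positive. Calibrating \<open>tau ^ d = p\<close> removes everything below: no proper subset of a
  cycle deviates from independence, so the mean of a signed weight is carried by the full cycle
  alone.

  Comparing the squared mean \<open>(np) ^ (2k) / d ^ 4\<close> with the two variance terms gives
  the conditions \<open>d << (np) ^ (k / 4)\<close> and \<open>d << np\<close>, up to logarithms.
  The first implies the second because \<open>k <= 4\<close> and \<open>np >= 1\<close>; this is why
  overlapping cycles never move the threshold.\<close>

definition circle :: "real measure" where
  "circle = uniform_measure lborel {0..<2}"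

lemma prob_space_circle: "prob_space circle"
  unfolding circle_def by (rule prob_space_uniform_measure) auto

lemma sets_circle [simp, measurable_cong]: "sets circle = sets borel"
  by (simp add: circle_def)

lemma space_circle [simp]: "space circle = UNIV"
  by (simp add: circle_def)

lemma torus_eq: "torus d = (\<Pi>\<^sub>M k\<in>{..<d}. circle)"
  by (simp add: torus_def circle_def)

lemma prob_space_torus: "prob_space (torus d)"
  unfolding torus_eq by (intro prob_space_PiM prob_space_circle)

lemma product_sigma_finite_prob_space:
  assumes "prob_space M"
  shows "product_sigma_finite (\<lambda>_. M)"
  using assms by (simp add: product_sigma_finite_def prob_space_imp_sigma_finite)

lemma prob_space_rgg_points: "prob_space (rgg_points n d)"
  unfolding rgg_points_def by (intro prob_space_PiM prob_space_torus)

interpretation circle: prob_space circle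
  by (rule prob_space_circle)

interpretation circles: product_sigma_finite "\<lambda>_. circle"
  by (intro product_sigma_finite_prob_space prob_space_circle)

interpretation tori: product_sigma_finite "\<lambda>_. torus d" for d
  by (intro product_sigma_finite_prob_space prob_space_torus)

interpretation circle_power: prob_space "PiM I (\<lambda>_. circle)" for I :: "nat set"
  by (intro prob_space_PiM prob_space_circle)

lemma periodic_int:
  fixes f :: "real \<Rightarrow> 'a"
  assumes "\<And>x. f (x + 2) = f x"
  shows "f (x + 2 * of_int m) = f x"
proof (induction m rule: int_induct[where k = 0])
  case (step1 i)
  have "x + 2 * of_int (i + 1) = (x + 2 * of_int i) + 2" by simp
  then show ?case using step1 assms by metis
next
  case (step2 i)
  have "x + 2 * of_int i = (x + 2 * of_int (i - 1)) + 2" by simp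
  then show ?case using step2 assms by metis
qed simp

lemma nn_integral_circle:
  assumes "f \<in> borel_measurable borel"
  shows "(\<integral>\<^sup>+x. f x \<partial>circle) = (\<integral>\<^sup>+x. f x * indicator {0..<2} x \<partial>lborel) / 2"
  unfolding circle_def using assms by (subst nn_integral_uniform_measure) auto

text \<open>Reduce the shift modulo 2 to some \<open>r\<close> in \<open>[0, 2)\<close>. The window
  \<open>[r, r + 2)\<close> then sticks out beyond 2 by \<open>[2, r + 2)\<close>, which the period
  carries back onto \<open>[0, r)\<close>.\<close>

lemma nn_integral_circle_shift:
  fixes f :: "real \<Rightarrow> ennreal"
  assumes [measurable]: "f \<in> borel_measurable borel" and per: "\<And>x. f (x + 2) = f x"
  shows "(\<integral>\<^sup>+x. f (x + s) \<partial>circle) = (\<integral>\<^sup>+x. f x \<partial>circle)"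
proof -
  define r where "r = s - 2 * of_int \<lfloor>s / 2\<rfloor>"
  have r: "0 \<le> r" "r < 2" unfolding r_def by linarith+
  have "f (x + s) = f (x + r)" for x
    using periodic_int[of f "x + r" "\<lfloor>s / 2\<rfloor>", OF per] by (simp add: r_def)
  then have "(\<integral>\<^sup>+x. f (x + s) \<partial>circle) = (\<integral>\<^sup>+x. f (x + r) \<partial>circle)" by simp
  also have "\<dots> = (\<integral>\<^sup>+x. f (x + r) * indicator {0..<2} x \<partial>lborel) / 2"
    by (subst nn_integral_circle) auto
  also have "(\<integral>\<^sup>+x. f (x + r) * indicator {0..<2} x \<partial>lborel)
      = (\<integral>\<^sup>+x. f x * indicator {r..<r + 2} x \<partial>lborel)"
    by (subst nn_integral_real_affine[where c = 1 and t = r and f = "\<lambda>x. f x * indicator {r..<r + 2} x"])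
       (auto intro!: nn_integral_cong simp: add.commute split: split_indicator)
  also have "\<dots> = (\<integral>\<^sup>+x. f x * indicator {r..<2} x + f x * indicator {2..<r + 2} x \<partial>lborel)"
    using r by (auto intro!: nn_integral_cong split: split_indicator)
  also have "\<dots> = (\<integral>\<^sup>+x. f x * indicator {r..<2} x \<partial>lborel) + (\<integral>\<^sup>+x. f x * indicator {2..<r + 2} x \<partial>lborel)"
    by (subst nn_integral_add) auto
  also have "(\<integral>\<^sup>+x. f x * indicator {2..<r + 2} x \<partial>lborel) = (\<integral>\<^sup>+x. f x * indicator {0..<r} x \<partial>lborel)"
    by (subst nn_integral_real_affine[where c = 1 and t = 2])
       (auto intro!: nn_integral_cong simp: per add.commute[of 2] split: split_indicator)
  also have "(\<integral>\<^sup>+x. f x * indicator {r..<2} x \<partial>lborel) + (\<integral>\<^sup>+x. f x * indicator {0..<r} x \<partial>lborel)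
      = (\<integral>\<^sup>+x. f x * indicator {r..<2} x + f x * indicator {0..<r} x \<partial>lborel)"
    by (subst nn_integral_add) auto
  also have "\<dots> = (\<integral>\<^sup>+x. f x * indicator {0..<2} x \<partial>lborel)"
    using r by (auto intro!: nn_integral_cong split: split_indicator)
  also have "\<dots> / 2 = (\<integral>\<^sup>+x. f x \<partial>circle)"
    by (subst nn_integral_circle) auto
  finally show ?thesis .
qed

section \<open>The circular distance: symmetries and law\<close>

lemma measurable_round [measurable]: "(round :: real \<Rightarrow> int) \<in> borel \<rightarrow>\<^sub>M count_space UNIV"
  unfolding round_def[abs_def] by measurable

lemma cdist_measurable [measurable (raw)]:
  assumes [measurable]: "f \<in> borel_measurable M" "g \<in> borel_measurable M"
  shows "(\<lambda>x. cdist (f x) (g x)) \<in> borel_measurable M"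
  unfolding cdist_def by measurable

text \<open>\<open>cdist\<close> is a minimum over all integers \<open>m\<close>. In this
  existential form symmetry and periodicity are reindexings of \<open>m\<close> instead of case
  analyses of \<open>round\<close>.\<close>

lemma cdist_le_iff: "cdist a b \<le> t \<longleftrightarrow> (\<exists>m::int. \<bar>a - b - 2 * of_int m\<bar> \<le> t)"
proof -
  have "cdist a b \<le> \<bar>a - b - 2 * of_int m\<bar>" for m :: int
    using round_diff_minimal[of "(a - b) / 2" m] unfolding cdist_def abs_if
    by (simp add: field_simps split: if_splits)
  then show ?thesis using order_trans by (auto simp: cdist_def)
qed

lemma cdist_eqI:
  assumes "\<And>t. cdist a b \<le> t \<longleftrightarrow> cdist a' b' \<le> t"
  shows "cdist a b = cdist a' b'"
  using assms by (metis order_antisym order_refl)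

lemma cdist_commute: "cdist a b = cdist b a"
proof (rule cdist_eqI)
  have "\<exists>m::int. \<bar>b - a - 2 * of_int m\<bar> \<le> t" if "\<bar>a - b - 2 * of_int m\<bar> \<le> t" for t a b :: real and m :: int
    using that by (intro exI[of _ "- m"]) (simp add: abs_le_iff)
  then show "cdist a b \<le> t \<longleftrightarrow> cdist b a \<le> t" for t
    unfolding cdist_le_iff by blast
qed

lemma cdist_translate: "cdist (a + c) (b + c) = cdist a b"
  by (simp add: cdist_def)

lemma cdist_periodic: "cdist (a + 2) b = cdist a b"
proof (rule cdist_eqI)
  fix t
  have "\<bar>a + 2 - b - 2 * of_int m\<bar> = \<bar>a - b - 2 * of_int (m - 1)\<bar>" for m :: int
    by (simp add: algebra_simps)
  then show "cdist (a + 2) b \<le> t \<longleftrightarrow> cdist a b \<le> t"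
    unfolding cdist_le_iff by (metis add_diff_cancel_right')
qed

lemma cdist_nonneg: "0 \<le> cdist a b"
  by (simp add: cdist_def)

lemma cdist_le_1: "cdist a b \<le> 1"
  unfolding cdist_def using of_int_round_abs_le[of "(a - b) / 2"] by (simp add: abs_le_iff field_simps)

text \<open>The odd integers are the antipodes: farther than \<open>t\<close> from all even integers
  means closer than \<open>1 - t\<close> to an odd one. Far relations can then be added along a
  path, and parity decides whether they are compatible.\<close>

lemma cdist_gt_iff:
  assumes "t \<ge> 0"
  shows "cdist a b > t \<longleftrightarrow> (\<exists>m::int. \<bar>a - b - (2 * of_int m + 1)\<bar> < 1 - t)"
proof
  assume *: "cdist a b > t"
  let ?m = "\<lfloor>(a - b) / 2\<rfloor>"
  have "\<not> \<bar>a - b - 2 * of_int ?m\<bar> \<le> t" "\<not> \<bar>a - b - 2 * of_int (?m + 1)\<bar> \<le> t"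
    using * cdist_le_iff[of a b t] by (auto simp del: of_int_add)
  moreover have "a - b - 2 * of_int ?m \<ge> 0" "a - b - 2 * of_int (?m + 1) \<le> 0"
    using floor_correct[of "(a - b) / 2"] by (simp_all add: field_simps)
  ultimately have "\<bar>a - b - (2 * of_int ?m + 1)\<bar> < 1 - t"
    by (simp add: abs_if split: if_splits)
  then show "\<exists>m::int. \<bar>a - b - (2 * of_int m + 1)\<bar> < 1 - t" by blast
next
  assume "\<exists>m::int. \<bar>a - b - (2 * of_int m + 1)\<bar> < 1 - t"
  then obtain m :: int where m: "\<bar>a - b - (2 * of_int m + 1)\<bar> < 1 - t" by blast
  have "\<not> \<bar>a - b - 2 * of_int l\<bar> \<le> t" for l :: int
  proof (cases "l \<le> m")
    case True
    then have "real_of_int l \<le> of_int m" by simp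
    then show ?thesis using m by linarith
  next
    case False
    then have "real_of_int l \<ge> of_int (m + 1)" by (subst of_int_le_iff) simp
    then show ?thesis using m by simp
  qed
  then show "cdist a b > t" using cdist_le_iff[of a b t] by auto
qed

lemma cdist_zero:
  assumes "0 \<le> x" "x < 2"
  shows "cdist x 0 \<le> t \<longleftrightarrow> x \<le> t \<or> 2 - x \<le> t"
proof
  assume "cdist x 0 \<le> t"
  then obtain m :: int where m: "\<bar>x - 2 * of_int m\<bar> \<le> t" by (auto simp: cdist_le_iff)
  show "x \<le> t \<or> 2 - x \<le> t"
  proof (cases "m \<le> 0")
    case True
    then have "real_of_int m \<le> 0" by simp
    then show ?thesis using m assms by linarith
  next
    case False
    then have "real_of_int m \<ge> 1" by (simp add: int_one_le_iff_zero_less)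
    then show ?thesis using m assms by linarith
  qed
next
  assume "x \<le> t \<or> 2 - x \<le> t"
  then show "cdist x 0 \<le> t"
    unfolding cdist_le_iff using assms by (auto intro: exI[of _ 0] exI[of _ 1])
qed

text \<open>The arc of points within \<open>t\<close> of \<open>x\<close> has length
  \<open>2t\<close> on a circumference of 2. Translation moves \<open>x\<close> to 0, where the arc
  splits into the two ends of \<open>[0, 2)\<close>.\<close>

lemma nn_integral_cdist_le:
  assumes "0 \<le> t" "t \<le> 1"
  shows "(\<integral>\<^sup>+y. indicator {..t} (cdist x y) \<partial>circle) = ennreal t"
proof -
  have "(\<integral>\<^sup>+y. indicator {..t} (cdist x y) \<partial>circle)
      = (\<integral>\<^sup>+y. indicator {..t} (cdist (y + (- x)) 0) \<partial>circle)"
    by (intro nn_integral_cong) (metis add.right_inverse cdist_commute cdist_translate)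
  also have "\<dots> = (\<integral>\<^sup>+y. indicator {..t} (cdist y 0) \<partial>circle)"
    by (rule nn_integral_circle_shift) (auto simp: cdist_periodic)
  also have "\<dots> = (\<integral>\<^sup>+y. indicator {..t} (cdist y 0) * indicator {0..<2} y \<partial>lborel) / 2"
    by (rule nn_integral_circle) measurable
  also have "(\<integral>\<^sup>+y. indicator {..t} (cdist y 0) * indicator {0..<2} y \<partial>lborel)
      = (\<integral>\<^sup>+y. indicator ({0..t} \<union> {2 - t..<2}) y \<partial>lborel)"
    by (intro nn_integral_cong_AE AE_I[where N = "{2}"])
       (use assms in \<open>auto split: split_indicator simp: cdist_zero\<close>)
  \<comment> \<open>The two ends overlap only for \<open>t = 1\<close>, in the single point 1; hence
    the null set.\<close>
  also have "(\<integral>\<^sup>+y. indicator ({0..t} \<union> {2 - t..<2}) y \<partial>lborel)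
      = (\<integral>\<^sup>+y. indicator {0..t} y + indicator {2 - t..<2} y \<partial>lborel)"
    by (intro nn_integral_cong_AE AE_I[where N = "{1}"])
       (use assms in \<open>auto split: split_indicator\<close>)
  also have "\<dots> = ennreal (2 * t)"
    using assms by (subst nn_integral_add) (auto simp: ennreal_plus[symmetric] simp del: ennreal_plus)
  also have "\<dots> / 2 = ennreal t"
    using assms by (simp add: ennreal_divide_numeral)
  finally show ?thesis .
qed

lemma nn_integral_cdist_gt:
  assumes "0 \<le> t" "t \<le> 1"
  shows "(\<integral>\<^sup>+y. indicator {t<..} (cdist x y) \<partial>circle) = ennreal (1 - t)"
proof -
  have "(\<integral>\<^sup>+y. indicator {t<..} (cdist x y) \<partial>circle) + ennreal t
      = (\<integral>\<^sup>+y. indicator {t<..} (cdist x y) + indicator {..t} (cdist x y) \<partial>circle)"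
    by (subst nn_integral_add) (auto simp: nn_integral_cdist_le assms)
  also have "\<dots> = (\<integral>\<^sup>+y. 1 \<partial>circle)"
    by (intro nn_integral_cong) (auto split: split_indicator)
  also have "\<dots> = 1" using circle.emeasure_space_1 by simp
  also have "\<dots> = ennreal (1 - t) + ennreal t"
    using assms by (simp flip: ennreal_plus)
  finally show ?thesis by simp
qed

section \<open>Translation invariance on products of circles\<close>

lemma nn_integral_circles_const: "(\<integral>\<^sup>+x. c \<partial>PiM I (\<lambda>_. circle)) = c" for I :: "nat set"
  unfolding nn_integral_const circle_power.emeasure_space_1 by simp

text \<open>Coordinates are peeled off one at a time, each by the one-dimensional shift. Locality of
  \<open>G\<close> is assumed because the shift acts on every index, also outside \<open>J\<close>,
  where points of the product space carry \<open>undefined\<close>.\<close>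

lemma nn_integral_circles_shift:
  fixes G :: "(nat \<Rightarrow> real) \<Rightarrow> ennreal"
  assumes "finite J" and "G \<in> borel_measurable (PiM J (\<lambda>_. circle))"
    and "\<And>x y. (\<And>i. i \<in> J \<Longrightarrow> x i = y i) \<Longrightarrow> G x = G y"
    and "\<And>x i. i \<in> J \<Longrightarrow> G (x(i := x i + 2)) = G x"
  shows "(\<integral>\<^sup>+x. G (\<lambda>i. x i + s) \<partial>PiM J (\<lambda>_. circle)) = (\<integral>\<^sup>+x. G x \<partial>PiM J (\<lambda>_. circle))"
  using assms
proof (induction J arbitrary: G rule: finite_induct)
  case empty
  then have "G (\<lambda>i. x i + s) = G x" for x by blast
  then show ?case by simp
next
  case (insert j J)
  note G [measurable] = insert.prems(1)
  note dep = insert.prems(2)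
  note per = insert.prems(3)
  define G' where "G' x = (\<integral>\<^sup>+y. G (x(j := y)) \<partial>circle)" for x
  \<comment> \<open>The shifted point is no longer extensional, so measurability has to pass through
    a restriction.\<close>
  have G_eq: "(\<lambda>x. G (\<lambda>i. x i + s)) = (\<lambda>x. G (\<lambda>i\<in>insert j J. x i + s))"
    by (intro ext dep) auto
  have "(\<lambda>x. G (\<lambda>i. x i + s)) \<in> borel_measurable (PiM (insert j J) (\<lambda>_. circle))"
    unfolding G_eq by measurable
  then have "(\<integral>\<^sup>+x. G (\<lambda>i. x i + s) \<partial>PiM (insert j J) (\<lambda>_. circle))
      = (\<integral>\<^sup>+x. \<integral>\<^sup>+y. G (\<lambda>i. (x(j := y)) i + s) \<partial>circle \<partial>PiM J (\<lambda>_. circle))"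
    using insert.hyps by (subst circles.product_nn_integral_insert) auto
  also have "\<dots> = (\<integral>\<^sup>+x. G' (\<lambda>i. x i + s) \<partial>PiM J (\<lambda>_. circle))"
  proof (rule nn_integral_cong)
    fix x assume "x \<in> space (PiM J (\<lambda>_. circle))"
    define f where "f y = G ((\<lambda>i. x i + s)(j := y))" for y
    have f_eq: "f = (\<lambda>y. G (\<lambda>i\<in>insert j J. if i = j then y else x i + s))"
      unfolding f_def by (intro ext dep) auto
    have f [measurable]: "f \<in> borel_measurable borel"
      unfolding f_eq by measurable
    have "f (y + 2) = f y" for y
      using per[of j "(\<lambda>i. x i + s)(j := y)", OF insertI1] unfolding f_def fun_upd_same fun_upd_upd .
    then have "(\<integral>\<^sup>+y. f (y + s) \<partial>circle) = (\<integral>\<^sup>+y. f y \<partial>circle)"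
      by (intro nn_integral_circle_shift) auto
    moreover have "(\<lambda>i. (x(j := y)) i + s) = (\<lambda>i. x i + s)(j := y + s)" for y
      by auto
    ultimately show "(\<integral>\<^sup>+y. G (\<lambda>i. (x(j := y)) i + s) \<partial>circle) = G' (\<lambda>i. x i + s)"
      by (simp add: f_def G'_def)
  qed
  also have "\<dots> = (\<integral>\<^sup>+x. G' x \<partial>PiM J (\<lambda>_. circle))"
  proof (rule insert.IH)
    show "G' \<in> borel_measurable (PiM J (\<lambda>_. circle))"
      unfolding G'_def by measurable
    show "G' x = G' y" if "\<And>i. i \<in> J \<Longrightarrow> x i = y i" for x y
      unfolding G'_def using that by (intro nn_integral_cong dep) auto
    show "G' (x(i := x i + 2)) = G' x" if "i \<in> J" for x i
    proof -
      have "i \<noteq> j" using that insert.hyps by auto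
      have "x(i := x i + 2, j := y) = (x(j := y))(i := (x(j := y)) i + 2)" for y
        using \<open>i \<noteq> j\<close> by auto
      then have "G (x(i := x i + 2, j := y)) = G (x(j := y))" for y
        by (simp only: per[OF insertI2[OF that]])
      then show ?thesis by (simp add: G'_def)
    qed
  qed
  also have "\<dots> = (\<integral>\<^sup>+x. G x \<partial>PiM (insert j J) (\<lambda>_. circle))"
    using insert.hyps by (subst circles.product_nn_integral_insert) (auto simp: G'_def[abs_def])
  finally show ?case .
qed

text \<open>Translation invariance makes the conditional expectation of the first factor
  given the single shared coordinate constant.\<close>

lemma nn_integral_circles_split:
  fixes F1 F2 :: "(nat \<Rightarrow> real) \<Rightarrow> ennreal"
  assumes "finite I" "V1 \<subseteq> I" "V2 \<subseteq> I" "V1 \<inter> V2 \<subseteq> {v}"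
    and [measurable]: "F1 \<in> borel_measurable (PiM I (\<lambda>_. circle))"
      "F2 \<in> borel_measurable (PiM I (\<lambda>_. circle))"
    and dep1: "\<And>x y. (\<And>i. i \<in> V1 \<Longrightarrow> x i = y i) \<Longrightarrow> F1 x = F1 y"
    and dep2: "\<And>x y. (\<And>i. i \<in> V2 \<Longrightarrow> x i = y i) \<Longrightarrow> F2 x = F2 y"
    and inv: "\<And>x c. F1 (\<lambda>i. x i + c) = F1 x"
    and per: "\<And>x i. F1 (x(i := x i + 2)) = F1 x"
  shows "(\<integral>\<^sup>+x. F1 x * F2 x \<partial>PiM I (\<lambda>_. circle))
    = (\<integral>\<^sup>+x. F1 x \<partial>PiM I (\<lambda>_. circle)) * (\<integral>\<^sup>+x. F2 x \<partial>PiM I (\<lambda>_. circle))"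
proof -
  \<comment> \<open>\<open>J\<close> holds the coordinates private to the first factor. The
    coordinate \<open>v\<close> goes to \<open>K\<close>, so that integrating over \<open>J\<close>
    leaves \<open>F1\<close> as a function of the value at \<open>v\<close> alone.\<close>
  define J where "J = V1 - {v}"
  define K where "K = I - J"
  define c where "c = (\<integral>\<^sup>+x. F1 (x(v := 0)) \<partial>PiM J (\<lambda>_. circle))"
  have "finite V1" using assms(1,2) by (rule finite_subset[rotated])
  then have fin: "finite J" "finite K" "K \<inter> J = {}"
    using assms(1) by (auto simp: J_def K_def)
  have I: "I = K \<union> J"
    using assms(2) unfolding J_def K_def by blast
  have F1_upd: "F1 (x(v := r)) = F1 (\<lambda>i\<in>I. if i = v then r else if i \<in> J then x i else 0)" for x r
    using assms(2) by (intro dep1) (auto simp: J_def)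
  have meas: "(\<lambda>x. F1 (x(v := r))) \<in> borel_measurable (PiM J (\<lambda>_. circle))" for r
  proof -
    have "(\<lambda>x. if i = v then r else if i \<in> J then x i else 0) \<in> PiM J (\<lambda>_. circle) \<rightarrow>\<^sub>M circle" for i
      by (cases "i = v"; cases "i \<in> J") auto
    then show ?thesis
      unfolding F1_upd by (rule measurable_compose[OF measurable_restrict assms(5)])
  qed
  \<comment> \<open>Translating by \<open>- r\<close> moves the pinned coordinate from
    \<open>r\<close> to 0, while the other coordinates keep their uniform law.\<close>
  have const: "(\<integral>\<^sup>+x. F1 (x(v := r)) \<partial>PiM J (\<lambda>_. circle)) = c" for r
  proof -
    have "(\<integral>\<^sup>+x. F1 (x(v := r)) \<partial>PiM J (\<lambda>_. circle))
        = (\<integral>\<^sup>+x. F1 ((\<lambda>i. x i + - r)(v := 0)) \<partial>PiM J (\<lambda>_. circle))"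
    proof (rule nn_integral_cong)
      fix x
      have "(\<lambda>i. (x(v := r)) i + - r) = (\<lambda>i. x i + - r)(v := 0)" by auto
      then show "F1 (x(v := r)) = F1 ((\<lambda>i. x i + - r)(v := 0))"
        using inv[of "x(v := r)" "- r"] by simp
    qed
    also have "\<dots> = c"
      unfolding c_def
    proof (rule nn_integral_circles_shift[where G = "\<lambda>x. F1 (x(v := 0))"])
      show "F1 (x(v := 0)) = F1 (y(v := 0))" if "\<And>i. i \<in> J \<Longrightarrow> x i = y i" for x y
        using that by (intro dep1) (auto simp: J_def)
      show "F1 (x(i := x i + 2, v := 0)) = F1 (x(v := 0))" if "i \<in> J" for x i
      proof -
        have "i \<noteq> v" using that by (auto simp: J_def)
        then show ?thesis using per[of "x(v := 0)" i] by (simp add: fun_upd_twist)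
      qed
    qed (use fin meas in auto)
    finally show ?thesis .
  qed
  have split: "(\<integral>\<^sup>+x. F1 x * F x \<partial>PiM I (\<lambda>_. circle)) = c * (\<integral>\<^sup>+x. F x \<partial>PiM K (\<lambda>_. circle))"
    if [measurable]: "F \<in> borel_measurable (PiM I (\<lambda>_. circle))" "F \<in> borel_measurable (PiM K (\<lambda>_. circle))"
      and dep: "\<And>x y. F (merge K J (x, y)) = F x" for F
  proof -
    have "(\<integral>\<^sup>+x. F1 x * F x \<partial>PiM I (\<lambda>_. circle))
      = (\<integral>\<^sup>+x. \<integral>\<^sup>+y. F1 (merge K J (x, y)) * F (merge K J (x, y)) \<partial>PiM J (\<lambda>_. circle) \<partial>PiM K (\<lambda>_. circle))"
      unfolding I by (rule circles.product_nn_integral_fold) (use fin in \<open>auto simp flip: I\<close>)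
    also have "\<dots> = (\<integral>\<^sup>+x. \<integral>\<^sup>+y. F1 (y(v := x v)) * F x \<partial>PiM J (\<lambda>_. circle) \<partial>PiM K (\<lambda>_. circle))"
    proof (intro nn_integral_cong)
      fix x y
      have "F1 (merge K J (x, y)) = F1 (y(v := x v))"
        using assms(2) by (intro dep1) (auto simp: merge_def J_def K_def)
      then show "F1 (merge K J (x, y)) * F (merge K J (x, y)) = F1 (y(v := x v)) * F x"
        by (simp add: dep)
    qed
    also have "\<dots> = (\<integral>\<^sup>+x. c * F x \<partial>PiM K (\<lambda>_. circle))"
      by (intro nn_integral_cong, subst nn_integral_multc[OF meas]) (simp add: const)
    also have "\<dots> = c * (\<integral>\<^sup>+x. F x \<partial>PiM K (\<lambda>_. circle))"
      by (rule nn_integral_cmult) measurable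
    finally show ?thesis .
  qed
  have "F2 = (\<lambda>x. F2 (\<lambda>i\<in>I. if i \<in> K then x i else 0))"
    using assms(3,4) by (intro ext dep2) (auto simp: J_def K_def)
  then have F2K: "F2 \<in> borel_measurable (PiM K (\<lambda>_. circle))"
  proof (rule ssubst)
    have "(\<lambda>x. if i \<in> K then x i else 0) \<in> PiM K (\<lambda>_. circle) \<rightarrow>\<^sub>M circle" for i
      by (cases "i \<in> K") auto
    then show "(\<lambda>x. F2 (\<lambda>i\<in>I. if i \<in> K then x i else 0)) \<in> borel_measurable (PiM K (\<lambda>_. circle))"
      by (rule measurable_compose[OF measurable_restrict assms(6)])
  qed
  have dep2': "F2 (merge K J (x, y)) = F2 x" for x y
    using assms(3,4) by (intro dep2) (auto simp: merge_def J_def K_def)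
  have "(\<integral>\<^sup>+x. F1 x \<partial>PiM I (\<lambda>_. circle)) = c"
    using split[of "\<lambda>_. 1", OF borel_measurable_const borel_measurable_const refl]
    by (simp only: mult_1_right nn_integral_circles_const)
  moreover have "(\<integral>\<^sup>+x. F2 x \<partial>PiM I (\<lambda>_. circle)) = (\<integral>\<^sup>+x. F2 x \<partial>PiM K (\<lambda>_. circle))"
  proof -
    have "(\<integral>\<^sup>+x. F2 x \<partial>PiM I (\<lambda>_. circle))
      = (\<integral>\<^sup>+x. \<integral>\<^sup>+y. F2 (merge K J (x, y)) \<partial>PiM J (\<lambda>_. circle) \<partial>PiM K (\<lambda>_. circle))"
      unfolding I by (rule circles.product_nn_integral_fold) (use fin in \<open>auto simp flip: I\<close>)
    then show ?thesis
      unfolding dep2' nn_integral_circles_const .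
  qed
  moreover have "(\<integral>\<^sup>+x. F1 x * F2 x \<partial>PiM I (\<lambda>_. circle)) = c * (\<integral>\<^sup>+x. F2 x \<partial>PiM K (\<lambda>_. circle))"
    using F2K dep2' by (intro split) auto
  ultimately show ?thesis by simp
qed

section \<open>One coordinate of a geometric graph\<close>

text \<open>Edges are unordered pairs, hence the existential; by symmetry of \<open>cdist\<close>
  the order chosen does not matter. The parameter \<open>B\<close> lets one theory serve both the
  near event \<open>{..t}\<close> and the far event \<open>{t<..}\<close>.\<close>

definition edge_ind :: "real set \<Rightarrow> (nat \<Rightarrow> real) \<Rightarrow> nat set \<Rightarrow> real" where
  "edge_ind B x e = (if \<exists>i j. i \<noteq> j \<and> e = {i, j} \<and> cdist (x i) (x j) \<in> B then 1 else 0)"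

definition edge_mean :: "nat \<Rightarrow> real set \<Rightarrow> nat set set \<Rightarrow> real" where
  "edge_mean n B T = (\<integral>x. (\<Prod>e\<in>T. edge_ind B x e) \<partial>PiM {..<n} (\<lambda>_. circle))"

lemma edge_ind_pair: "i \<noteq> j \<Longrightarrow> edge_ind B x {i, j} = indicator B (cdist (x i) (x j))"
  unfolding edge_ind_def by (auto simp: doubleton_eq_iff cdist_commute split: split_indicator)

lemma edge_ind_range: "0 \<le> edge_ind B x e" "edge_ind B x e \<le> 1"
  by (auto simp: edge_ind_def)

lemma prod_edge_ind_range: "0 \<le> (\<Prod>e\<in>T. edge_ind B x e)" "(\<Prod>e\<in>T. edge_ind B x e) \<le> 1"
  by (auto intro: prod_nonneg prod_le_1 simp: edge_ind_range)

lemma Kn_edgesE: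
  assumes "e \<in> Kn_edges n"
  obtains i j where "i < n" "j < n" "i \<noteq> j" "e = {i, j}"
  using assms by (auto simp: Kn_edges_def)

lemma Kn_edges_subset: "e \<in> Kn_edges n \<Longrightarrow> e \<subseteq> {..<n}"
  by (auto simp: Kn_edges_def)

lemma finite_Kn_edges [simp]: "finite (Kn_edges n)"
  by (rule finite_subset[of _ "Pow {..<n}"]) (auto simp: Kn_edges_def)

lemma edge_ind_measurable [measurable]:
  assumes "e \<in> Kn_edges n" and [measurable]: "B \<in> sets borel"
  shows "(\<lambda>x. edge_ind B x e) \<in> borel_measurable (PiM {..<n} (\<lambda>_. circle))"
proof -
  obtain i j where ij [simp]: "i < n" "j < n" "i \<noteq> j" "e = {i, j}"
    using assms(1) by (rule Kn_edgesE)
  show ?thesis by (simp add: edge_ind_pair)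
qed

lemma prod_edge_ind_measurable:
  assumes "T \<subseteq> Kn_edges n" "B \<in> sets borel"
  shows "(\<lambda>x. \<Prod>e\<in>T. edge_ind B x e) \<in> borel_measurable (PiM {..<n} (\<lambda>_. circle))"
  using assms by (intro borel_measurable_prod edge_ind_measurable) auto

lemma prod_edge_ind_integrable:
  assumes "T \<subseteq> Kn_edges n" "B \<in> sets borel"
  shows "integrable (PiM {..<n} (\<lambda>_. circle)) (\<lambda>x. \<Prod>e\<in>T. edge_ind B x e)"
  by (rule circle_power.integrable_const_bound[where B = 1])
     (auto simp: prod_edge_ind_range prod_edge_ind_measurable assms)

lemma ennreal_edge_mean:
  assumes "T \<subseteq> Kn_edges n" "B \<in> sets borel"
  shows "ennreal (edge_mean n B T)
    = (\<integral>\<^sup>+x. ennreal (\<Prod>e\<in>T. edge_ind B x e) \<partial>PiM {..<n} (\<lambda>_. circle))"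
  unfolding edge_mean_def using assms
  by (intro nn_integral_eq_integral[symmetric] prod_edge_ind_integrable) (auto simp: prod_edge_ind_range)

lemma edge_mean_nonneg: "0 \<le> edge_mean n B T"
  unfolding edge_mean_def by (intro integral_nonneg_AE AE_I2 prod_edge_ind_range)

lemma edge_mean_empty: "edge_mean n B {} = 1"
  using circle_power.prob_space by (simp add: edge_mean_def)

lemma edge_ind_cong:
  assumes "\<And>i. i \<in> e \<Longrightarrow> x i = y i"
  shows "edge_ind B x e = edge_ind B y e"
proof -
  have "(i \<noteq> j \<and> e = {i, j} \<and> cdist (x i) (x j) \<in> B) = (i \<noteq> j \<and> e = {i, j} \<and> cdist (y i) (y j) \<in> B)" for i j
    using assms by auto
  then show ?thesis by (simp add: edge_ind_def)
qed

lemma edge_ind_translate: "edge_ind B (\<lambda>i. x i + c) e = edge_ind B x e"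
  by (simp add: edge_ind_def cdist_translate)

lemma edge_ind_periodic: "edge_ind B (x(i := x i + 2)) e = edge_ind B x e"
proof -
  have "cdist ((x(i := x i + 2)) j) ((x(i := x i + 2)) k) = cdist (x j) (x k)" for j k
    using cdist_periodic cdist_commute by (simp add: cdist_translate)
  then show ?thesis by (simp add: edge_ind_def)
qed

text \<open>Given the shared point, the mean of the first product does not depend on its position,
  so the mean factors over a cut vertex. The bound \<open>{v}\<close> also covers disjoint vertex
  sets, and it excludes a common edge, since an edge has two vertices.\<close>

lemma edge_mean_Un:
  assumes T: "T1 \<subseteq> Kn_edges n" "T2 \<subseteq> Kn_edges n" and "B \<in> sets borel"
    and v: "\<Union>T1 \<inter> \<Union>T2 \<subseteq> {v}"
  shows "edge_mean n B (T1 \<union> T2) = edge_mean n B T1 * edge_mean n B T2"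
proof -
  have fin: "finite T1" "finite T2" using T finite_subset[OF _ finite_Kn_edges] by blast+
  have disj: "T1 \<inter> T2 = {}"
  proof (rule ccontr)
    assume "T1 \<inter> T2 \<noteq> {}"
    then obtain e where e: "e \<in> T1" "e \<in> T2" by auto
    then obtain i j where "i \<noteq> j" "e = {i, j}" using T(1) Kn_edgesE[of e n] by blast
    with e v show False by auto
  qed
  have "ennreal (edge_mean n B (T1 \<union> T2))
    = (\<integral>\<^sup>+x. ennreal (\<Prod>e\<in>T1. edge_ind B x e) * ennreal (\<Prod>e\<in>T2. edge_ind B x e) \<partial>PiM {..<n} (\<lambda>_. circle))"
    using assms fin disj
    by (subst ennreal_edge_mean) (auto simp: prod.union_disjoint ennreal_mult prod_edge_ind_range)
  also have "\<dots> = (\<integral>\<^sup>+x. ennreal (\<Prod>e\<in>T1. edge_ind B x e) \<partial>PiM {..<n} (\<lambda>_. circle))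
      * (\<integral>\<^sup>+x. ennreal (\<Prod>e\<in>T2. edge_ind B x e) \<partial>PiM {..<n} (\<lambda>_. circle))"
  proof (rule nn_integral_circles_split[where ?V1.0 = "\<Union>T1" and ?V2.0 = "\<Union>T2" and v = v])
    show "\<Union>T1 \<subseteq> {..<n}" "\<Union>T2 \<subseteq> {..<n}"
      using T Kn_edges_subset by blast+
    show "ennreal (\<Prod>e\<in>T1. edge_ind B x e) = ennreal (\<Prod>e\<in>T1. edge_ind B y e)"
      if "\<And>i. i \<in> \<Union>T1 \<Longrightarrow> x i = y i" for x y
      using that by (intro arg_cong[where f = ennreal] prod.cong edge_ind_cong) auto
    show "ennreal (\<Prod>e\<in>T2. edge_ind B x e) = ennreal (\<Prod>e\<in>T2. edge_ind B y e)"
      if "\<And>i. i \<in> \<Union>T2 \<Longrightarrow> x i = y i" for x y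
      using that by (intro arg_cong[where f = ennreal] prod.cong edge_ind_cong) auto
    show "(\<lambda>x. ennreal (\<Prod>e\<in>T1. edge_ind B x e)) \<in> borel_measurable (PiM {..<n} (\<lambda>_. circle))"
      using assms by (intro measurable_compose[OF prod_edge_ind_measurable measurable_ennreal])
    show "(\<lambda>x. ennreal (\<Prod>e\<in>T2. edge_ind B x e)) \<in> borel_measurable (PiM {..<n} (\<lambda>_. circle))"
      using assms by (intro measurable_compose[OF prod_edge_ind_measurable measurable_ennreal])
  qed (use v in \<open>simp_all add: edge_ind_translate edge_ind_periodic\<close>)
  also have "\<dots> = ennreal (edge_mean n B T1 * edge_mean n B T2)"
    using assms by (simp add: ennreal_edge_mean ennreal_mult edge_mean_nonneg)
  finally show ?thesis by (simp add: edge_mean_nonneg)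
qed

section \<open>Far edges in one coordinate\<close>

lemma edge_mean_gt_singleton:
  assumes "e \<in> Kn_edges n" "0 \<le> t" "t \<le> 1"
  shows "edge_mean n {t<..} {e} = 1 - t"
proof -
  obtain i j where ij: "i < n" "j < n" "i \<noteq> j" "e = {i, j}"
    using assms(1) by (rule Kn_edgesE)
  define I where "I = {..<n} - {j}"
  have ins: "{..<n} = insert j I" and I: "finite I" "j \<notin> I" using ij by (auto simp: I_def)
  have "(\<lambda>x. ennreal (edge_ind {t<..} x e)) \<in> borel_measurable (PiM (insert j I) (\<lambda>_. circle))"
    using edge_ind_measurable[OF assms(1), of "{t<..}"] unfolding ins by simp
  then have "ennreal (edge_mean n {t<..} {e})
      = (\<integral>\<^sup>+x. \<integral>\<^sup>+y. ennreal (edge_ind {t<..} (x(j := y)) e) \<partial>circle \<partial>PiM I (\<lambda>_. circle))"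
    using assms(1) I circles.product_nn_integral_insert[of I j "\<lambda>x. ennreal (edge_ind {t<..} x e)"]
    by (subst ennreal_edge_mean) (auto simp: ins)
  also have "\<dots> = (\<integral>\<^sup>+x. ennreal (1 - t) \<partial>PiM I (\<lambda>_. circle))"
    using nn_integral_cdist_gt[OF assms(2,3)] ij
    by (simp add: edge_ind_pair ennreal_indicator)
  also have "\<dots> = ennreal (1 - t)"
    by (rule nn_integral_circles_const)
  finally show ?thesis using assms by (simp add: edge_mean_nonneg)
qed

text \<open>A pendant or isolated edge splits off as an independent factor; repeated use treats
  forests.\<close>

lemma edge_mean_insert:
  assumes "e \<in> Kn_edges n" "T \<subseteq> Kn_edges n" "0 \<le> t" "t \<le> 1" "e \<inter> \<Union>T \<subseteq> {v}"
  shows "edge_mean n {t<..} (insert e T) = (1 - t) * edge_mean n {t<..} T"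
  using edge_mean_Un[of "{e}" n T "{t<..}" v] assms by (simp add: edge_mean_gt_singleton)

lemma edge_mean_mono:
  assumes "S \<subseteq> T" "T \<subseteq> Kn_edges n" "B \<in> sets borel"
  shows "edge_mean n B T \<le> edge_mean n B S"
  unfolding edge_mean_def
proof (rule integral_mono)
  fix x
  have fin: "finite T" using assms finite_subset[OF _ finite_Kn_edges] by blast
  have "(\<Prod>e\<in>T. edge_ind B x e) = (\<Prod>e\<in>T - S. edge_ind B x e) * (\<Prod>e\<in>S. edge_ind B x e)"
    using assms fin by (intro prod.subset_diff) auto
  also have "\<dots> \<le> 1 * (\<Prod>e\<in>S. edge_ind B x e)"
    by (intro mult_right_mono prod_edge_ind_range)
  finally show "(\<Prod>e\<in>T. edge_ind B x e) \<le> (\<Prod>e\<in>S. edge_ind B x e)" by simp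
qed (use assms in \<open>auto intro!: prod_edge_ind_integrable\<close>)

lemma Kn_edges_inter_singleton:
  assumes "e1 \<in> Kn_edges n" "e2 \<in> Kn_edges n" "e1 \<noteq> e2"
  obtains v where "e1 \<inter> e2 \<subseteq> {v}"
proof -
  obtain i j where "i \<noteq> j" "e1 = {i, j}" using assms(1) by (rule Kn_edgesE)
  moreover obtain k l where "k \<noteq> l" "e2 = {k, l}" using assms(2) by (rule Kn_edgesE)
  ultimately have "e1 \<inter> e2 \<subseteq> {i} \<or> e1 \<inter> e2 \<subseteq> {j}" using assms(3) by auto
  then show ?thesis using that by blast
qed

lemma edge_mean_card_le_2:
  assumes T: "T \<subseteq> Kn_edges n" and t: "0 \<le> t" "t \<le> 1" and "card T \<le> 2"
  shows "edge_mean n {t<..} T = (1 - t) ^ card T"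
proof -
  have fin: "finite T" using T finite_subset[OF _ finite_Kn_edges] by blast
  consider "card T = 0" | "card T = 1" | "card T = 2" using assms(4) by linarith
  then show ?thesis
  proof cases
    case 1
    then show ?thesis using fin by (simp add: edge_mean_empty)
  next
    case 2
    then obtain e where "T = {e}" by (auto simp: card_1_singleton_iff)
    then show ?thesis using T t by (simp add: edge_mean_gt_singleton)
  next
    case 3
    then obtain e1 e2 where T_eq: "T = {e1, e2}" "e1 \<noteq> e2" by (auto simp: card_2_iff)
    then obtain v where "e1 \<inter> e2 \<subseteq> {v}" using T Kn_edges_inter_singleton[of e1 n e2] by auto
    then show ?thesis
      using edge_mean_insert[of e1 n "{e2}" t v] T t T_eq 3
      by (simp add: edge_mean_gt_singleton power2_eq_square)
  qed
qed

lemma edge_mean_three: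
  assumes T: "e1 \<in> Kn_edges n" "e2 \<in> Kn_edges n" "e3 \<in> Kn_edges n"
    and ne: "e1 \<noteq> e2" and t: "0 \<le> t" "t \<le> 1" and v: "e3 \<inter> (e1 \<union> e2) \<subseteq> {v}"
  shows "edge_mean n {t<..} {e1, e2, e3} = (1 - t) ^ 3"
proof -
  have "edge_mean n {t<..} (insert e3 {e1, e2}) = (1 - t) * (1 - t) ^ 2"
    using edge_mean_insert[of e3 n "{e1, e2}" t v] edge_mean_card_le_2[of "{e1, e2}" n t] assms
    by (simp add: power2_eq_square)
  moreover have "insert e3 {e1, e2} = {e1, e2, e3}" by auto
  ultimately show ?thesis by (simp add: power3_eq_cube power2_eq_square mult.assoc)
qed

text \<open>An edge meeting the union of the other two in more than one vertex is contained in that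
  union. In a path this happens only for the middle edge; if it happens for both \<open>e3\<close>
  and \<open>e1\<close>, the three edges close up. So testing these two is enough.\<close>

lemma three_edges_cases:
  assumes T: "e1 \<in> Kn_edges n" "e2 \<in> Kn_edges n" "e3 \<in> Kn_edges n"
    and ne: "e1 \<noteq> e2" "e1 \<noteq> e3" "e2 \<noteq> e3"
  obtains v where "e3 \<inter> (e1 \<union> e2) \<subseteq> {v}" | v where "e1 \<inter> (e2 \<union> e3) \<subseteq> {v}"
  | a b c where "a \<noteq> b" "b \<noteq> c" "a \<noteq> c" "e1 = {a, b}" "e2 = {b, c}" "e3 = {a, c}"
proof -
  have sub: "e \<subseteq> A" if "e \<in> Kn_edges n" "\<nexists>v. e \<inter> A \<subseteq> {v}" for e A :: "nat set"
  proof -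
    obtain i j where "i \<noteq> j" "e = {i, j}" using \<open>e \<in> Kn_edges n\<close> by (rule Kn_edgesE)
    moreover have "\<not> e \<inter> A \<subseteq> {i}" "\<not> e \<inter> A \<subseteq> {j}" using that(2) by blast+
    ultimately show ?thesis by auto
  qed
  have eq: "e = {i, j}" if e: "e \<in> Kn_edges n" "i \<in> e" "j \<in> e" "i \<noteq> j" for e :: "nat set" and i j
  proof -
    obtain k l where "k \<noteq> l" "e = {k, l}" using e(1) by (rule Kn_edgesE)
    then show ?thesis using e by auto
  qed
  show ?thesis
  proof (cases "(\<exists>v. e3 \<inter> (e1 \<union> e2) \<subseteq> {v}) \<or> (\<exists>v. e1 \<inter> (e2 \<union> e3) \<subseteq> {v})")
    case True
    then show ?thesis using that(1,2) by blast
  next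
    case False
    then have s3: "e3 \<subseteq> e1 \<union> e2" and s1: "e1 \<subseteq> e2 \<union> e3" using sub T by blast+
    obtain x y where xy: "x \<noteq> y" "e3 = {x, y}" using T(3) by (rule Kn_edgesE)
    \<comment> \<open>Two end points of \<open>e3\<close> inside \<open>e1\<close> or
      \<open>e2\<close> would make the edges equal, so each of these contains exactly one of them;
      these become \<open>a\<close> and \<open>c\<close>.\<close>
    have n1: "\<not> (x \<in> e1 \<and> y \<in> e1)" using eq[OF T(1), of x y] xy ne(2) by auto
    have n2: "\<not> (x \<in> e2 \<and> y \<in> e2)" using eq[OF T(2), of x y] xy ne(3) by auto
    obtain a c where ac: "a \<noteq> c" "e3 = {a, c}" "a \<in> e1" "c \<notin> e1" "c \<in> e2" "a \<notin> e2"
    proof (cases "x \<in> e1")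
      case True
      then show ?thesis using n1 n2 s3 xy that[of x y] by auto
    next
      case False
      then show ?thesis using n1 n2 s3 xy that[of y x] by (auto simp: insert_commute)
    qed
    obtain b where b: "b \<noteq> a" "e1 = {a, b}"
    proof -
      obtain i j where "i \<noteq> j" "e1 = {i, j}" using T(1) by (rule Kn_edgesE)
      then show ?thesis using ac(3) that[of i] that[of j] by (auto simp: insert_commute)
    qed
    then have "b \<in> e2" "b \<noteq> c" using s1 ac by auto
    then have "e2 = {b, c}" using eq[OF T(2)] ac(5) by auto
    then show ?thesis using that(3)[of a b c] b ac \<open>b \<noteq> c\<close> by auto
  qed
qed

text \<open>Two odd integers add up to an even one, whereas \<open>a - c\<close> would have to be
  close to an odd one. The three errors are below \<open>1 - t < 1 / 3\<close> each, hence below 1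
  together, too little to bridge the gap: this fixes \<open>2 / 3\<close>.\<close>

lemma cdist_triangle_gt:
  assumes "2 / 3 < t" "cdist a b > t" "cdist b c > t"
  shows "cdist a c \<le> t"
proof (rule ccontr)
  assume "\<not> cdist a c \<le> t"
  then obtain m1 m2 m3 :: int where
    "\<bar>a - b - (2 * of_int m1 + 1)\<bar> < 1 - t" "\<bar>b - c - (2 * of_int m2 + 1)\<bar> < 1 - t"
    "\<bar>a - c - (2 * of_int m3 + 1)\<bar> < 1 - t"
    using assms cdist_gt_iff[of t a b] cdist_gt_iff[of t b c] cdist_gt_iff[of t a c] by auto
  then have "\<bar>real_of_int (2 * (m1 + m2 - m3) + 1)\<bar> < 1"
    using assms(1) by simp
  then have "\<bar>2 * (m1 + m2 - m3) + 1\<bar> < 1" by linarith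
  then show False by presburger
qed

lemma edge_mean_triangle:
  assumes "2 / 3 < t" "a \<noteq> b" "b \<noteq> c" "a \<noteq> c"
  shows "edge_mean n {t<..} {{a, b}, {b, c}, {a, c}} = 0"
proof -
  have "edge_ind {t<..} x {a, b} * (edge_ind {t<..} x {b, c} * edge_ind {t<..} x {a, c}) = 0" for x
    using cdist_triangle_gt[OF assms(1), of "x a" "x b" "x c"] assms
    by (auto simp: edge_ind_pair split: split_indicator)
  then have "(\<Prod>e\<in>{{a, b}, {b, c}, {a, c}}. edge_ind {t<..} x e) = 0" for x
    using assms by (simp add: doubleton_eq_iff)
  then show ?thesis unfolding edge_mean_def by (simp only: integral_zero)
qed

text \<open>Of any three of the edges, either one meets the others in at most one vertex or they
  form a triangle: probability \<open>(1 - t) ^ 3\<close> or 0. Further edges only shrink the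
  event.\<close>

lemma edge_mean_card_ge_3:
  assumes T: "T \<subseteq> Kn_edges n" and t: "2 / 3 < t" "t \<le> 1" and "3 \<le> card T"
  shows "edge_mean n {t<..} T \<le> (1 - t) ^ 3"
proof -
  obtain S where S: "S \<subseteq> T" "card S = 3" using obtain_subset_with_card_n[OF assms(4)] by metis
  then obtain e1 e2 e3 where S_eq: "S = {e1, e2, e3}" and ne: "e1 \<noteq> e2" "e1 \<noteq> e3" "e2 \<noteq> e3"
    by (auto simp: card_3_iff)
  have e: "e1 \<in> Kn_edges n" "e2 \<in> Kn_edges n" "e3 \<in> Kn_edges n" using S S_eq T by auto
  from e ne have "edge_mean n {t<..} S \<le> (1 - t) ^ 3"
  proof (cases rule: three_edges_cases)
    case (1 v)
    then show ?thesis using edge_mean_three[OF e ne(1), of t v] t S_eq by simp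
  next
    case (2 v)
    moreover have "S = {e2, e3, e1}" using S_eq by auto
    ultimately show ?thesis using edge_mean_three[OF e(2,3,1) ne(3), of t v] t by simp
  next
    case (3 a b c)
    then show ?thesis using edge_mean_triangle[of t a b c n] t S_eq by simp
  qed
  with edge_mean_mono[OF S(1) T, of "{t<..}"] show ?thesis by simp
qed

section \<open>Inclusion-exclusion over the far edges\<close>

lemma edge_mean_le_incl_excl:
  assumes S: "S \<subseteq> Kn_edges n"
  shows "edge_mean n {..t} S = (\<Sum>T\<in>Pow S. (-1) ^ card T * edge_mean n {t<..} T)"
proof -
  have fin: "finite S" using S finite_subset[OF _ finite_Kn_edges] by blast
  have "(\<Prod>e\<in>S. edge_ind {..t} x e) = (\<Sum>T\<in>Pow S. (-1) ^ card T * (\<Prod>e\<in>T. edge_ind {t<..} x e))" for x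
  proof -
    have "edge_ind {..t} x e = - edge_ind {t<..} x e + 1" if "e \<in> S" for e
    proof -
      have "e \<in> Kn_edges n" using that S by blast
      then obtain i j where "i \<noteq> j" "e = {i, j}" by (rule Kn_edgesE)
      then show ?thesis by (auto simp: edge_ind_pair split: split_indicator)
    qed
    then have "(\<Prod>e\<in>S. edge_ind {..t} x e) = (\<Prod>e\<in>S. - edge_ind {t<..} x e + 1)"
      by (rule prod.cong[OF refl])
    also have "\<dots> = (\<Sum>T\<in>Pow S. (\<Prod>e\<in>T. - edge_ind {t<..} x e) * (\<Prod>e\<in>S - T. 1))"
      using fin by (rule prod_add)
    finally show ?thesis by (simp add: prod_uminus)
  qed
  then have "edge_mean n {..t} S = (\<integral>x. (\<Sum>T\<in>Pow S. (-1) ^ card T * (\<Prod>e\<in>T. edge_ind {t<..} x e)) \<partial>PiM {..<n} (\<lambda>_. circle))"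
    unfolding edge_mean_def by (simp only:)
  also have "\<dots> = (\<Sum>T\<in>Pow S. \<integral>x. (-1) ^ card T * (\<Prod>e\<in>T. edge_ind {t<..} x e) \<partial>PiM {..<n} (\<lambda>_. circle))"
    using S by (intro Bochner_Integration.integral_sum integrable_mult_right prod_edge_ind_integrable) auto
  finally show ?thesis unfolding edge_mean_def by (simp only: integral_mult_right_zero)
qed

text \<open>The independent counterpart of the expansion above. Subtracting the two compares
  \<open>edge_mean\<close> with independence one subset at a time.\<close>

lemma power_incl_excl:
  assumes "finite S"
  shows "(t::real) ^ card S = (\<Sum>T\<in>Pow S. (-1) ^ card T * (1 - t) ^ card T)"
proof -
  have "t ^ card S = (\<Prod>e\<in>S. - (1 - t) + 1)" by simp
  also have "\<dots> = (\<Sum>T\<in>Pow S. (\<Prod>e\<in>T. - (1 - t)) * (\<Prod>e\<in>S - T. 1))"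
    using assms by (rule prod_add)
  also have "\<dots> = (\<Sum>T\<in>Pow S. (-1) ^ card T * (1 - t) ^ card T)"
    by (simp only: prod_uminus prod_constant power_one mult_1_right)
  finally show ?thesis .
qed

text \<open>Subsets of at most two edges cancel. For a larger subset both terms lie between 0 and
  \<open>(1 - t) ^ 3\<close>, which therefore bounds their difference, and there are
  \<open>2 ^ card S\<close> subsets.\<close>

lemma edge_mean_le_approx:
  assumes S: "S \<subseteq> Kn_edges n" and t: "2 / 3 < t" "t \<le> 1"
  shows "\<bar>edge_mean n {..t} S - t ^ card S\<bar> \<le> 2 ^ card S * (1 - t) ^ 3"
proof -
  have fin: "finite S" using S finite_subset[OF _ finite_Kn_edges] by blast
  have "edge_mean n {..t} S - t ^ card S
      = (\<Sum>T\<in>Pow S. (-1) ^ card T * (edge_mean n {t<..} T - (1 - t) ^ card T))"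
    using S fin
    by (simp add: edge_mean_le_incl_excl power_incl_excl[of S t] right_diff_distrib sum_subtractf)
  also have "\<bar>\<dots>\<bar> \<le> (\<Sum>T\<in>Pow S. \<bar>(-1) ^ card T * (edge_mean n {t<..} T - (1 - t) ^ card T)\<bar>)"
    by (rule sum_abs)
  also have "\<dots> \<le> (\<Sum>T\<in>Pow S. (1 - t) ^ 3)"
  proof (rule sum_mono)
    fix T assume "T \<in> Pow S"
    then have T: "T \<subseteq> Kn_edges n" using S by auto
    have "\<bar>edge_mean n {t<..} T - (1 - t) ^ card T\<bar> \<le> (1 - t) ^ 3"
    proof (cases "card T \<le> 2")
      case True
      then show ?thesis using edge_mean_card_le_2[OF T, of t] t by simp
    next
      case False
      have "(1 - t) ^ card T \<le> (1 - t) ^ 3" using False t by (intro power_decreasing) auto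
      moreover have "0 \<le> (1 - t) ^ card T" using t by simp
      moreover have "edge_mean n {t<..} T \<le> (1 - t) ^ 3"
        using False edge_mean_card_ge_3[OF T t] by simp
      ultimately show ?thesis using edge_mean_nonneg[of n "{t<..}" T] by linarith
    qed
    then show "\<bar>(-1) ^ card T * (edge_mean n {t<..} T - (1 - t) ^ card T)\<bar> \<le> (1 - t) ^ 3"
      by (simp add: abs_mult power_abs)
  qed
  also have "\<dots> = 2 ^ card S * (1 - t) ^ 3" using fin by (simp add: card_Pow)
  finally show ?thesis .
qed

section \<open>Triangles and 4-cycles in one coordinate\<close>

lemma lessThan_3: "{..<3} = {0, 1, 2::nat}" and lessThan_4: "{..<4} = {0, 1, 2, 3::nat}"
  by auto

lemma cycle_copies_3E:
  assumes "H \<in> cycle_copies 3 n"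
  obtains a b c where "a < n" "b < n" "c < n" "distinct [a, b, c]" "H = {{a, b}, {b, c}, {a, c}}"
proof -
  obtain v where v: "inj_on v {..<3}" "v ` {..<3} \<subseteq> {..<n}" "H = (\<lambda>i. {v i, v (Suc i mod 3)}) ` {..<3}"
    using assms by (auto simp: cycle_copies_def)
  have "distinct [v 0, v 1, v 2]"
    using v(1) by (auto simp: lessThan_3 inj_on_def)
  moreover have "Suc 2 mod 3 = 0" "Suc 1 mod 3 = 2" "Suc 0 mod 3 = 1" by auto
  then have "H = {{v 0, v 1}, {v 1, v 2}, {v 0, v 2}}"
    using v(3) unfolding lessThan_3 by (simp only: image_insert image_empty) (simp add: insert_commute)
  moreover have "v 0 < n" "v 1 < n" "v 2 < n" using v(2) unfolding lessThan_3 by auto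
  ultimately show ?thesis using that by blast
qed

lemma cycle_copies_4E:
  assumes "H \<in> cycle_copies 4 n"
  obtains a b c e where "a < n" "b < n" "c < n" "e < n" "distinct [a, b, c, e]"
    "H = {{a, b}, {b, c}, {c, e}, {a, e}}"
proof -
  obtain v where v: "inj_on v {..<4}" "v ` {..<4} \<subseteq> {..<n}" "H = (\<lambda>i. {v i, v (Suc i mod 4)}) ` {..<4}"
    using assms by (auto simp: cycle_copies_def)
  have "distinct [v 0, v 1, v 2, v 3]"
    using v(1) by (auto simp: lessThan_4 inj_on_def)
  moreover have "Suc 2 mod 4 = 3" "Suc 3 mod 4 = 0" "Suc 1 mod 4 = 2" "Suc 0 mod 4 = 1" by auto
  then have "H = {{v 0, v 1}, {v 1, v 2}, {v 2, v 3}, {v 0, v 3}}"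
    using v(3) unfolding lessThan_4 by (simp only: image_insert image_empty) (simp add: insert_commute)
  moreover have "v 0 < n" "v 1 < n" "v 2 < n" "v 3 < n" using v(2) unfolding lessThan_4 by auto
  ultimately show ?thesis using that by blast
qed

lemma card_cycle_copy:
  assumes "H \<in> cycle_copies k n" "k = 3 \<or> k = 4"
  shows "card H = k"
  using assms(2)
proof
  assume k: "k = 3"
  then obtain a b c where "a < n" "b < n" "c < n" "distinct [a, b, c]" "H = {{a, b}, {b, c}, {a, c}}"
    using assms(1) by (auto elim: cycle_copies_3E)
  then show ?thesis using k by (auto simp: doubleton_eq_iff)
next
  assume k: "k = 4"
  then obtain a b c e where "a < n" "b < n" "c < n" "e < n" "distinct [a, b, c, e]" "H = {{a, b}, {b, c}, {c, e}, {a, e}}"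
    using assms(1) by (auto elim: cycle_copies_4E)
  then show ?thesis using k by (auto simp: doubleton_eq_iff)
qed

lemma cycle_copy_subset:
  assumes "H \<in> cycle_copies k n" "k = 3 \<or> k = 4"
  shows "H \<subseteq> Kn_edges n"
  using assms(2)
proof
  assume k: "k = 3"
  then obtain a b c where "a < n" "b < n" "c < n" "distinct [a, b, c]" "H = {{a, b}, {b, c}, {a, c}}"
    using assms(1) by (auto elim: cycle_copies_3E)
  then show ?thesis by (auto simp: Kn_edges_def)
next
  assume k: "k = 4"
  then obtain a b c e where "a < n" "b < n" "c < n" "e < n" "distinct [a, b, c, e]"
      "H = {{a, b}, {b, c}, {c, e}, {a, e}}"
    using assms(1) by (auto elim: cycle_copies_4E)
  then show ?thesis by (auto simp: Kn_edges_def)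
qed

text \<open>Removing an edge leaves a forest. Only three edges of a 4-cycle go beyond the two-edge
  case; they form a path, whose end edge is pendant.\<close>

lemma edge_mean_cycle_subset:
  assumes H: "H \<in> cycle_copies k n" and k: "k = 3 \<or> k = 4" and T: "T \<subset> H" and t: "0 \<le> t" "t \<le> 1"
  shows "edge_mean n {t<..} T = (1 - t) ^ card T"
  using k
proof
  assume "k = 3"
  have HK: "H \<subseteq> Kn_edges n" using cycle_copy_subset[OF H k] .
  then have "finite H" using finite_subset[OF _ finite_Kn_edges] by blast
  then have "card T < card H" using T by (intro psubset_card_mono)
  then have "card T \<le> 2" using card_cycle_copy[OF H k] \<open>k = 3\<close> by simp
  then show ?thesis using edge_mean_card_le_2[of T n t] t T HK by auto
next
  assume "k = 4"
  then obtain a b c e where H_eq: "a < n" "b < n" "c < n" "e < n" "distinct [a, b, c, e]"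
    "H = {{a, b}, {b, c}, {c, e}, {a, e}}"
    using H by (auto elim: cycle_copies_4E)
  have HK: "{a, b} \<in> Kn_edges n" "{b, c} \<in> Kn_edges n" "{c, e} \<in> Kn_edges n" "{a, e} \<in> Kn_edges n"
    using H_eq by (auto simp: Kn_edges_def)
  have fin: "finite H" using H_eq by simp
  have ne: "{a, b} \<noteq> {b, c}" "{b, c} \<noteq> {c, e}" "{c, e} \<noteq> {a, e}" "{a, e} \<noteq> {a, b}"
    "{a, b} \<noteq> {c, e}" "{b, c} \<noteq> {a, e}"
    using H_eq(5) by (auto simp: doubleton_eq_iff)
  have cardH: "card H = 4" unfolding H_eq(6) using ne by (auto simp: doubleton_eq_iff)
  have TK: "T \<subseteq> Kn_edges n" using H_eq(6) HK T by auto
  have "card T < card H" using T fin by (intro psubset_card_mono)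
  then consider "card T \<le> 2" | "card T = 3" using cardH by linarith
  then show ?thesis
  proof cases
    case 1
    then show ?thesis using edge_mean_card_le_2[OF TK t] by simp
  next
    case 2
    obtain f where f: "f \<in> H" "f \<notin> T" using T by auto
    then have "T \<subseteq> H - {f}" using T by auto
    moreover have "card (H - {f}) = 3" using f fin cardH by simp
    ultimately have Tf: "T = H - {f}" using 2 fin by (intro card_subset_eq) auto
    have "edge_mean n {t<..} T = (1 - t) ^ 3"
    proof -
      consider "f = {a, b}" | "f = {b, c}" | "f = {c, e}" | "f = {a, e}" using f H_eq(6) by auto
      then show ?thesis
      proof cases
        case 1
        then have T_eq: "T = {{b, c}, {c, e}, {a, e}}" unfolding Tf H_eq(6) using ne by (simp add: insert_Diff_if ne ne[symmetric] insert_commute)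
        have "{a, e} \<inter> ({b, c} \<union> {c, e}) \<subseteq> {e}" using H_eq(5) by auto
        from edge_mean_three[OF HK(2,3,4) ne(2) t this] show ?thesis by (simp only: T_eq)
      next
        case 2
        then have T_eq: "T = {{c, e}, {a, e}, {a, b}}" unfolding Tf H_eq(6) using ne by (simp add: insert_Diff_if ne ne[symmetric] insert_commute)
        have "{a, b} \<inter> ({c, e} \<union> {a, e}) \<subseteq> {a}" using H_eq(5) by auto
        from edge_mean_three[OF HK(3,4,1) ne(3) t this] show ?thesis by (simp only: T_eq)
      next
        case 3
        then have T_eq: "T = {{a, e}, {a, b}, {b, c}}" unfolding Tf H_eq(6) using ne by (simp add: insert_Diff_if ne ne[symmetric] insert_commute)
        have "{b, c} \<inter> ({a, e} \<union> {a, b}) \<subseteq> {b}" using H_eq(5) by auto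
        from edge_mean_three[OF HK(4,1,2) ne(4) t this] show ?thesis by (simp only: T_eq)
      next
        case 4
        then have T_eq: "T = {{a, b}, {b, c}, {c, e}}" unfolding Tf H_eq(6) using ne by (simp add: insert_Diff_if ne ne[symmetric] insert_commute)
        have "{c, e} \<inter> ({a, b} \<union> {b, c}) \<subseteq> {c}" using H_eq(5) by auto
        from edge_mean_three[OF HK(1,2,3) ne(1) t this] show ?thesis by (simp only: T_eq)
      qed
    qed
    then show ?thesis using 2 by simp
  qed
qed

text \<open>Three odd integers add up to an odd one, and three errors below
  \<open>(1 - t) / 3\<close> add up to one below \<open>1 - t\<close>.\<close>

lemma cdist_path_gt:
  assumes "0 \<le> t" "t \<le> 1" "cdist a b > 1 - (1 - t) / 3" "cdist b c > 1 - (1 - t) / 3" "cdist c e > 1 - (1 - t) / 3"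
  shows "cdist a e > t"
proof -
  have "0 \<le> 1 - (1 - t) / 3" using assms(1,2) by simp
  then obtain m1 m2 m3 :: int where
    "\<bar>a - b - (2 * of_int m1 + 1)\<bar> < (1 - t) / 3" "\<bar>b - c - (2 * of_int m2 + 1)\<bar> < (1 - t) / 3"
    "\<bar>c - e - (2 * of_int m3 + 1)\<bar> < (1 - t) / 3"
    using assms cdist_gt_iff[of "1 - (1 - t) / 3" a b] cdist_gt_iff[of "1 - (1 - t) / 3" b c]
      cdist_gt_iff[of "1 - (1 - t) / 3" c e] by auto
  moreover have "a - e - (2 * of_int (m1 + m2 + m3 + 1) + 1)
      = (a - b - (2 * of_int m1 + 1)) + (b - c - (2 * of_int m2 + 1)) + (c - e - (2 * of_int m3 + 1))"
    by simp
  moreover have "\<bar>x + y + z\<bar> < s + s + s" if "\<bar>x\<bar> < s" "\<bar>y\<bar> < s" "\<bar>z\<bar> < s" for x y z s :: real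
    using that by linarith
  ultimately have "\<bar>a - e - (2 * of_int (m1 + m2 + m3 + 1) + 1)\<bar> < (1 - t) / 3 + (1 - t) / 3 + (1 - t) / 3"
    by presburger
  moreover have "(1 - t) / 3 + (1 - t) / 3 + (1 - t) / 3 = 1 - t" by (simp add: field_simps)
  ultimately have "\<bar>a - e - (2 * of_int (m1 + m2 + m3 + 1) + 1)\<bar> < 1 - t" by (simp only:)
  then show ?thesis using cdist_gt_iff[of t a e] assms(1) by blast
qed

text \<open>Three edges that are far at the stricter threshold \<open>s\<close> force all four to be
  far at \<open>t\<close>. They form a path, so the probability of the smaller event is an exact
  cube.\<close>

lemma edge_mean_4_cycle_ge:
  assumes H: "a < n" "b < n" "c < n" "e < n" "distinct [a, b, c, e]" and t: "0 \<le> t" "t \<le> 1"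
  shows "((1 - t) / 3) ^ 3 \<le> edge_mean n {t<..} {{a, b}, {b, c}, {c, e}, {a, e}}"
proof -
  define s where "s = 1 - (1 - t) / 3"
  have s: "0 \<le> s" "s \<le> 1" "t \<le> s" "1 - s = (1 - t) / 3" using t by (auto simp: s_def field_simps)
  have HK: "{a, b} \<in> Kn_edges n" "{b, c} \<in> Kn_edges n" "{c, e} \<in> Kn_edges n" "{a, e} \<in> Kn_edges n"
    using H by (auto simp: Kn_edges_def)
  have ne: "{a, b} \<noteq> {b, c}" "{b, c} \<noteq> {c, e}" "{c, e} \<noteq> {a, e}" "{a, e} \<noteq> {a, b}"
    "{a, b} \<noteq> {c, e}" "{b, c} \<noteq> {a, e}"
    using H(5) by (auto simp: doubleton_eq_iff)
  have "((1 - t) / 3) ^ 3 = edge_mean n {s<..} {{a, b}, {b, c}, {c, e}}"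
    unfolding s(4)[symmetric] using H(5) by (intro edge_mean_three[OF HK(1,2,3) ne(1) s(1,2), of c, symmetric]) auto
  also have "\<dots> \<le> edge_mean n {t<..} {{a, b}, {b, c}, {c, e}, {a, e}}"
    unfolding edge_mean_def
  proof (rule integral_mono)
    fix x
    have "edge_ind {s<..} x {a, b} * (edge_ind {s<..} x {b, c} * edge_ind {s<..} x {c, e})
      \<le> edge_ind {t<..} x {a, b} * (edge_ind {t<..} x {b, c} * (edge_ind {t<..} x {c, e} * edge_ind {t<..} x {a, e}))"
      using H(5) s(3) cdist_path_gt[OF t, of "x a" "x b" "x c" "x e"]
      by (auto simp: edge_ind_pair s_def split: split_indicator)
    then show "(\<Prod>e\<in>{{a, b}, {b, c}, {c, e}}. edge_ind {s<..} x e)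
      \<le> (\<Prod>e\<in>{{a, b}, {b, c}, {c, e}, {a, e}}. edge_ind {t<..} x e)"
      by (simp add: ne ne[symmetric])
  qed (use HK in \<open>intro prod_edge_ind_integrable; simp\<close>)+
  finally show ?thesis .
qed

lemma edge_mean_le_cycle_subset:
  assumes H: "H \<in> cycle_copies k n" "k = 3 \<or> k = 4" and S: "S \<subset> H" and t: "0 \<le> t" "t \<le> 1"
  shows "edge_mean n {..t} S = t ^ card S"
proof -
  have "S \<subseteq> Kn_edges n" using S cycle_copy_subset[OF H] by blast
  then have "finite S" using finite_subset[OF _ finite_Kn_edges] by blast
  have "T \<subset> H" if "T \<in> Pow S" for T using that S by auto
  then show ?thesis
    unfolding edge_mean_le_incl_excl[OF \<open>S \<subseteq> Kn_edges n\<close>] power_incl_excl[OF \<open>finite S\<close>]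
    by (intro sum.cong refl) (simp add: edge_mean_cycle_subset[OF H _ t])
qed

text \<open>Only the full cycle survives in the difference of the two expansions, with sign
  \<open>(-1) ^ k\<close>. For the triangle it yields \<open>(1 - t) ^ 3\<close>. For the 4-cycle it
  yields at least \<open>(1 - t) ^ 3 / 27 - (1 - t) ^ 4\<close>, and \<open>1 - t <= 1 / 54\<close>
  keeps half of the first term; hence 54.\<close>

lemma edge_mean_le_cycle_ge:
  assumes H: "H \<in> cycle_copies k n" "k = 3 \<or> k = 4" and t: "53 / 54 \<le> t" "t \<le> 1"
  shows "t ^ k + (1 - t) ^ 3 / 54 \<le> edge_mean n {..t} H"
proof -
  have HK: "H \<subseteq> Kn_edges n" using cycle_copy_subset[OF H] .
  have fin: "finite H" using HK finite_subset[OF _ finite_Kn_edges] by blast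
  have t0: "0 \<le> t" "2 / 3 < t" using t by auto
  have "edge_mean n {..t} H - t ^ card H
      = (\<Sum>T\<in>Pow H. (-1) ^ card T * (edge_mean n {t<..} T - (1 - t) ^ card T))"
    by (simp add: edge_mean_le_incl_excl[OF HK] power_incl_excl[OF fin, of t] right_diff_distrib sum_subtractf)
  also have "\<dots> = (\<Sum>T\<in>{H}. (-1) ^ card T * (edge_mean n {t<..} T - (1 - t) ^ card T))"
    using fin edge_mean_cycle_subset[OF H _ t0(1) t(2)] by (intro sum.mono_neutral_right) auto
  finally have eq: "edge_mean n {..t} H = t ^ k + (-1) ^ k * (edge_mean n {t<..} H - (1 - t) ^ k)"
    using card_cycle_copy[OF H] by simp
  have nn: "0 \<le> (1 - t) ^ 3" using t by simp
  from H(2) have "(1 - t) ^ 3 / 54 \<le> (-1) ^ k * (edge_mean n {t<..} H - (1 - t) ^ k)"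
  proof
    assume k: "k = 3"
    then obtain a b c where "a < n" "b < n" "c < n" "distinct [a, b, c]" "H = {{a, b}, {b, c}, {a, c}}"
      using H(1) by (auto elim: cycle_copies_3E)
    then have "edge_mean n {t<..} H = 0" using edge_mean_triangle[OF t0(2), of a b c n] by auto
    then show ?thesis using k nn by simp
  next
    assume k: "k = 4"
    then obtain a b c e where "a < n" "b < n" "c < n" "e < n" "distinct [a, b, c, e]"
      "H = {{a, b}, {b, c}, {c, e}, {a, e}}"
      using H(1) by (auto elim: cycle_copies_4E)
    then have "((1 - t) / 3) ^ 3 \<le> edge_mean n {t<..} H"
      using edge_mean_4_cycle_ge[of a n b c e t] t0 t by simp
    moreover have "((1 - t) / 3) ^ 3 = (1 - t) ^ 3 / 27" by (simp add: power_divide)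
    moreover have "(1 - t) ^ 4 \<le> (1 - t) ^ 3 / 54"
    proof -
      have "(1 - t) ^ 4 = (1 - t) * (1 - t) ^ 3" by (simp add: numeral_eq_Suc)
      also have "\<dots> \<le> (1 / 54) * (1 - t) ^ 3" using t nn by (intro mult_right_mono) auto
      finally show ?thesis by simp
    qed
    ultimately show ?thesis using k by simp
  qed
  then show ?thesis using eq by simp
qed

section \<open>Independence of the coordinates of the torus\<close>

lemma slice_measurable [measurable]:
  assumes "k < d"
  shows "(\<lambda>x. \<lambda>i\<in>I. x i k) \<in> PiM I (\<lambda>_. torus d) \<rightarrow>\<^sub>M PiM I (\<lambda>_. circle)"
proof (rule measurable_restrict)
  fix i assume "i \<in> I"
  then have "(\<lambda>x. x i) \<in> PiM I (\<lambda>_. torus d) \<rightarrow>\<^sub>M torus d" by (rule measurable_component_singleton)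
  moreover have "(\<lambda>y. y k) \<in> torus d \<rightarrow>\<^sub>M circle"
    unfolding torus_eq using assms by (intro measurable_component_singleton) simp
  ultimately show "(\<lambda>x. x i k) \<in> PiM I (\<lambda>_. torus d) \<rightarrow>\<^sub>M circle"
    by (rule measurable_compose)
qed

text \<open>The array of points and coordinates is read by coordinates instead of by points. Fixing
  the value \<open>y\<close> of one point leaves, by induction, a product whose \<open>k\<close>-th
  factor sees only \<open>y k\<close>, and the torus integral of such a product factors.\<close>

lemma nn_integral_tori_prod:
  fixes F :: "nat \<Rightarrow> (nat \<Rightarrow> real) \<Rightarrow> ennreal"
  assumes "finite I" "\<And>k. k < d \<Longrightarrow> F k \<in> borel_measurable (PiM I (\<lambda>_. circle))"
  shows "(\<integral>\<^sup>+x. (\<Prod>k<d. F k (\<lambda>i\<in>I. x i k)) \<partial>PiM I (\<lambda>_. torus d)) = (\<Prod>k<d. \<integral>\<^sup>+y. F k y \<partial>PiM I (\<lambda>_. circle))"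
  using assms
proof (induction I arbitrary: F rule: finite_induct)
  case empty
  show ?case
    by (simp add: PiM_empty nn_integral_count_space_finite restrict_def)
next
  case (insert v I)
  note F = insert.prems
  define g where "g k r = (\<integral>\<^sup>+z. F k (z(v := r)) \<partial>PiM I (\<lambda>_. circle))" for k r
  have meas: "(\<lambda>x. \<Prod>k<d. F k (\<lambda>i\<in>insert v I. x i k)) \<in> borel_measurable (PiM (insert v I) (\<lambda>_. torus d))"
    by (intro borel_measurable_prod_ennreal measurable_compose[OF slice_measurable F]) auto
  have "(\<integral>\<^sup>+x. (\<Prod>k<d. F k (\<lambda>i\<in>insert v I. x i k)) \<partial>PiM (insert v I) (\<lambda>_. torus d))
      = (\<integral>\<^sup>+y. \<integral>\<^sup>+x. (\<Prod>k<d. F k (\<lambda>i\<in>insert v I. (x(v := y)) i k)) \<partial>PiM I (\<lambda>_. torus d) \<partial>torus d)"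
    by (rule tori.product_nn_integral_insert_rev[OF insert.hyps meas])
  also have "\<dots> = (\<integral>\<^sup>+y. (\<Prod>k<d. g k (y k)) \<partial>torus d)"
  proof (rule nn_integral_cong)
    fix y
    have "(\<lambda>i\<in>insert v I. (x(v := y)) i k) = (\<lambda>i\<in>I. x i k)(v := y k)" for x :: "nat \<Rightarrow> nat \<Rightarrow> real" and k
      using insert.hyps by (auto simp: restrict_def fun_eq_iff)
    then have "(\<integral>\<^sup>+x. (\<Prod>k<d. F k (\<lambda>i\<in>insert v I. (x(v := y)) i k)) \<partial>PiM I (\<lambda>_. torus d))
       = (\<integral>\<^sup>+x. (\<Prod>k<d. (\<lambda>z. F k (z(v := y k))) (\<lambda>i\<in>I. x i k)) \<partial>PiM I (\<lambda>_. torus d))"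
      by (simp only:)
    also have "\<dots> = (\<Prod>k<d. \<integral>\<^sup>+z. F k (z(v := y k)) \<partial>PiM I (\<lambda>_. circle))"
    proof (rule insert.IH)
      fix k assume k: "k < d"
      have "(\<lambda>z. z(v := y k)) \<in> PiM I (\<lambda>_. circle) \<rightarrow>\<^sub>M PiM (insert v I) (\<lambda>_. circle)"
        by measurable
      then show "(\<lambda>z. F k (z(v := y k))) \<in> borel_measurable (PiM I (\<lambda>_. circle))"
        by (rule measurable_compose[OF _ F[OF k]])
    qed
    finally show "(\<integral>\<^sup>+x. (\<Prod>k<d. F k (\<lambda>i\<in>insert v I. (x(v := y)) i k)) \<partial>PiM I (\<lambda>_. torus d))
      = (\<Prod>k<d. g k (y k))" by (simp add: g_def)
  qed
  also have "\<dots> = (\<Prod>k<d. \<integral>\<^sup>+r. g k r \<partial>circle)"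
    unfolding torus_eq
  proof (rule circles.product_nn_integral_prod)
    fix k assume "k \<in> {..<d}"
    then have [measurable]: "F k \<in> borel_measurable (PiM (insert v I) (\<lambda>_. circle))" using F by simp
    show "g k \<in> borel_measurable circle"
      unfolding g_def
      by (intro sigma_finite_measure.borel_measurable_nn_integral prob_space_imp_sigma_finite
          circle_power.prob_space_axioms) measurable
  qed simp
  also have "\<dots> = (\<Prod>k<d. \<integral>\<^sup>+y. F k y \<partial>PiM (insert v I) (\<lambda>_. circle))"
    using F insert.hyps by (intro prod.cong refl) (simp add: g_def circles.product_nn_integral_insert_rev)
  finally show ?case .
qed

section \<open>Law of the sup distance and the connection threshold\<close>

lemma linf_le_iff: "1 \<le> d \<Longrightarrow> linf d x y \<le> t \<longleftrightarrow> (\<forall>k<d. cdist (x k) (y k) \<le> t)"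
  unfolding linf_def by (subst Max_le_iff) (auto simp: lessThan_empty_iff)

lemma measure_linf_le:
  assumes "1 \<le> d" "0 \<le> t" "t \<le> 1"
  shows "measure (torus d \<Otimes>\<^sub>M torus d) {z \<in> space (torus d \<Otimes>\<^sub>M torus d). linf d (fst z) (snd z) \<le> t} = t ^ d"
proof -
  interpret T: prob_space "torus d" by (rule prob_space_torus)
  interpret P: pair_sigma_finite "torus d" "torus d" ..
  define A where "A = {z \<in> space (torus d \<Otimes>\<^sub>M torus d). linf d (fst z) (snd z) \<le> t}"
  have A_eq: "A = {z \<in> space (torus d \<Otimes>\<^sub>M torus d). \<forall>k\<in>{..<d}. cdist (fst z k) (snd z k) \<le> t}"
    using assms(1) by (auto simp: A_def linf_le_iff)
  have [measurable]: "A \<in> sets (torus d \<Otimes>\<^sub>M torus d)"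
    unfolding A_eq torus_eq by measurable
  have "emeasure (torus d \<Otimes>\<^sub>M torus d) A = (\<integral>\<^sup>+x. \<integral>\<^sup>+y. indicator A (x, y) \<partial>torus d \<partial>torus d)"
    by (rule sigma_finite_measure.emeasure_pair_measure[OF prob_space_imp_sigma_finite[OF prob_space_torus]])
       measurable
  also have "\<dots> = (\<integral>\<^sup>+x. \<integral>\<^sup>+y. (\<Prod>k<d. indicator {..t} (cdist (x k) (y k))) \<partial>torus d \<partial>torus d)"
  proof (intro nn_integral_cong)
    fix x y assume "x \<in> space (torus d)" "y \<in> space (torus d)"
    then have "(x, y) \<in> A \<longleftrightarrow> (\<forall>k\<in>{..<d}. cdist (x k) (y k) \<le> t)"
      by (auto simp: A_eq space_pair_measure)
    then show "indicator A (x, y) = (\<Prod>k<d. indicator {..t} (cdist (x k) (y k)) :: ennreal)"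
      by (auto simp: indicator_def prod_zero_iff)
  qed
  also have "\<dots> = (\<integral>\<^sup>+x. (\<Prod>k<d. ennreal t) \<partial>torus d)"
  proof (rule nn_integral_cong)
    fix x :: "nat \<Rightarrow> real"
    have "(\<integral>\<^sup>+y. (\<Prod>k<d. indicator {..t} (cdist (x k) (y k))) \<partial>torus d)
       = (\<Prod>k<d. \<integral>\<^sup>+y. indicator {..t} (cdist (x k) y) \<partial>circle)"
      unfolding torus_eq
      by (rule circles.product_nn_integral_prod[where f = "\<lambda>k y. indicator {..t} (cdist (x k) y)"]) auto
    then show "(\<integral>\<^sup>+y. (\<Prod>k<d. indicator {..t} (cdist (x k) (y k))) \<partial>torus d) = (\<Prod>k<d. ennreal t)"
      by (simp only: nn_integral_cdist_le[OF assms(2,3)])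
  qed
  also have "\<dots> = ennreal (t ^ d)"
    using assms by (simp add: T.emeasure_space_1 ennreal_power)
  finally show ?thesis using assms by (simp add: measure_def A_def)
qed

text \<open>\<open>tau\<close> is a definite description over all reals, so uniqueness requires the
  distribution function everywhere: it is \<open>t ^ d\<close> on \<open>[0, 1]\<close>, 0 below and
  1 above, and the outer values differ from \<open>p\<close>. For \<open>d = 0\<close> the maximum
  defining \<open>linf\<close> would be unspecified.\<close>

lemma tau_properties:
  assumes "1 \<le> d" "0 < p" "p < 1"
  shows "tau d p ^ d = p" "0 < tau d p" "tau d p < 1"
proof -
  interpret T: prob_space "torus d" by (rule prob_space_torus)
  interpret P: pair_prob_space "torus d" "torus d" ..
  define m where "m t = measure (torus d \<Otimes>\<^sub>M torus d)
      {z \<in> space (torus d \<Otimes>\<^sub>M torus d). linf d (fst z) (snd z) \<le> t}" for t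
  have unit: "m t = t ^ d" if "0 \<le> t" "t \<le> 1" for t
    unfolding m_def using measure_linf_le assms(1) that by blast
  have neg: "m t = 0" if "t < 0" for t
  proof -
    have "\<not> linf d x y \<le> t" for x y
      using assms(1) that cdist_nonneg by (auto simp: linf_le_iff not_le intro!: exI[of _ 0] elim: less_le_trans)
    then show ?thesis by (simp add: m_def)
  qed
  have large: "m t = 1" if "t > 1" for t
  proof -
    have "linf d x y \<le> t" for x y
      unfolding linf_le_iff[OF assms(1)] using that cdist_le_1 by (meson less_imp_le order_trans)
    then show ?thesis by (simp add: m_def P.prob_space)
  qed
  define r where "r = root d p"
  have r: "r ^ d = p" "0 < r" "r < 1"
    using assms by (auto simp: r_def)
  have "tau d p = r"
    unfolding tau_def m_def[symmetric]
  proof (rule the_equality)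
    show "m r = p" using unit[of r] r by simp
    show "t = r" if "m t = p" for t
    proof (cases "0 \<le> t \<and> t \<le> 1")
      case True
      then have "t ^ d = r ^ d" using unit[of t] that r by simp
      then show ?thesis using True r assms(1) by (intro power_eq_imp_eq_base[of t d r]) auto
    next
      case False
      then show ?thesis using neg[of t] large[of t] that assms by auto
    qed
  qed
  then show "tau d p ^ d = p" "0 < tau d p" "tau d p < 1" using r by auto
qed

text \<open>The restriction does not affect an edge between vertices below \<open>n\<close>; it
  places each slice in the product space over \<open>{..<n}\<close>.\<close>

lemma rgg_graph_eq_prod:
  assumes "1 \<le> d" "e \<in> Kn_edges n"
  shows "rgg_graph d p x e = (\<Prod>k<d. edge_ind {..tau d p} (\<lambda>i\<in>{..<n}. x i k) e)"
proof -
  obtain i j where ij: "i < n" "j < n" "i \<noteq> j" "e = {i, j}"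
    using assms(2) by (rule Kn_edgesE)
  have "rgg_graph d p x e = (if \<forall>k<d. cdist (x i k) (x j k) \<le> tau d p then 1 else 0)"
    unfolding rgg_graph_def linf_le_iff[OF assms(1)] ij(4)
    using ij(3) by (auto simp: doubleton_eq_iff cdist_commute)
  also have "\<dots> = (\<Prod>k<d. indicator {..tau d p} (cdist (x i k) (x j k)))"
    by (auto simp: indicator_def prod_zero_iff)
  finally show ?thesis using ij by (simp add: edge_ind_pair)
qed

lemma rgg_graph_measurable:
  assumes "1 \<le> d" "e \<in> Kn_edges n"
  shows "(\<lambda>x. rgg_graph d p x e) \<in> borel_measurable (rgg_points n d)"
  unfolding rgg_graph_eq_prod[OF assms] rgg_points_def
  by (intro borel_measurable_prod measurable_compose[OF slice_measurable edge_ind_measurable] assms(2)) auto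

lemma rgg_graph_01: "rgg_graph d p x e \<in> {0, 1}"
  by (simp add: rgg_graph_def)

lemma expectation_rgg_subgraph:
  assumes d: "1 \<le> d" and S: "S \<subseteq> Kn_edges n"
  shows "(\<integral>x. (\<Prod>e\<in>S. rgg_graph d p x e) \<partial>rgg_points n d) = edge_mean n {..tau d p} S ^ d"
proof -
  let ?f = "\<lambda>y. \<Prod>e\<in>S. edge_ind {..tau d p} y e"
  have meas: "(\<lambda>x. \<Prod>e\<in>S. rgg_graph d p x e) \<in> borel_measurable (rgg_points n d)"
    using S by (intro borel_measurable_prod rgg_graph_measurable[OF d]) auto
  have eq: "(\<Prod>e\<in>S. rgg_graph d p x e) = (\<Prod>k<d. ?f (\<lambda>i\<in>{..<n}. x i k))" for x
  proof -
    have "(\<Prod>e\<in>S. rgg_graph d p x e) = (\<Prod>e\<in>S. \<Prod>k<d. edge_ind {..tau d p} (\<lambda>i\<in>{..<n}. x i k) e)"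
      using S by (intro prod.cong refl rgg_graph_eq_prod[OF d]) auto
    then show ?thesis by (subst (asm) prod.swap)
  qed
  have "(\<integral>\<^sup>+x. ennreal (\<Prod>e\<in>S. rgg_graph d p x e) \<partial>rgg_points n d)
      = (\<integral>\<^sup>+x. (\<Prod>k<d. ennreal (?f (\<lambda>i\<in>{..<n}. x i k))) \<partial>rgg_points n d)"
    unfolding eq by (subst prod_ennreal) (auto intro: prod_edge_ind_range(1))
  also have "\<dots> = (\<Prod>k<d. \<integral>\<^sup>+y. ennreal (?f y) \<partial>PiM {..<n} (\<lambda>_. circle))"
    unfolding rgg_points_def
    by (rule nn_integral_tori_prod)
       (use S in \<open>auto intro: measurable_compose[OF prod_edge_ind_measurable measurable_ennreal]\<close>)
  also have "\<dots> = ennreal (edge_mean n {..tau d p} S ^ d)"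
    using S by (simp add: ennreal_edge_mean[symmetric] ennreal_power edge_mean_nonneg)
  finally have "(\<integral>\<^sup>+x. ennreal (\<Prod>e\<in>S. rgg_graph d p x e) \<partial>rgg_points n d) = ennreal (edge_mean n {..tau d p} S ^ d)" .
  moreover have "0 \<le> (\<Prod>e\<in>S. rgg_graph d p x e)" for x
    unfolding eq by (intro prod_nonneg) (simp add: edge_ind_range)
  ultimately show ?thesis
    using meas by (subst integral_eq_nn_integral) (auto simp: edge_mean_nonneg)
qed

section \<open>Signed counts in a random graph\<close>

lemma finite_cycle_copies:
  assumes "k = 3 \<or> k = 4"
  shows "finite (cycle_copies k n)"
proof (rule finite_subset)
  show "cycle_copies k n \<subseteq> Pow (Kn_edges n)"
    by (rule subsetI, rule PowI, rule cycle_copy_subset[OF _ assms])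
qed simp

text \<open>A common frame for both models: the first two moments of a signed count depend on the
  graph only through its subgraph containment probabilities.\<close>

locale random_graph = prob_space M for M :: "'a measure" +
  fixes X :: "'a \<Rightarrow> nat set \<Rightarrow> real" and n :: nat
  assumes X_measurable: "e \<in> Kn_edges n \<Longrightarrow> (\<lambda>\<omega>. X \<omega> e) \<in> borel_measurable M"
    and X_01: "e \<in> Kn_edges n \<Longrightarrow> X \<omega> e \<in> {0, 1}"
begin

definition subgraph_mean :: "nat set set \<Rightarrow> real" where
  "subgraph_mean S = expectation (\<lambda>\<omega>. \<Prod>e\<in>S. X \<omega> e)"

text \<open>Signed weights and, for 0/1 entries, products of two of them are products of affine
  functions of single edges; this form handles both at once.\<close>

lemma integrable_affine_prod:
  assumes "U \<subseteq> Kn_edges n"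
  shows "integrable M (\<lambda>\<omega>. \<Prod>e\<in>U. a e * X \<omega> e + b e)"
proof (rule integrable_const_bound[where B = "\<Prod>e\<in>U. \<bar>a e\<bar> + \<bar>b e\<bar>"])
  have "\<bar>a e * X \<omega> e + b e\<bar> \<le> \<bar>a e\<bar> + \<bar>b e\<bar>" if "e \<in> U" for e \<omega>
  proof -
    have "X \<omega> e \<in> {0, 1}" using X_01 that assms by blast
    then show ?thesis by auto
  qed
  then show "AE \<omega> in M. norm (\<Prod>e\<in>U. a e * X \<omega> e + b e) \<le> (\<Prod>e\<in>U. \<bar>a e\<bar> + \<bar>b e\<bar>)"
    unfolding prod_norm[symmetric] by (intro AE_I2 prod_mono) auto
  show "(\<lambda>\<omega>. \<Prod>e\<in>U. a e * X \<omega> e + b e) \<in> borel_measurable M"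
    using assms X_measurable by (intro borel_measurable_prod borel_measurable_add borel_measurable_times) auto
qed

lemma integrable_subgraph:
  assumes "S \<subseteq> Kn_edges n"
  shows "integrable M (\<lambda>\<omega>. \<Prod>e\<in>S. X \<omega> e)"
  using integrable_affine_prod[OF assms, of "\<lambda>_. 1" "\<lambda>_. 0"] by simp

lemma expectation_affine_prod:
  assumes U: "U \<subseteq> Kn_edges n"
  shows "expectation (\<lambda>\<omega>. \<Prod>e\<in>U. a e * X \<omega> e + b e)
    = (\<Sum>S\<in>Pow U. (\<Prod>e\<in>S. a e) * (\<Prod>e\<in>U - S. b e) * subgraph_mean S)"
proof -
  have fin: "finite U" using U finite_subset[OF _ finite_Kn_edges] by blast
  have "(\<Prod>e\<in>U. a e * X \<omega> e + b e)
      = (\<Sum>S\<in>Pow U. (\<Prod>e\<in>S. a e) * (\<Prod>e\<in>U - S. b e) * (\<Prod>e\<in>S. X \<omega> e))" for \<omega>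
    unfolding prod_add[OF fin] prod.distrib by (simp only: mult_ac)
  then have "expectation (\<lambda>\<omega>. \<Prod>e\<in>U. a e * X \<omega> e + b e)
      = expectation (\<lambda>\<omega>. \<Sum>S\<in>Pow U. (\<Prod>e\<in>S. a e) * (\<Prod>e\<in>U - S. b e) * (\<Prod>e\<in>S. X \<omega> e))"
    by (simp only:)
  also have "\<dots> = (\<Sum>S\<in>Pow U. expectation (\<lambda>\<omega>. (\<Prod>e\<in>S. a e) * (\<Prod>e\<in>U - S. b e) * (\<Prod>e\<in>S. X \<omega> e)))"
    using U by (intro Bochner_Integration.integral_sum integrable_mult_right integrable_subgraph) auto
  finally show ?thesis unfolding subgraph_mean_def by (simp only: integral_mult_right_zero)
qed

text \<open>Both expectation and centre expand over the subsets of \<open>U\<close>, and each term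
  has relative error \<open>\<theta>\<close>. With absolute values on the coefficients, the error
  terms fold back into a single product.\<close>

lemma expectation_affine_prod_approx:
  assumes U: "U \<subseteq> Kn_edges n" and "0 \<le> p"
    and approx: "\<And>S. S \<subseteq> U \<Longrightarrow> \<bar>subgraph_mean S - p ^ card S\<bar> \<le> \<theta> * p ^ card S"
  shows "\<bar>expectation (\<lambda>\<omega>. \<Prod>e\<in>U. a e * X \<omega> e + b e) - (\<Prod>e\<in>U. a e * p + b e)\<bar>
    \<le> \<theta> * (\<Prod>e\<in>U. \<bar>a e\<bar> * p + \<bar>b e\<bar>)"
proof -
  have fin: "finite U" using U finite_subset[OF _ finite_Kn_edges] by blast
  have expand: "(\<Prod>e\<in>U. f e * p + g e) = (\<Sum>S\<in>Pow U. (\<Prod>e\<in>S. f e) * (\<Prod>e\<in>U - S. g e) * p ^ card S)"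
    for f g :: "nat set \<Rightarrow> real"
    unfolding prod_add[OF fin] prod.distrib prod_constant by (simp only: mult_ac)
  have "expectation (\<lambda>\<omega>. \<Prod>e\<in>U. a e * X \<omega> e + b e) - (\<Prod>e\<in>U. a e * p + b e)
     = (\<Sum>S\<in>Pow U. (\<Prod>e\<in>S. a e) * (\<Prod>e\<in>U - S. b e) * (subgraph_mean S - p ^ card S))"
    unfolding expectation_affine_prod[OF U] expand by (simp add: sum_subtractf right_diff_distrib)
  also have "\<bar>\<dots>\<bar> \<le> (\<Sum>S\<in>Pow U. \<bar>(\<Prod>e\<in>S. a e) * (\<Prod>e\<in>U - S. b e) * (subgraph_mean S - p ^ card S)\<bar>)"
    by (rule sum_abs)
  also have "\<dots> \<le> (\<Sum>S\<in>Pow U. \<theta> * ((\<Prod>e\<in>S. \<bar>a e\<bar>) * (\<Prod>e\<in>U - S. \<bar>b e\<bar>) * p ^ card S))"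
  proof (rule sum_mono)
    fix S assume "S \<in> Pow U"
    then have "\<bar>(\<Prod>e\<in>S. a e) * (\<Prod>e\<in>U - S. b e)\<bar> * \<bar>subgraph_mean S - p ^ card S\<bar>
      \<le> \<bar>(\<Prod>e\<in>S. a e) * (\<Prod>e\<in>U - S. b e)\<bar> * (\<theta> * p ^ card S)"
      by (intro mult_left_mono approx) auto
    then show "\<bar>(\<Prod>e\<in>S. a e) * (\<Prod>e\<in>U - S. b e) * (subgraph_mean S - p ^ card S)\<bar>
      \<le> \<theta> * ((\<Prod>e\<in>S. \<bar>a e\<bar>) * (\<Prod>e\<in>U - S. \<bar>b e\<bar>) * p ^ card S)"
      by (simp add: abs_mult abs_prod mult_ac)
  qed
  also have "\<dots> = \<theta> * (\<Prod>e\<in>U. \<bar>a e\<bar> * p + \<bar>b e\<bar>)"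
    unfolding expand by (simp only: sum_distrib_left)
  finally show ?thesis .
qed

lemma signed_weight_affine: "signed_weight p H (X \<omega>) = (\<Prod>e\<in>H. 1 * X \<omega> e + (- p))"
  by (simp add: signed_weight_def)

text \<open>Since \<open>X * X = X\<close> for 0/1 entries, a shared edge contributes
  \<open>(X - p) ^ 2 = (1 - 2p) X + p ^ 2\<close>, which is again affine.\<close>

lemma signed_weight_mult_affine:
  assumes "H1 \<subseteq> Kn_edges n" "H2 \<subseteq> Kn_edges n"
  shows "signed_weight p H1 (X \<omega>) * signed_weight p H2 (X \<omega>)
    = (\<Prod>e\<in>H1 \<union> H2. (if e \<in> H1 \<inter> H2 then 1 - 2 * p else 1) * X \<omega> e + (if e \<in> H1 \<inter> H2 then p\<^sup>2 else - p))"
proof -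
  have fin: "finite H1" "finite H2" using assms finite_subset[OF _ finite_Kn_edges] by blast+
  let ?f = "\<lambda>e. X \<omega> e - p"
  have "signed_weight p H1 (X \<omega>) * signed_weight p H2 (X \<omega>) = prod ?f (H1 \<union> H2) * prod ?f (H1 \<inter> H2)"
    unfolding signed_weight_def using prod.union_inter[OF fin, of ?f] by simp
  also have "prod ?f (H1 \<inter> H2) = (\<Prod>e\<in>H1 \<union> H2. if e \<in> H1 \<inter> H2 then ?f e else 1)"
  proof -
    have "(\<Prod>e\<in>H1 \<union> H2. if e \<in> H1 \<inter> H2 then ?f e else 1) = prod ?f ((H1 \<union> H2) \<inter> (H1 \<inter> H2))"
      using fin by (intro prod.inter_restrict[symmetric]) simp
    moreover have "(H1 \<union> H2) \<inter> (H1 \<inter> H2) = H1 \<inter> H2" by blast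
    ultimately show ?thesis by simp
  qed
  also have "prod ?f (H1 \<union> H2) * \<dots> = (\<Prod>e\<in>H1 \<union> H2. ?f e * (if e \<in> H1 \<inter> H2 then ?f e else 1))"
    by (rule prod.distrib[symmetric])
  also have "\<dots> = (\<Prod>e\<in>H1 \<union> H2. (if e \<in> H1 \<inter> H2 then 1 - 2 * p else 1) * X \<omega> e + (if e \<in> H1 \<inter> H2 then p\<^sup>2 else - p))"
  proof (rule prod.cong[OF refl])
    fix e assume "e \<in> H1 \<union> H2"
    then have "X \<omega> e \<in> {0, 1}" using X_01 assms by blast
    then show "?f e * (if e \<in> H1 \<inter> H2 then ?f e else 1)
       = (if e \<in> H1 \<inter> H2 then 1 - 2 * p else 1) * X \<omega> e + (if e \<in> H1 \<inter> H2 then p\<^sup>2 else - p)"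
      by (auto simp: power2_eq_square algebra_simps)
  qed
  finally show ?thesis .
qed

lemma integrable_signed_weight:
  "H \<subseteq> Kn_edges n \<Longrightarrow> integrable M (\<lambda>\<omega>. signed_weight p H (X \<omega>))"
  unfolding signed_weight_affine by (rule integrable_affine_prod)

lemma integrable_signed_weight_mult:
  assumes "H1 \<subseteq> Kn_edges n" "H2 \<subseteq> Kn_edges n"
  shows "integrable M (\<lambda>\<omega>. signed_weight p H1 (X \<omega>) * signed_weight p H2 (X \<omega>))"
  unfolding signed_weight_mult_affine[OF assms] using assms by (intro integrable_affine_prod) auto

text \<open>The centre is \<open>(p - p) ^ card H\<close>, which vanishes as \<open>H\<close> has an
  edge, and every edge contributes \<open>p + p\<close> to the error product.\<close>

lemma expectation_signed_weight_approx:
  assumes H: "H \<subseteq> Kn_edges n" "H \<noteq> {}" and "0 \<le> p"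
    and approx: "\<And>S. S \<subseteq> H \<Longrightarrow> \<bar>subgraph_mean S - p ^ card S\<bar> \<le> \<theta> * p ^ card S"
  shows "\<bar>expectation (\<lambda>\<omega>. signed_weight p H (X \<omega>))\<bar> \<le> \<theta> * (2 * p) ^ card H"
proof -
  have fin: "finite H" using H finite_subset[OF _ finite_Kn_edges] by blast
  then show ?thesis
    unfolding signed_weight_affine
    using expectation_affine_prod_approx[OF H(1) \<open>0 \<le> p\<close> approx, of "\<lambda>_. 1" "\<lambda>_. - p"] assms(2,3)
    by (simp add: power_0_left)
qed

text \<open>At the centre an unshared edge gives \<open>p - p = 0\<close> and a shared one
  \<open>(1 - 2p) p + p ^ 2 = p (1 - p)\<close>, so only \<open>H1 = H2\<close> leaves something. In
  both cases \<open>2p\<close> bounds the error factor; \<open>p <= 1 / 2\<close> keeps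
  \<open>1 - 2p\<close> nonnegative.\<close>

lemma expectation_signed_weight_mult_approx:
  assumes H: "H1 \<subseteq> Kn_edges n" "H2 \<subseteq> Kn_edges n" and p: "0 \<le> p" "p \<le> 1/2" and "0 \<le> \<theta>"
    and approx: "\<And>S. S \<subseteq> H1 \<union> H2 \<Longrightarrow> \<bar>subgraph_mean S - p ^ card S\<bar> \<le> \<theta> * p ^ card S"
  shows "\<bar>expectation (\<lambda>\<omega>. signed_weight p H1 (X \<omega>) * signed_weight p H2 (X \<omega>))
      - (if H1 = H2 then (p * (1 - p)) ^ card H1 else 0)\<bar> \<le> \<theta> * (2 * p) ^ card (H1 \<union> H2)"
proof -
  have fin: "finite H1" "finite H2" using H finite_subset[OF _ finite_Kn_edges] by blast+
  let ?a = "\<lambda>e. if e \<in> H1 \<inter> H2 then 1 - 2 * p else 1"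
  let ?b = "\<lambda>e. if e \<in> H1 \<inter> H2 then p\<^sup>2 else - p"
  have "(\<Prod>e\<in>H1 \<union> H2. ?a e * p + ?b e) = (if H1 = H2 then (p * (1 - p)) ^ card H1 else 0)"
  proof (cases "H1 = H2")
    case True
    then have "(\<Prod>e\<in>H1 \<union> H2. ?a e * p + ?b e) = (\<Prod>e\<in>H1. p * (1 - p))"
      by (intro prod.cong) (auto simp: power2_eq_square algebra_simps)
    then show ?thesis using True by simp
  next
    case False
    then obtain e where "e \<in> H1 \<union> H2" "e \<notin> H1 \<inter> H2" by blast
    then have "\<exists>e\<in>H1 \<union> H2. ?a e * p + ?b e = 0" by (intro bexI[of _ e]) auto
    then have "(\<Prod>e\<in>H1 \<union> H2. ?a e * p + ?b e) = 0" using fin by (intro prod_zero) auto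
    then show ?thesis using False by simp
  qed
  moreover have "(\<Prod>e\<in>H1 \<union> H2. \<bar>?a e\<bar> * p + \<bar>?b e\<bar>) \<le> (\<Prod>e\<in>H1 \<union> H2. 2 * p)"
  proof (intro prod_mono conjI)
    fix e
    show "0 \<le> \<bar>?a e\<bar> * p + \<bar>?b e\<bar>" using p by simp
    have "(1 - 2 * p) * p + p\<^sup>2 \<le> 2 * p" using p by (simp add: power2_eq_square algebra_simps)
    then show "\<bar>?a e\<bar> * p + \<bar>?b e\<bar> \<le> 2 * p" using p by simp
  qed
  then have "\<theta> * (\<Prod>e\<in>H1 \<union> H2. \<bar>?a e\<bar> * p + \<bar>?b e\<bar>) \<le> \<theta> * (2 * p) ^ card (H1 \<union> H2)"
    using \<open>0 \<le> \<theta>\<close> by (intro mult_left_mono) simp_all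
  moreover have "H1 \<union> H2 \<subseteq> Kn_edges n" using H by simp
  ultimately show ?thesis
    unfolding signed_weight_mult_affine[OF H]
    using expectation_affine_prod_approx[OF \<open>H1 \<union> H2 \<subseteq> Kn_edges n\<close> p(1) approx, of ?a ?b]
    by linarith
qed

lemma expectation_signed_weight_mult_indep:
  assumes H: "H1 \<subseteq> Kn_edges n" "H2 \<subseteq> Kn_edges n" "H1 \<inter> H2 = {}"
    and indep: "\<And>S1 S2. S1 \<subseteq> H1 \<Longrightarrow> S2 \<subseteq> H2 \<Longrightarrow> subgraph_mean (S1 \<union> S2) = subgraph_mean S1 * subgraph_mean S2"
  shows "expectation (\<lambda>\<omega>. signed_weight p H1 (X \<omega>) * signed_weight p H2 (X \<omega>))
    = expectation (\<lambda>\<omega>. signed_weight p H1 (X \<omega>)) * expectation (\<lambda>\<omega>. signed_weight p H2 (X \<omega>))"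
proof -
  have fin: "finite H1" "finite H2" using H finite_subset[OF _ finite_Kn_edges] by blast+
  define c where "c H S = (\<Prod>e\<in>S. 1) * (\<Prod>e\<in>H - S. - p)" for H S :: "nat set set"
  have sw: "signed_weight p H (X \<omega>) = (\<Sum>S\<in>Pow H. c H S * (\<Prod>e\<in>S. X \<omega> e))" if "finite H" for H \<omega>
    unfolding signed_weight_affine prod_add[OF that] c_def by (simp add: mult_ac)
  have E: "expectation (\<lambda>\<omega>. signed_weight p H (X \<omega>)) = (\<Sum>S\<in>Pow H. c H S * subgraph_mean S)"
    if "H \<subseteq> Kn_edges n" for H
    unfolding signed_weight_affine expectation_affine_prod[OF that] c_def ..
  have "expectation (\<lambda>\<omega>. signed_weight p H1 (X \<omega>) * signed_weight p H2 (X \<omega>))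
    = expectation (\<lambda>\<omega>. \<Sum>S1\<in>Pow H1. \<Sum>S2\<in>Pow H2. c H1 S1 * c H2 S2 * (\<Prod>e\<in>S1 \<union> S2. X \<omega> e))"
  proof (rule Bochner_Integration.integral_cong[OF refl])
    fix \<omega>
    show "signed_weight p H1 (X \<omega>) * signed_weight p H2 (X \<omega>)
      = (\<Sum>S1\<in>Pow H1. \<Sum>S2\<in>Pow H2. c H1 S1 * c H2 S2 * (\<Prod>e\<in>S1 \<union> S2. X \<omega> e))"
      unfolding sw[OF fin(1)] sw[OF fin(2)] sum_product
    proof (intro sum.cong refl)
      fix S1 S2 assume S: "S1 \<in> Pow H1" "S2 \<in> Pow H2"
      then have "finite S1" "finite S2" "S1 \<inter> S2 = {}" 
        using fin H(3) finite_subset[of S1 H1] finite_subset[of S2 H2] by auto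
      then show "c H1 S1 * (\<Prod>e\<in>S1. X \<omega> e) * (c H2 S2 * (\<Prod>e\<in>S2. X \<omega> e)) = c H1 S1 * c H2 S2 * (\<Prod>e\<in>S1 \<union> S2. X \<omega> e)"
        by (simp add: prod.union_disjoint)
    qed
  qed
  also have "\<dots> = (\<Sum>S1\<in>Pow H1. expectation (\<lambda>\<omega>. \<Sum>S2\<in>Pow H2. c H1 S1 * c H2 S2 * (\<Prod>e\<in>S1 \<union> S2. X \<omega> e)))"
    using H by (intro Bochner_Integration.integral_sum Bochner_Integration.integrable_sum integrable_mult_right integrable_subgraph) auto
  also have "\<dots> = (\<Sum>S1\<in>Pow H1. \<Sum>S2\<in>Pow H2. expectation (\<lambda>\<omega>. c H1 S1 * c H2 S2 * (\<Prod>e\<in>S1 \<union> S2. X \<omega> e)))"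
    using H by (intro sum.cong refl Bochner_Integration.integral_sum integrable_mult_right integrable_subgraph) auto
  also have "\<dots> = (\<Sum>S1\<in>Pow H1. \<Sum>S2\<in>Pow H2. c H1 S1 * c H2 S2 * (subgraph_mean S1 * subgraph_mean S2))"
    by (intro sum.cong refl) (simp only: integral_mult_right_zero subgraph_mean_def[symmetric] indep Pow_iff)
  also have "\<dots> = (\<Sum>S\<in>Pow H1. c H1 S * subgraph_mean S) * (\<Sum>S\<in>Pow H2. c H2 S * subgraph_mean S)"
    unfolding sum_product by (simp only: mult_ac)
  finally show ?thesis unfolding E[OF H(1)] E[OF H(2)] .
qed

lemma expectation_signed_count:
  assumes "k = 3 \<or> k = 4"
  shows "expectation (\<lambda>\<omega>. signed_count k n p (X \<omega>)) = (\<Sum>H\<in>cycle_copies k n. expectation (\<lambda>\<omega>. signed_weight p H (X \<omega>)))"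
  unfolding signed_count_def
  by (intro Bochner_Integration.integral_sum integrable_signed_weight cycle_copy_subset[OF _ assms])

lemma var_of_signed_count:
  assumes k: "k = 3 \<or> k = 4"
  shows "var_of M (\<lambda>\<omega>. signed_count k n p (X \<omega>)) = (\<Sum>H1\<in>cycle_copies k n. \<Sum>H2\<in>cycle_copies k n.
     expectation (\<lambda>\<omega>. signed_weight p H1 (X \<omega>) * signed_weight p H2 (X \<omega>))
     - expectation (\<lambda>\<omega>. signed_weight p H1 (X \<omega>)) * expectation (\<lambda>\<omega>. signed_weight p H2 (X \<omega>)))"
proof -
  let ?C = "cycle_copies k n" and ?Y = "\<lambda>\<omega>. signed_count k n p (X \<omega>)"
  have sub: "H \<subseteq> Kn_edges n" if "H \<in> ?C" for H using cycle_copy_subset[OF that k] .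
  have sq: "(?Y \<omega>)\<^sup>2 = (\<Sum>H1\<in>?C. \<Sum>H2\<in>?C. signed_weight p H1 (X \<omega>) * signed_weight p H2 (X \<omega>))" for \<omega>
    by (simp add: signed_count_def power2_eq_square sum_product)
  have int1: "integrable M ?Y"
    unfolding signed_count_def by (intro Bochner_Integration.integrable_sum integrable_signed_weight sub)
  have int2: "integrable M (\<lambda>\<omega>. (?Y \<omega>)\<^sup>2)"
    unfolding sq by (intro Bochner_Integration.integrable_sum integrable_signed_weight_mult sub)
  have "expectation (\<lambda>\<omega>. (?Y \<omega>)\<^sup>2)
     = (\<Sum>H1\<in>?C. expectation (\<lambda>\<omega>. \<Sum>H2\<in>?C. signed_weight p H1 (X \<omega>) * signed_weight p H2 (X \<omega>)))"
    unfolding sq by (intro Bochner_Integration.integral_sum Bochner_Integration.integrable_sum integrable_signed_weight_mult sub)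
  also have "\<dots> = (\<Sum>H1\<in>?C. \<Sum>H2\<in>?C. expectation (\<lambda>\<omega>. signed_weight p H1 (X \<omega>) * signed_weight p H2 (X \<omega>)))"
    by (intro sum.cong refl Bochner_Integration.integral_sum integrable_signed_weight_mult sub)
  finally have "expectation (\<lambda>\<omega>. (?Y \<omega>)\<^sup>2)
    = (\<Sum>H1\<in>?C. \<Sum>H2\<in>?C. expectation (\<lambda>\<omega>. signed_weight p H1 (X \<omega>) * signed_weight p H2 (X \<omega>)))" .
  moreover have "(expectation ?Y)\<^sup>2 = (\<Sum>H1\<in>?C. \<Sum>H2\<in>?C.
     expectation (\<lambda>\<omega>. signed_weight p H1 (X \<omega>)) * expectation (\<lambda>\<omega>. signed_weight p H2 (X \<omega>)))"
    unfolding expectation_signed_count[OF k] power2_eq_square sum_product ..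
  ultimately show ?thesis
    unfolding var_of_def variance_eq[OF int1 int2] by (simp add: sum_subtractf)
qed

end

section \<open>Counting cycles and pairs of cycles\<close>

lemma cycle_copyE:
  assumes "E \<in> cycle_copies k n" "0 < k"
  obtains v where "inj_on v {..<k}" "v ` {..<k} = \<Union>E" "v ` {..<k} \<subseteq> {..<n}"
    "E = (\<lambda>i. {v i, v (Suc i mod k)}) ` {..<k}"
proof -
  obtain v where v: "inj_on v {..<k}" "v ` {..<k} \<subseteq> {..<n}" "E = (\<lambda>i. {v i, v (Suc i mod k)}) ` {..<k}"
    using assms(1) by (auto simp: cycle_copies_def)
  have "\<Union>E = v ` {..<k} \<union> (\<lambda>i. v (Suc i mod k)) ` {..<k}"
    unfolding v(3) by auto
  moreover have "(\<lambda>i. v (Suc i mod k)) ` {..<k} \<subseteq> v ` {..<k}"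
    using assms(2) by auto
  ultimately have "v ` {..<k} = \<Union>E" by blast
  then show ?thesis using that v by blast
qed

lemma card_Union_cycle_copy:
  assumes "E \<in> cycle_copies k n" "0 < k"
  shows "card (\<Union>E) = k" "\<Union>E \<subseteq> {..<n}"
proof -
  obtain v where v: "inj_on v {..<k}" "v ` {..<k} = \<Union>E" "v ` {..<k} \<subseteq> {..<n}"
    using assms by (rule cycle_copyE)
  show "card (\<Union>E) = k" unfolding v(2)[symmetric] using card_image[OF v(1)] by simp
  show "\<Union>E \<subseteq> {..<n}" using v(2,3) by simp
qed

lemma card_cycle_copies_le:
  assumes "0 < k"
  shows "card (cycle_copies k n) \<le> n ^ k"
proof -
  let ?f = "\<lambda>v. (\<lambda>i. {v i, v (Suc i mod k)}) ` {..<k}"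
  have "cycle_copies k n \<subseteq> ?f ` ({..<k} \<rightarrow>\<^sub>E {..<n})"
  proof
    fix E assume "E \<in> cycle_copies k n"
    then obtain v where v: "v ` {..<k} \<subseteq> {..<n}" "E = ?f v" by (auto simp: cycle_copies_def)
    have "E = ?f (restrict v {..<k})" unfolding v(2) using assms by (intro image_cong) auto
    moreover have "restrict v {..<k} \<in> {..<k} \<rightarrow>\<^sub>E {..<n}" using v(1) by auto
    ultimately show "E \<in> ?f ` ({..<k} \<rightarrow>\<^sub>E {..<n})" by blast
  qed
  then have "card (cycle_copies k n) \<le> card (?f ` ({..<k} \<rightarrow>\<^sub>E {..<n}))"
    by (intro card_mono finite_imageI finite_PiE) auto
  also have "\<dots> \<le> card ({..<k} \<rightarrow>\<^sub>E {..<n})"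
    by (intro card_image_le finite_PiE) auto
  finally show ?thesis by (simp add: card_PiE)
qed

text \<open>Distinct \<open>k\<close>-sets carry distinct cycles, so there are at least
  \<open>n choose k\<close> of them.\<close>

lemma card_cycle_copies_ge:
  assumes k: "k = 3 \<or> k = 4" and "k \<le> n"
  shows "(real n / real k) ^ k \<le> real (card (cycle_copies k n))"
proof -
  have k0: "0 < k" using k by auto
  have "{W. W \<subseteq> {..<n} \<and> card W = k} \<subseteq> Union ` cycle_copies k n"
  proof
    fix W assume "W \<in> {W. W \<subseteq> {..<n} \<and> card W = k}"
    then have W: "W \<subseteq> {..<n}" "card W = k" by auto
    then have "finite W" using finite_subset by blast
    then obtain v where v: "bij_betw v {..<k} W"
      using ex_bij_betw_nat_finite[of W] W(2) by (auto simp: atLeast0LessThan)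
    define E where "E = (\<lambda>i. {v i, v (Suc i mod k)}) ` {..<k}"
    have "E \<in> cycle_copies k n"
      unfolding cycle_copies_def E_def using v W(1) by (auto simp: bij_betw_def)
    moreover have "\<Union>E = W"
    proof -
      have "\<Union>E = v ` {..<k} \<union> (\<lambda>i. v (Suc i mod k)) ` {..<k}"
        unfolding E_def by auto
      moreover have "(\<lambda>i. v (Suc i mod k)) ` {..<k} \<subseteq> v ` {..<k}" using k0 by auto
      ultimately show ?thesis using v by (auto simp: bij_betw_def)
    qed
    ultimately show "W \<in> Union ` cycle_copies k n" by blast
  qed
  then have "card {W. W \<subseteq> {..<n} \<and> card W = k} \<le> card (Union ` cycle_copies k n)"
    using finite_cycle_copies[OF k] by (intro card_mono) auto
  also have "\<dots> \<le> card (cycle_copies k n)"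
    using finite_cycle_copies[OF k] by (rule card_image_le)
  finally have "n choose k \<le> card (cycle_copies k n)"
    by (simp add: n_subsets)
  then show ?thesis
    using binomial_ge_n_over_k_pow_k[OF assms(2), where ?'a = real] by (meson of_nat_le_iff order_trans)
qed

text \<open>Charge each common edge to its starting point \<open>v i\<close> in a fixed traversal of
  \<open>H1\<close>. That point lies on both cycles, and every vertex starts only one edge.\<close>

lemma card_cycle_copies_inter_le:
  assumes "H1 \<in> cycle_copies k n" "0 < k"
  shows "card (H1 \<inter> H2) \<le> card (\<Union>H1 \<inter> \<Union>H2)"
proof -
  obtain v where v: "inj_on v {..<k}" "v ` {..<k} = \<Union>H1" "v ` {..<k} \<subseteq> {..<n}"
    "H1 = (\<lambda>i. {v i, v (Suc i mod k)}) ` {..<k}"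
    using assms by (rule cycle_copyE)
  define J where "J = {i. i < k \<and> v i \<in> \<Union>H1 \<inter> \<Union>H2}"
  have fin: "finite J" unfolding J_def by simp
  have "H1 \<inter> H2 \<subseteq> (\<lambda>i. {v i, v (Suc i mod k)}) ` J"
  proof
    fix e assume e: "e \<in> H1 \<inter> H2"
    then obtain i where i: "i < k" "e = {v i, v (Suc i mod k)}" using v(4) by auto
    then have "v i \<in> e" by simp
    then have "i \<in> J" using e i(1) by (auto simp: J_def)
    then show "e \<in> (\<lambda>i. {v i, v (Suc i mod k)}) ` J" using i(2) by blast
  qed
  then have "card (H1 \<inter> H2) \<le> card J"
    by (rule order_trans[OF card_mono[OF finite_imageI[OF fin]] card_image_le[OF fin]])
  also have "finite (\<Union>H1)" unfolding v(2)[symmetric] by simp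
  then have "card J \<le> card (\<Union>H1 \<inter> \<Union>H2)"
    using v(1) by (intro card_inj_on_le[of v]) (auto simp: J_def inj_on_def)
  finally show ?thesis .
qed

text \<open>Each cycle has as many vertices as edges, so the bound for intersections reverses for
  unions. It allows a power of the number of edges to be replaced by one of the number of
  vertices.\<close>

lemma card_Union_le_card_edges:
  assumes k: "k = 3 \<or> k = 4" and H: "H1 \<in> cycle_copies k n" "H2 \<in> cycle_copies k n"
  shows "card (\<Union>H1 \<union> \<Union>H2) \<le> card (H1 \<union> H2)"
proof -
  have k0: "0 < k" using k by auto
  have fin: "finite H1" "finite H2" "finite (\<Union>H1)" "finite (\<Union>H2)"
    by (fact finite_subset[OF cycle_copy_subset[OF H(1) k] finite_Kn_edges]
      finite_subset[OF cycle_copy_subset[OF H(2) k] finite_Kn_edges]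
      finite_subset[OF card_Union_cycle_copy(2)[OF H(1) k0] finite_lessThan]
      finite_subset[OF card_Union_cycle_copy(2)[OF H(2) k0] finite_lessThan])+
  have "card H1 + card H2 = card (H1 \<union> H2) + card (H1 \<inter> H2)"
    using fin by (intro card_Un_Int)
  moreover have "card (\<Union>H1) + card (\<Union>H2) = card (\<Union>H1 \<union> \<Union>H2) + card (\<Union>H1 \<inter> \<Union>H2)"
    using fin by (intro card_Un_Int)
  moreover have "card (\<Union>H1) = k" "card (\<Union>H2) = k" "card H1 = k" "card H2 = k"
    using card_Union_cycle_copy(1)[OF H(1) k0] card_Union_cycle_copy(1)[OF H(2) k0]
      card_cycle_copy[OF H(1) k] card_cycle_copy[OF H(2) k] by auto
  ultimately show ?thesis using card_cycle_copies_inter_le[OF H(1) k0, of H2] by linarith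
qed

text \<open>Subsets of size \<open>m\<close> contribute at most \<open>(n q) ^ m\<close>; as
  \<open>n q >= 1\<close>, the size \<open>r\<close> dominates all \<open>r + 1\<close>
  sizes.\<close>

lemma sum_subsets_power_le:
  fixes q :: real
  assumes "0 \<le> q" "1 \<le> real n * q"
  shows "(\<Sum>W | W \<subseteq> {..<n} \<and> card W \<le> r. q ^ card W) \<le> real (Suc r) * (real n * q) ^ r"
proof -
  have fin: "finite {W. W \<subseteq> {..<n} \<and> card W \<le> r}"
    by (rule finite_subset[of _ "Pow {..<n}"]) auto
  have "(\<Sum>W | W \<subseteq> {..<n} \<and> card W \<le> r. q ^ card W)
      = (\<Sum>m\<le>r. \<Sum>W | W \<in> {W. W \<subseteq> {..<n} \<and> card W \<le> r} \<and> card W = m. q ^ card W)"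
    by (rule sum.group[symmetric, OF fin]) auto
  also have "\<dots> \<le> (\<Sum>m\<le>r. (real n * q) ^ r)"
  proof (rule sum_mono)
    fix m assume m: "m \<in> {..r}"
    have "{W \<in> {W. W \<subseteq> {..<n} \<and> card W \<le> r}. card W = m} = {W. W \<subseteq> {..<n} \<and> card W = m}"
      using m by auto
    then have "(\<Sum>W | W \<in> {W. W \<subseteq> {..<n} \<and> card W \<le> r} \<and> card W = m. q ^ card W) = real (n choose m) * q ^ m"
      by (simp add: n_subsets)
    also have "real (n choose m) \<le> real n ^ m"
    proof (cases "m \<le> n")
      case True
      then show ?thesis using binomial_le_pow[OF True] by (metis of_nat_le_iff of_nat_power)
    qed (simp add: binomial_eq_0)
    then have "real (n choose m) * q ^ m \<le> real n ^ m * q ^ m"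
      using assms(1) by (intro mult_right_mono) auto
    also have "\<dots> = (real n * q) ^ m" by (simp add: power_mult_distrib)
    also have "\<dots> \<le> (real n * q) ^ r" using assms(2) m by (intro power_increasing) auto
    finally show "(\<Sum>W | W \<in> {W. W \<subseteq> {..<n} \<and> card W \<le> r} \<and> card W = m. q ^ card W) \<le> (real n * q) ^ r" .
  qed
  finally show ?thesis by simp
qed

text \<open>The pairs that may be correlated, the diagonal included: with at most one common vertex,
  translation invariance makes the covariance vanish.\<close>

definition linked_pairs :: "nat \<Rightarrow> nat \<Rightarrow> (nat set set \<times> nat set set) set" where
  "linked_pairs k n = {(H1, H2). H1 \<in> cycle_copies k n \<and> H2 \<in> cycle_copies k n \<and> 2 \<le> card (\<Union>H1 \<inter> \<Union>H2)}"

text \<open>A linked pair lives on a vertex set of size at most \<open>2k - 2\<close>, and each vertex set of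
  bounded size carries boundedly many pairs.\<close>

lemma sum_linked_pairs_le:
  fixes q :: real
  assumes k: "k = 3 \<or> k = 4" and q: "0 \<le> q" "q \<le> 1" "1 \<le> real n * q"
  shows "(\<Sum>(H1, H2)\<in>linked_pairs k n. q ^ card (H1 \<union> H2))
    \<le> (2 ^ 2 ^ (2 * k)) ^ 2 * (real (2 * k) * (real n * q) ^ (2 * k - 2))"
proof -
  have k0: "0 < k" using k by auto
  have sub: "linked_pairs k n \<subseteq> cycle_copies k n \<times> cycle_copies k n"
    by (auto simp: linked_pairs_def)
  then have fin: "finite (linked_pairs k n)"
    by (rule finite_subset) (intro finite_SigmaI finite_cycle_copies[OF k])
  define V where "V = (\<lambda>(H1, H2). \<Union>H1 \<union> \<Union>H2 :: nat set)"
  define T where "T = {W. W \<subseteq> {..<n} \<and> card W \<le> 2 * k - 2}"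
  have finT: "finite T" unfolding T_def by (rule finite_subset[of _ "Pow {..<n}"]) auto
  have VT: "V ` linked_pairs k n \<subseteq> T"
  proof
    fix W assume "W \<in> V ` linked_pairs k n"
    then obtain H1 H2 where H: "H1 \<in> cycle_copies k n" "H2 \<in> cycle_copies k n"
      "2 \<le> card (\<Union>H1 \<inter> \<Union>H2)" and W: "W = \<Union>H1 \<union> \<Union>H2"
      by (auto simp: linked_pairs_def V_def)
    note H1 = card_Union_cycle_copy[OF H(1) k0] and H2 = card_Union_cycle_copy[OF H(2) k0]
    have "finite (\<Union>H1)" "finite (\<Union>H2)"
      by (fact finite_subset[OF H1(2) finite_lessThan] finite_subset[OF H2(2) finite_lessThan])+
    then have "card (\<Union>H1) + card (\<Union>H2) = card (\<Union>H1 \<union> \<Union>H2) + card (\<Union>H1 \<inter> \<Union>H2)"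
      by (rule card_Un_Int)
    then show "W \<in> T" unfolding T_def W using H(3) H1 H2 by auto
  qed
  have "(\<Sum>(H1, H2)\<in>linked_pairs k n. q ^ card (H1 \<union> H2)) \<le> (\<Sum>P\<in>linked_pairs k n. q ^ card (V P))"
  proof (rule sum_mono, clarify)
    fix H1 H2 assume "(H1, H2) \<in> linked_pairs k n"
    then have "card (V (H1, H2)) \<le> card (H1 \<union> H2)"
      using card_Union_le_card_edges[OF k] by (auto simp: linked_pairs_def V_def)
    then show "q ^ card (H1 \<union> H2) \<le> q ^ card (V (H1, H2))"
      using q by (intro power_decreasing) auto
  qed
  also have "\<dots> = (\<Sum>W\<in>T. \<Sum>P | P \<in> linked_pairs k n \<and> V P = W. q ^ card (V P))"
    by (rule sum.group[symmetric, OF fin finT VT])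
  also have "\<dots> \<le> (\<Sum>W\<in>T. (2 ^ 2 ^ (2 * k)) ^ 2 * q ^ card W)"
  proof (rule sum_mono)
    fix W assume W: "W \<in> T"
    then have finW: "finite W" using finite_subset[OF _ finite_lessThan] by (auto simp: T_def)
    \<comment> \<open>A pair on the vertex set \<open>W\<close> consists of two families of subsets
      of \<open>W\<close>; this crude count is the source of the double exponential.\<close>
    have "{P. P \<in> linked_pairs k n \<and> V P = W} \<subseteq> Pow (Pow W) \<times> Pow (Pow W)"
      by (auto simp: V_def)
    then have "card {P. P \<in> linked_pairs k n \<and> V P = W} \<le> card (Pow (Pow W) \<times> Pow (Pow W))"
      using finW by (intro card_mono) auto
    also have "\<dots> = (2 ^ 2 ^ card W) ^ 2"
      using finW by (simp add: card_cartesian_product card_Pow power2_eq_square)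
    also have "\<dots> \<le> (2 ^ 2 ^ (2 * k)) ^ 2"
      using W by (intro power_mono power_increasing) (auto simp: T_def)
    finally have "real (card {P. P \<in> linked_pairs k n \<and> V P = W}) \<le> (2 ^ 2 ^ (2 * k)) ^ 2"
      by (metis (mono_tags) of_nat_le_iff of_nat_numeral of_nat_power)
    then have "real (card {P. P \<in> linked_pairs k n \<and> V P = W}) * q ^ card W \<le> (2 ^ 2 ^ (2 * k)) ^ 2 * q ^ card W"
      using q by (intro mult_right_mono) auto
    then show "(\<Sum>P | P \<in> linked_pairs k n \<and> V P = W. q ^ card (V P)) \<le> (2 ^ 2 ^ (2 * k)) ^ 2 * q ^ card W"
      by simp
  qed
  also have "\<dots> = (2 ^ 2 ^ (2 * k)) ^ 2 * (\<Sum>W\<in>T. q ^ card W)"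
    by (simp only: sum_distrib_left)
  also have "\<dots> \<le> (2 ^ 2 ^ (2 * k)) ^ 2 * (real (Suc (2 * k - 2)) * (real n * q) ^ (2 * k - 2))"
    unfolding T_def using q by (intro mult_left_mono sum_subsets_power_le) auto
  also have "\<dots> \<le> (2 ^ 2 ^ (2 * k)) ^ 2 * (real (2 * k) * (real n * q) ^ (2 * k - 2))"
    using q k0 by (intro mult_left_mono mult_right_mono) auto
  finally show ?thesis .
qed

section \<open>Moments of signed counts\<close>

context random_graph
begin

text \<open>Subtract the expansion of \<open>(p - p) ^ card H = 0\<close>: all proper subsets
  cancel, and the full set has coefficient 1.\<close>

lemma expectation_signed_weight_eq:
  assumes H: "H \<subseteq> Kn_edges n" "H \<noteq> {}"
    and eq: "\<And>S. S \<subset> H \<Longrightarrow> subgraph_mean S = p ^ card S"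
  shows "expectation (\<lambda>\<omega>. signed_weight p H (X \<omega>)) = subgraph_mean H - p ^ card H"
proof -
  have fin: "finite H" using H finite_subset[OF _ finite_Kn_edges] by blast
  define c where "c S = (\<Prod>e\<in>S. 1) * (\<Prod>e\<in>H - S. - p)" for S :: "nat set set"
  have "0 = (\<Prod>e\<in>H. p + - p)" using H fin by (simp add: power_0_left)
  also have "\<dots> = (\<Sum>S\<in>Pow H. c S * p ^ card S)"
    by (subst prod_add[OF fin]) (simp add: c_def mult_ac)
  finally have zero: "(\<Sum>S\<in>Pow H. c S * p ^ card S) = 0" by simp
  have "expectation (\<lambda>\<omega>. signed_weight p H (X \<omega>)) = (\<Sum>S\<in>Pow H. c S * subgraph_mean S)"
    unfolding signed_weight_affine expectation_affine_prod[OF H(1)] c_def ..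
  also have "\<dots> = (\<Sum>S\<in>Pow H. c S * subgraph_mean S) - (\<Sum>S\<in>Pow H. c S * p ^ card S)"
    unfolding zero by (rule diff_zero[symmetric])
  also have "\<dots> = (\<Sum>S\<in>Pow H. c S * (subgraph_mean S - p ^ card S))"
    by (simp add: sum_subtractf right_diff_distrib)
  also have "\<dots> = (\<Sum>S\<in>{H}. c S * (subgraph_mean S - p ^ card S))"
    using fin eq by (intro sum.mono_neutral_right) auto
  finally show ?thesis by (simp add: c_def)
qed

lemma var_of_signed_count_le:
  assumes k: "k = 3 \<or> k = 4" and p: "0 \<le> p" "p \<le> 1/2" and "0 \<le> \<theta>"
    and approx: "\<And>S. S \<subseteq> Kn_edges n \<Longrightarrow> card S \<le> 2 * k \<Longrightarrow> \<bar>subgraph_mean S - p ^ card S\<bar> \<le> \<theta> * p ^ card S"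
    and indep: "\<And>S1 S2 v. S1 \<subseteq> Kn_edges n \<Longrightarrow> S2 \<subseteq> Kn_edges n \<Longrightarrow> \<Union>S1 \<inter> \<Union>S2 \<subseteq> {v} \<Longrightarrow>
      subgraph_mean (S1 \<union> S2) = subgraph_mean S1 * subgraph_mean S2"
    and nonneg: "\<And>H. H \<in> cycle_copies k n \<Longrightarrow> 0 \<le> expectation (\<lambda>\<omega>. signed_weight p H (X \<omega>))"
  shows "var_of M (\<lambda>\<omega>. signed_count k n p (X \<omega>))
    \<le> real (card (cycle_copies k n)) * p ^ k + \<theta> * (\<Sum>(H1, H2)\<in>linked_pairs k n. (2 * p) ^ card (H1 \<union> H2))"
proof -
  let ?C = "cycle_copies k n"
  let ?E = "\<lambda>H. expectation (\<lambda>\<omega>. signed_weight p H (X \<omega>))"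
  let ?EE = "\<lambda>H1 H2. expectation (\<lambda>\<omega>. signed_weight p H1 (X \<omega>) * signed_weight p H2 (X \<omega>))"
  have k0: "0 < k" using k by auto
  have finC: "finite ?C" by (rule finite_cycle_copies[OF k])
  have bound: "?EE H1 H2 - ?E H1 * ?E H2 \<le> (if H1 = H2 then p ^ k else 0)
      + (if (H1, H2) \<in> linked_pairs k n then \<theta> * (2 * p) ^ card (H1 \<union> H2) else 0)"
    if H: "H1 \<in> ?C" "H2 \<in> ?C" for H1 H2
  proof -
    have sub: "H1 \<subseteq> Kn_edges n" "H2 \<subseteq> Kn_edges n" using cycle_copy_subset[OF _ k] H by blast+
    have fin: "finite (\<Union>H1 \<inter> \<Union>H2)"
      using finite_subset[OF card_Union_cycle_copy(2)[OF H(1) k0] finite_lessThan] by blast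
    show ?thesis
    proof (cases "(H1, H2) \<in> linked_pairs k n")
      case True
      have "card (H1 \<union> H2) \<le> 2 * k"
        using card_Un_le[of H1 H2] card_cycle_copy[OF H(1) k] card_cycle_copy[OF H(2) k] by simp
      moreover have finU: "finite (H1 \<union> H2)" using sub finite_subset[OF _ finite_Kn_edges] by blast
      ultimately have "card S \<le> 2 * k" if "S \<subseteq> H1 \<union> H2" for S
        using card_mono[OF finU that] by linarith
      then have "\<bar>?EE H1 H2 - (if H1 = H2 then (p * (1 - p)) ^ card H1 else 0)\<bar> \<le> \<theta> * (2 * p) ^ card (H1 \<union> H2)"
        using sub p \<open>0 \<le> \<theta>\<close> by (intro expectation_signed_weight_mult_approx approx) auto
      moreover have "(p * (1 - p)) ^ card H1 \<le> p ^ k"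
        unfolding card_cycle_copy[OF H(1) k] using p by (intro power_mono) (auto simp: mult_left_le)
      then have "(if H1 = H2 then (p * (1 - p)) ^ card H1 else 0) \<le> (if H1 = H2 then p ^ k else 0)" by auto
      moreover have "0 \<le> ?E H1 * ?E H2" using nonneg H by simp
      ultimately show ?thesis unfolding if_P[OF True] by linarith
    next
      case False
      then have "\<not> 2 \<le> card (\<Union>H1 \<inter> \<Union>H2)" using H by (simp add: linked_pairs_def)
      then obtain v where v: "\<Union>H1 \<inter> \<Union>H2 \<subseteq> {v}"
      proof (cases "\<Union>H1 \<inter> \<Union>H2 = {}")
        case True
        then show ?thesis using that[of 0] by simp
      next
        case nempty: False
        then have "card (\<Union>H1 \<inter> \<Union>H2) \<noteq> 0" using fin by simp
        then have "card (\<Union>H1 \<inter> \<Union>H2) = 1" using \<open>\<not> 2 \<le> card (\<Union>H1 \<inter> \<Union>H2)\<close> by linarith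
        then obtain v where "\<Union>H1 \<inter> \<Union>H2 = {v}" by (rule card_1_singletonE)
        then show ?thesis using that[of v] by simp
      qed
      have disj: "H1 \<inter> H2 = {}"
      proof (rule ccontr)
        assume "H1 \<inter> H2 \<noteq> {}"
        then obtain e where e: "e \<in> H1" "e \<in> H2" by auto
        then have "e \<in> Kn_edges n" using sub by blast
        then obtain i j where "i \<noteq> j" "e = {i, j}" by (rule Kn_edgesE)
        with e v show False by auto
      qed
      have "?EE H1 H2 = ?E H1 * ?E H2"
      proof (rule expectation_signed_weight_mult_indep[OF sub disj])
        fix S1 S2 assume S: "S1 \<subseteq> H1" "S2 \<subseteq> H2"
        then have "\<Union>S1 \<inter> \<Union>S2 \<subseteq> {v}" using v by blast
        then show "subgraph_mean (S1 \<union> S2) = subgraph_mean S1 * subgraph_mean S2"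
          using S sub by (intro indep) auto
      qed
      then show ?thesis using False p by simp
    qed
  qed
  have "var_of M (\<lambda>\<omega>. signed_count k n p (X \<omega>))
    \<le> (\<Sum>H1\<in>?C. \<Sum>H2\<in>?C. (if H1 = H2 then p ^ k else 0)
      + (if (H1, H2) \<in> linked_pairs k n then \<theta> * (2 * p) ^ card (H1 \<union> H2) else 0))"
    unfolding var_of_signed_count[OF k] by (intro sum_mono bound)
  also have "\<dots> = (\<Sum>H1\<in>?C. \<Sum>H2\<in>?C. (if H1 = H2 then p ^ k else 0))
      + (\<Sum>H1\<in>?C. \<Sum>H2\<in>?C. (if (H1, H2) \<in> linked_pairs k n then \<theta> * (2 * p) ^ card (H1 \<union> H2) else 0))"
    by (simp only: sum.distrib)
  also have "(\<Sum>H1\<in>?C. \<Sum>H2\<in>?C. (if H1 = H2 then p ^ k else 0)) = real (card ?C) * p ^ k"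
    using finC by simp
  also have "(\<Sum>H1\<in>?C. \<Sum>H2\<in>?C. (if (H1, H2) \<in> linked_pairs k n then \<theta> * (2 * p) ^ card (H1 \<union> H2) else 0))
    = (\<Sum>P\<in>?C \<times> ?C. if P \<in> linked_pairs k n then (case P of (H1, H2) \<Rightarrow> \<theta> * (2 * p) ^ card (H1 \<union> H2)) else 0)"
    unfolding sum.cartesian_product by (intro sum.cong) auto
  also have "\<dots> = (\<Sum>(H1, H2)\<in>(?C \<times> ?C) \<inter> linked_pairs k n. \<theta> * (2 * p) ^ card (H1 \<union> H2))"
    using finC by (subst sum.inter_restrict) auto
  also have "(?C \<times> ?C) \<inter> linked_pairs k n = linked_pairs k n" by (auto simp: linked_pairs_def)
  also have "(\<Sum>(H1, H2)\<in>linked_pairs k n. \<theta> * (2 * p) ^ card (H1 \<union> H2))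
    = \<theta> * (\<Sum>(H1, H2)\<in>linked_pairs k n. (2 * p) ^ card (H1 \<union> H2))"
    unfolding sum_distrib_left by (intro sum.cong) auto
  finally show ?thesis .
qed

end

section \<open>Moments in the geometric graph at fixed parameters\<close>

lemma random_graph_rgg:
  assumes "1 \<le> d"
  shows "random_graph (rgg_points n d) (rgg_graph d p) n"
  using prob_space_rgg_points rgg_graph_measurable[OF assms] rgg_graph_01
  by (intro random_graph.intro random_graph_axioms.intro)

lemma subgraph_mean_rgg:
  assumes "1 \<le> d" "S \<subseteq> Kn_edges n"
  shows "random_graph.subgraph_mean (rgg_points n d) (rgg_graph d p) S = edge_mean n {..tau d p} S ^ d"
  using random_graph.subgraph_mean_def[OF random_graph_rgg[OF assms(1)]] expectation_rgg_subgraph[OF assms]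
  by simp

text \<open>Bernoulli's inequality from below; from above \<open>exp u <= 1 + u + u ^ 2\<close> with
  \<open>u = d * \<bar>x\<bar> <= 1\<close>, where the square is at most \<open>u\<close>.\<close>

lemma one_plus_power_approx:
  fixes x :: real
  assumes "real d * \<bar>x\<bar> \<le> 1"
  shows "\<bar>(1 + x) ^ d - 1\<bar> \<le> 2 * real d * \<bar>x\<bar>"
proof (cases "d = 0")
  case False
  then have "\<bar>x\<bar> \<le> real d * \<bar>x\<bar>" by (intro mult_right_mono[of 1 "real d", simplified]) auto
  with assms have x: "\<bar>x\<bar> \<le> 1" by linarith
  have "1 + real d * x \<le> (1 + x) ^ d" using x by (intro Bernoulli_inequality) auto
  moreover have "- (real d * \<bar>x\<bar>) \<le> real d * x" using mult_left_mono[of "- \<bar>x\<bar>" x "real d"] by auto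
  moreover have "(1 + x) ^ d \<le> exp (real d * \<bar>x\<bar>)"
  proof -
    have "(1 + x) ^ d \<le> exp \<bar>x\<bar> ^ d"
      using x exp_ge_add_one_self[of "\<bar>x\<bar>"] by (intro power_mono; linarith)
    then show ?thesis by (simp add: exp_of_nat_mult)
  qed
  moreover have "exp (real d * \<bar>x\<bar>) \<le> 1 + real d * \<bar>x\<bar> + (real d * \<bar>x\<bar>)\<^sup>2"
    using assms by (intro exp_bound) auto
  moreover have "(real d * \<bar>x\<bar>)\<^sup>2 \<le> real d * \<bar>x\<bar>"
    using assms by (simp add: power2_eq_square mult_left_le)
  moreover have "0 \<le> real d * \<bar>x\<bar>" by simp
  ultimately show ?thesis unfolding abs_le_iff by linarith
qed simp

text \<open>Two cycles have at most 8 edges, so \<open>t ^ s >= (53 / 54) ^ 8 >= 1 / 2\<close>, and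
  the additive error \<open>2 ^ 8 * (1 - t) ^ 3\<close> of one coordinate becomes a relative error
  \<open>512 * (1 - t) ^ 3\<close>. The \<open>d\<close>-th power multiplies it by at most
  \<open>2d\<close>.\<close>

lemma edge_mean_power_approx:
  assumes d: "1 \<le> d" and p: "0 < p" "p < 1" and S: "S \<subseteq> Kn_edges n" "card S \<le> 8"
    and small: "1 - tau d p \<le> 1 / 54" "512 * real d * (1 - tau d p) ^ 3 \<le> 1"
  shows "\<bar>edge_mean n {..tau d p} S ^ d - p ^ card S\<bar> \<le> 1024 * real d * (1 - tau d p) ^ 3 * p ^ card S"
proof -
  define t where "t = tau d p"
  have t: "t ^ d = p" "0 < t" "t < 1" using tau_properties[OF d p] by (auto simp: t_def)
  define s where "s = card S"
  define x where "x = edge_mean n {..t} S / t ^ s - 1"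
  have ts: "0 < t ^ s" using t by simp
  have "(53 / 54) ^ 8 \<le> t ^ 8" using small(1) t by (intro power_mono) (auto simp: t_def)
  moreover have "t ^ 8 \<le> t ^ s" using t S(2) by (intro power_decreasing) (auto simp: s_def)
  moreover have "(1::real) / 2 \<le> (53 / 54) ^ 8" by (simp add: power_divide)
  ultimately have half: "1 / 2 \<le> t ^ s" by linarith
  have "\<bar>edge_mean n {..t} S - t ^ s\<bar> \<le> 2 ^ s * (1 - t) ^ 3"
    unfolding s_def using small(1) t by (intro edge_mean_le_approx S) (auto simp: t_def)
  also have "\<dots> \<le> 2 ^ 8 * (1 - t) ^ 3"
    using S(2) t by (intro mult_right_mono power_increasing) (auto simp: s_def)
  also have "\<dots> = (512 * (1 - t) ^ 3) * (1 / 2)" by simp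
  also have "\<dots> \<le> (512 * (1 - t) ^ 3) * t ^ s" using half t by (intro mult_left_mono) auto
  finally have "\<bar>edge_mean n {..t} S - t ^ s\<bar> / t ^ s \<le> 512 * (1 - t) ^ 3"
    using ts by (simp add: pos_divide_le_eq)
  moreover have "x = (edge_mean n {..t} S - t ^ s) / t ^ s" 
    using less_imp_neq[OF ts] by (simp add: x_def diff_divide_distrib del: power_eq_0_iff)
  ultimately have x: "\<bar>x\<bar> \<le> 512 * (1 - t) ^ 3" using ts by (simp add: abs_divide)
  then have dx: "real d * \<bar>x\<bar> \<le> real d * (512 * (1 - t) ^ 3)" by (intro mult_left_mono) auto
  have "edge_mean n {..t} S = t ^ s * (1 + x)" using t by (simp add: x_def)
  then have "edge_mean n {..t} S ^ d = p ^ s * (1 + x) ^ d"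
    by (simp add: power_mult_distrib t(1)[symmetric] power_mult[symmetric] mult.commute)
  then have "\<bar>edge_mean n {..t} S ^ d - p ^ s\<bar> = p ^ s * \<bar>(1 + x) ^ d - 1\<bar>"
  proof -
    have "p ^ s * (1 + x) ^ d - p ^ s = p ^ s * ((1 + x) ^ d - 1)" by (simp add: right_diff_distrib)
    then show ?thesis using \<open>edge_mean n {..t} S ^ d = p ^ s * (1 + x) ^ d\<close> p by (simp add: abs_mult)
  qed
  also have "\<dots> \<le> p ^ s * (2 * real d * \<bar>x\<bar>)"
    using p dx small(2) by (intro mult_left_mono one_plus_power_approx) (auto simp: t_def)
  also have "\<dots> \<le> p ^ s * (1024 * real d * (1 - t) ^ 3)"
    using p dx by (intro mult_left_mono) (auto simp: mult_ac)
  finally show ?thesis unfolding t_def[symmetric] s_def[symmetric] by (simp add: mult.commute)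
qed

text \<open>As \<open>t ^ k <= 1\<close>, the additive gain \<open>\<eta>\<close> of one coordinate
  is at least a factor \<open>1 + \<eta>\<close>; Bernoulli's inequality collects the
  \<open>d\<close> factors.\<close>

lemma edge_mean_power_cycle_ge:
  assumes d: "1 \<le> d" and p: "0 < p" "p < 1" and H: "H \<in> cycle_copies k n" "k = 3 \<or> k = 4"
    and small: "1 - tau d p \<le> 1 / 54"
  shows "p ^ k * (real d * (1 - tau d p) ^ 3 / 54) \<le> edge_mean n {..tau d p} H ^ d - p ^ k"
proof -
  define t where "t = tau d p"
  have t: "t ^ d = p" "0 < t" "t < 1" using tau_properties[OF d p] by (auto simp: t_def)
  define \<eta> where "\<eta> = (1 - t) ^ 3 / 54"
  have \<eta>: "0 \<le> \<eta>" using t by (simp add: \<eta>_def)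
  have tk: "0 < t ^ k" "t ^ k \<le> 1" using t by (auto intro: power_le_one)
  have "p ^ k * (1 + real d * \<eta>) \<le> p ^ k * (1 + \<eta>) ^ d"
    using p \<eta> by (intro mult_left_mono Bernoulli_inequality) auto
  also have "\<dots> = (t ^ k * (1 + \<eta>)) ^ d"
    by (simp add: power_mult_distrib t(1)[symmetric] power_mult[symmetric] mult.commute)
  also have "\<dots> \<le> edge_mean n {..t} H ^ d"
  proof (rule power_mono)
    have "t ^ k * (1 + \<eta>) \<le> t ^ k + \<eta>" using tk \<eta> by (simp add: distrib_left mult_left_le_one_le)
    also have "\<dots> \<le> edge_mean n {..t} H"
      unfolding \<eta>_def using small t by (intro edge_mean_le_cycle_ge[OF H]) (auto simp: t_def)
    finally show "t ^ k * (1 + \<eta>) \<le> edge_mean n {..t} H" .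
    show "0 \<le> t ^ k * (1 + \<eta>)" using tk \<eta> by simp
  qed
  finally show ?thesis by (simp add: t_def \<eta>_def distrib_left)
qed

lemma subgraph_mean_rgg_Un:
  assumes "1 \<le> d" "S1 \<subseteq> Kn_edges n" "S2 \<subseteq> Kn_edges n" "\<Union>S1 \<inter> \<Union>S2 \<subseteq> {v}"
  shows "random_graph.subgraph_mean (rgg_points n d) (rgg_graph d p) (S1 \<union> S2)
    = random_graph.subgraph_mean (rgg_points n d) (rgg_graph d p) S1
      * random_graph.subgraph_mean (rgg_points n d) (rgg_graph d p) S2"
  using assms edge_mean_Un[OF assms(2,3) _ assms(4), of "{..tau d p}"]
  by (simp add: subgraph_mean_rgg power_mult_distrib)

lemma rgg_bounds:
  assumes k: "k = 3 \<or> k = 4" and d: "1 \<le> d" and p: "0 < p" "p \<le> 1/2" and np: "1 \<le> real n * p"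
    and small: "1 - tau d p \<le> 1 / 54" "512 * real d * (1 - tau d p) ^ 3 \<le> 1"
  defines "N \<equiv> real (card (cycle_copies k n))" and "g \<equiv> real d * (1 - tau d p) ^ 3"
  shows "N * (p ^ k * (g / 54)) \<le> E_rgg k n d p"
    and "E_rgg k n d p \<le> N * (1024 * g * (2 * p) ^ k)"
    and "Var_rgg k n d p \<le> N * p ^ k
      + 1024 * g * ((2 ^ 2 ^ (2 * k)) ^ 2 * (real (2 * k) * (real n * (2 * p)) ^ (2 * k - 2)))"
proof -
  interpret R: random_graph "rgg_points n d" "rgg_graph d p" n
    by (rule random_graph_rgg[OF d])
  have p1: "p < 1" using p by simp
  note tau = tau_properties[OF d p(1) p1]
  have g0: "0 \<le> g" using tau by (simp add: g_def)
  have approx: "\<bar>R.subgraph_mean S - p ^ card S\<bar> \<le> 1024 * g * p ^ card S"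
    if "S \<subseteq> Kn_edges n" "card S \<le> 8" for S
    using edge_mean_power_approx[OF d p(1) p1 that small] that
    by (simp add: subgraph_mean_rgg[OF d] g_def mult.assoc)
  have SW_ge: "p ^ k * (g / 54) \<le> R.expectation (\<lambda>x. signed_weight p H (rgg_graph d p x))"
    if H: "H \<in> cycle_copies k n" for H
  proof -
    have sub: "H \<subseteq> Kn_edges n" by (rule cycle_copy_subset[OF H k])
    have ne: "H \<noteq> {}" using card_cycle_copy[OF H k] k by auto
    have eq: "R.subgraph_mean S = p ^ card S" if S: "S \<subset> H" for S
    proof -
      have "R.subgraph_mean S = (tau d p ^ card S) ^ d"
        using S sub tau by (subst subgraph_mean_rgg[OF d]) (auto simp: edge_mean_le_cycle_subset[OF H k S])
      also have "\<dots> = p ^ card S" by (metis tau(1) mult.commute power_mult)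
      finally show ?thesis .
    qed
    have "R.expectation (\<lambda>x. signed_weight p H (rgg_graph d p x)) = edge_mean n {..tau d p} H ^ d - p ^ k"
      using R.expectation_signed_weight_eq[OF sub ne eq] card_cycle_copy[OF H k] subgraph_mean_rgg[OF d sub]
      by simp
    then show ?thesis using edge_mean_power_cycle_ge[OF d p(1) p1 H k small(1)] by (simp add: g_def)
  qed
  have SW_nonneg: "0 \<le> R.expectation (\<lambda>x. signed_weight p H (rgg_graph d p x))"
    if "H \<in> cycle_copies k n" for H
  proof -
    have "0 \<le> p ^ k * (g / 54)" using g0 p by simp
    then show ?thesis using SW_ge[OF that] by (rule order_trans)
  qed
  have SW_le: "R.expectation (\<lambda>x. signed_weight p H (rgg_graph d p x)) \<le> 1024 * g * (2 * p) ^ k"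
    if H: "H \<in> cycle_copies k n" for H
  proof -
    have sub: "H \<subseteq> Kn_edges n" by (rule cycle_copy_subset[OF H k])
    have card: "card H = k" by (rule card_cycle_copy[OF H k])
    have fin: "finite H" by (rule finite_subset[OF sub finite_Kn_edges])
    have "card S \<le> 8" if "S \<subseteq> H" for S using card_mono[OF fin that] card k by auto
    then have "\<bar>R.expectation (\<lambda>x. signed_weight p H (rgg_graph d p x))\<bar> \<le> 1024 * g * (2 * p) ^ card H"
      using sub card k p by (intro R.expectation_signed_weight_approx approx) auto
    then show ?thesis using card by simp
  qed
  have E_eq: "E_rgg k n d p = (\<Sum>H\<in>cycle_copies k n. R.expectation (\<lambda>x. signed_weight p H (rgg_graph d p x)))"
    unfolding E_rgg_def by (rule R.expectation_signed_count[OF k])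
  show "N * (p ^ k * (g / 54)) \<le> E_rgg k n d p"
    unfolding E_eq N_def by (rule sum_bounded_below[OF SW_ge])
  show "E_rgg k n d p \<le> N * (1024 * g * (2 * p) ^ k)"
    unfolding E_eq N_def by (rule sum_bounded_above[OF SW_le])
  have "Var_rgg k n d p \<le> N * p ^ k + 1024 * g * (\<Sum>(H1, H2)\<in>linked_pairs k n. (2 * p) ^ card (H1 \<union> H2))"
    unfolding Var_rgg_def N_def
  proof (rule R.var_of_signed_count_le[OF k])
    show "\<bar>R.subgraph_mean S - p ^ card S\<bar> \<le> 1024 * g * p ^ card S"
      if "S \<subseteq> Kn_edges n" "card S \<le> 2 * k" for S
      using that k by (intro approx) auto
  qed (use p g0 SW_nonneg subgraph_mean_rgg_Un[OF d] in auto)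
  also have "(\<Sum>(H1, H2)\<in>linked_pairs k n. (2 * p) ^ card (H1 \<union> H2))
      \<le> (2 ^ 2 ^ (2 * k)) ^ 2 * (real (2 * k) * (real n * (2 * p)) ^ (2 * k - 2))"
    using p np by (intro sum_linked_pairs_le[OF k]) auto
  finally show "Var_rgg k n d p \<le> N * p ^ k
      + 1024 * g * ((2 ^ 2 ^ (2 * k)) ^ 2 * (real (2 * k) * (real n * (2 * p)) ^ (2 * k - 2)))"
    using g0 by (simp add: mult_left_mono)
qed

section \<open>Moments in the Erdos-Renyi graph\<close>

lemma random_graph_er:
  "random_graph (measure_pmf (er n p)) (\<lambda>\<omega> e. of_bool (\<omega> e)) n"
  by (intro random_graph.intro random_graph_axioms.intro measure_pmf.prob_space_axioms) auto

lemma subgraph_mean_er: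
  assumes "S \<subseteq> Kn_edges n" "0 \<le> p" "p \<le> 1"
  shows "random_graph.subgraph_mean (measure_pmf (er n p)) (\<lambda>\<omega> e. of_bool (\<omega> e)) S = p ^ card S"
proof -
  \<comment> \<open>Factors 1 off \<open>S\<close> extend the product to all edges, the index set of
    \<open>Pi_pmf\<close>.\<close>
  define f where "f = (\<lambda>e b. if e \<in> S then of_bool b else 1 :: real)"
  have eq: "(\<Prod>e\<in>S. g e) = (\<Prod>e\<in>Kn_edges n. if e \<in> S then g e else 1)" for g :: "nat set \<Rightarrow> real"
  proof -
    have "(\<Prod>e\<in>Kn_edges n. if e \<in> S then g e else 1) = prod g (Kn_edges n \<inter> S)"
      by (intro prod.inter_restrict[symmetric] finite_Kn_edges)
    moreover have "Kn_edges n \<inter> S = S" using assms(1) by blast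
    ultimately show ?thesis by simp
  qed
  have "measure_pmf.expectation (er n p) (\<lambda>\<omega>. \<Prod>e\<in>S. of_bool (\<omega> e))
      = measure_pmf.expectation (er n p) (\<lambda>\<omega>. \<Prod>e\<in>Kn_edges n. f e (\<omega> e))"
    unfolding f_def by (subst eq) simp
  also have "\<dots> = (\<Prod>e\<in>Kn_edges n. measure_pmf.expectation (bernoulli_pmf p) (f e))"
    unfolding er_def
    by (rule expectation_prod_Pi_pmf) (auto simp: f_def intro!: integrable_measure_pmf_finite)
  also have "\<dots> = (\<Prod>e\<in>Kn_edges n. if e \<in> S then p else 1)"
    using assms(2,3) by (intro prod.cong) (auto simp: f_def)
  also have "\<dots> = p ^ card S" by (subst eq[symmetric]) simp
  finally show ?thesis
    by (simp add: random_graph.subgraph_mean_def[OF random_graph_er])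
qed

text \<open>Independent edges satisfy the approximation with \<open>\<theta> = 0\<close>, which
  turns it into an identity; only diagonal pairs remain.\<close>

lemma Var_er_eq:
  assumes k: "k = 3 \<or> k = 4" and p: "0 \<le> p" "p \<le> 1/2"
  shows "Var_er k n p = real (card (cycle_copies k n)) * (p * (1 - p)) ^ k"
proof -
  interpret R: random_graph "measure_pmf (er n p)" "\<lambda>\<omega> e. of_bool (\<omega> e)" n
    by (rule random_graph_er)
  let ?C = "cycle_copies k n"
  have mean: "R.subgraph_mean S = p ^ card S" if "S \<subseteq> Kn_edges n" for S
    using subgraph_mean_er[OF that, of p] p by simp
  have E: "measure_pmf.expectation (er n p) (\<lambda>\<omega>. signed_weight p H (\<lambda>e. of_bool (\<omega> e))) = 0"
    if H: "H \<in> ?C" for H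
  proof -
    have sub: "H \<subseteq> Kn_edges n" by (rule cycle_copy_subset[OF H k])
    moreover have "H \<noteq> {}" using card_cycle_copy[OF H k] k by auto
    ultimately show ?thesis using mean by (subst R.expectation_signed_weight_eq) auto
  qed
  have EE: "measure_pmf.expectation (er n p)
      (\<lambda>\<omega>. signed_weight p H1 (\<lambda>e. of_bool (\<omega> e)) * signed_weight p H2 (\<lambda>e. of_bool (\<omega> e)))
      = (if H1 = H2 then (p * (1 - p)) ^ k else 0)" if H: "H1 \<in> ?C" "H2 \<in> ?C" for H1 H2
  proof -
    have sub: "H1 \<subseteq> Kn_edges n" "H2 \<subseteq> Kn_edges n" using cycle_copy_subset[OF _ k] H by blast+
    have "\<bar>R.subgraph_mean S - p ^ card S\<bar> \<le> 0 * p ^ card S" if "S \<subseteq> H1 \<union> H2" for S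
    proof -
      have "S \<subseteq> Kn_edges n" using that sub by blast
      then show ?thesis by (simp add: mean)
    qed
    from R.expectation_signed_weight_mult_approx[OF sub p order_refl this] show ?thesis
      using card_cycle_copy[OF H(1) k] by auto
  qed
  have "Var_er k n p = (\<Sum>H1\<in>?C. \<Sum>H2\<in>?C. if H1 = H2 then (p * (1 - p)) ^ k else 0)"
    unfolding Var_er_def R.var_of_signed_count[OF k]
    by (intro sum.cong refl) (simp only: E EE mult_zero_left diff_zero)
  then show ?thesis using finite_cycle_copies[OF k] by simp
qed

text \<open>Lower bound: otherwise \<open>tau ^ d > (1 - 1 / (2d)) ^ d >= 1 / 2 >= p\<close>. Upper
  bound: \<open>ln p = d * ln tau <= d * (tau - 1)\<close>, and \<open>ln p >= - ln n\<close>
  because \<open>n p >= 1\<close>.\<close>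

lemma one_minus_tau_bounds:
  assumes d: "1 \<le> d" and p: "0 < p" "p \<le> 1/2" and np: "1 \<le> real n * p"
  shows "1 / (2 * real d) \<le> 1 - tau d p" and "1 - tau d p \<le> ln (real n) / real d"
proof -
  have p1: "p < 1" using p by simp
  note tau = tau_properties[OF d p(1) p1]
  show "1 / (2 * real d) \<le> 1 - tau d p"
  proof (rule ccontr)
    assume "\<not> 1 / (2 * real d) \<le> 1 - tau d p"
    then have *: "1 - 1 / (2 * real d) < tau d p" by simp
    have "1 / (2 * real d) \<le> 1" using d by simp
    then have "1 + real d * (- (1 / (2 * real d))) \<le> (1 + - (1 / (2 * real d))) ^ d"
      by (intro Bernoulli_inequality) simp
    also have "\<dots> < tau d p ^ d"
      using * \<open>1 / (2 * real d) \<le> 1\<close> d by (intro power_strict_mono) auto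
    finally show False using tau(1) p d by simp
  qed
  have n0: "0 < real n" using np p by (cases n) auto
  have "ln p = real d * ln (tau d p)" using tau by (metis ln_realpow)
  moreover have "ln (tau d p) \<le> tau d p - 1" using tau by (intro ln_le_minus_one) auto
  ultimately have "ln p \<le> real d * (tau d p - 1)" by (simp add: mult_left_mono)
  moreover have "0 \<le> ln (real n * p)" using np by simp
  then have "0 \<le> ln (real n) + ln p" using n0 p by (simp add: ln_mult)
  ultimately have "real d * (1 - tau d p) \<le> ln (real n)" by (simp add: right_diff_distrib)
  then show "1 - tau d p \<le> ln (real n) / real d" using d by (simp add: pos_le_divide_eq mult.commute)
qed

section \<open>Asymptotics\<close>

text \<open>What the assumption provides for large \<open>n\<close>. The logarithmic conditions make
  \<open>1 - tau\<close> and \<open>d * (1 - tau) ^ 3\<close> small enough for the estimates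
  above.\<close>

definition sparse_regime :: "nat \<Rightarrow> nat \<Rightarrow> real \<Rightarrow> bool" where
  "sparse_regime n d p \<longleftrightarrow> 1 \<le> d \<and> 0 < p \<and> p \<le> 1/2 \<and> 1 \<le> real n * p \<and> 4 \<le> n \<and>
      ln (real n) / real d \<le> 1 / 54 \<and> 512 * ln (real n) ^ 3 / real d ^ 2 \<le> 1 \<and> 1 \<le> ln (real n)"

text \<open>A single constant \<open>K\<close> serves all bounds, so that the limit arguments see no
  explicit numbers.\<close>

definition moments_within :: "real \<Rightarrow> nat \<Rightarrow> nat \<Rightarrow> nat \<Rightarrow> real \<Rightarrow> bool" where
  "moments_within K k n d p \<longleftrightarrow>
      (real n * p) ^ k / (K * real d ^ 2) \<le> E_rgg k n d p \<and>
      E_rgg k n d p \<le> K * ((real n * p) ^ k * ln (real n) ^ 3 / real d ^ 2) \<and>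
      0 \<le> Var_rgg k n d p \<and>
      Var_rgg k n d p \<le> K * ((real n * p) ^ k + (real n * p) ^ (2 * k - 2) * ln (real n) ^ 3 / real d ^ 2) \<and>
      (real n * p) ^ k / K \<le> Var_er k n p \<and> Var_er k n p \<le> (real n * p) ^ k"

lemma moment_bounds:
  "\<exists>K::real. 1 \<le> K \<and> (\<forall>k n d p. k = 3 \<or> k = 4 \<longrightarrow> sparse_regime n d p \<longrightarrow> moments_within K k n d p)"
proof -
  \<comment> \<open>\<open>K0\<close> counts pairs for \<open>k = 4\<close>, the larger case. The
    factor in \<open>K\<close> covers all constants below: \<open>256 * 8 * 54 = 110592\<close> and
    \<open>1024 * 16\<close> for the mean, \<open>1024 * 8 * 64 = 524288\<close> for the geometric
    variance, and \<open>256 * 16\<close> for the Erdos-Renyi variance.\<close>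
  define K0 :: real where "K0 = (2 ^ 2 ^ 8) ^ 2"
  define K where "K = 1000000 * K0"
  have K0: "1 \<le> K0" unfolding K0_def by (intro one_le_power) simp
  show ?thesis
  proof (intro exI[of _ K] conjI allI impI)
    show "1 \<le> K" using K0 by (simp add: K_def)
    fix k n d :: nat and p :: real
    assume k: "k = 3 \<or> k = 4" and "sparse_regime n d p"
    then have d: "1 \<le> d" and p: "0 < p" "p \<le> 1/2" and np: "1 \<le> real n * p"
      and n: "4 \<le> n" and small: "ln (real n) / real d \<le> 1 / 54" "512 * ln (real n) ^ 3 / real d ^ 2 \<le> 1"
      unfolding sparse_regime_def by blast+
    define y where "y = real n * p"
    define l where "l = ln (real n)"
    define g where "g = real d * (1 - tau d p) ^ 3"
    define N where "N = real (card (cycle_copies k n))"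
    have p1: "p < 1" using p by simp
    note tau = tau_properties[OF d p(1) p1]
    note lam = one_minus_tau_bounds[OF d p np]
    have d0: "0 < real d" using d by simp
    have y1: "1 \<le> y" using np by (simp add: y_def)
    have l0: "0 \<le> l" using n by (simp add: l_def)
    have "(1 - tau d p) ^ 3 \<le> (l / real d) ^ 3"
      using lam(2) tau by (intro power_mono) (auto simp: l_def)
    then have "g \<le> real d * (l / real d) ^ 3" using d0 by (simp add: g_def)
    also have "\<dots> = l ^ 3 / real d ^ 2" using d0 by (simp add: field_simps power3_eq_cube power2_eq_square)
    finally have g_le: "g \<le> l ^ 3 / real d ^ 2" .
    have "(1 / (2 * real d)) ^ 3 \<le> (1 - tau d p) ^ 3"
      using lam(1) d0 by (intro power_mono) auto
    then have "real d * (1 / (2 * real d)) ^ 3 \<le> g" using d0 by (simp add: g_def)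
    moreover have "real d * (1 / (2 * real d)) ^ 3 = 1 / (8 * real d ^ 2)"
      using d0 by (simp add: field_simps power3_eq_cube power2_eq_square)
    ultimately have g_ge: "1 / (8 * real d ^ 2) \<le> g" by simp
    have g0: "0 \<le> g" using tau by (simp add: g_def)
    have s1: "1 - tau d p \<le> 1 / 54" using lam(2) small(1) by linarith
    have s2: "512 * real d * (1 - tau d p) ^ 3 \<le> 1"
      using g_le small(2) by (simp add: g_def l_def)
    note R = rgg_bounds[OF k d p np s1 s2, folded N_def g_def]
    have N_le: "N \<le> real n ^ k"
      using card_cycle_copies_le[of k n] k unfolding N_def by (metis of_nat_le_iff of_nat_power zero_less_numeral)
    \<comment> \<open>\<open>256 = 4 ^ 4\<close> is the larger of the two values of
      \<open>k ^ k\<close>.\<close>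
    have N_ge: "real n ^ k / 256 \<le> N"
    proof -
      have "real k ^ k \<le> 256" "0 < real k ^ k" using k by auto
      then have "real n ^ k / 256 \<le> real n ^ k / real k ^ k" by (intro divide_left_mono) auto
      also have "\<dots> \<le> N" unfolding N_def power_divide[symmetric]
        using k n by (intro card_cycle_copies_ge) auto
      finally show ?thesis .
    qed
    have N0: "0 \<le> N" by (simp add: N_def)
    have y_pow: "real n ^ k * p ^ k = y ^ k" by (simp add: y_def power_mult_distrib)
    have yk0: "0 \<le> y ^ k" using y1 by simp
    have two_k: "(2::real) ^ k \<le> 16" using k by auto
    have E_ge: "y ^ k / (K * real d ^ 2) \<le> E_rgg k n d p"
    proof -
      have "y ^ k / (K * real d ^ 2) \<le> y ^ k / (110592 * real d ^ 2)"
        using d0 yk0 K0 by (intro divide_left_mono mult_right_mono) (auto simp: K_def)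
      also have "\<dots> = real n ^ k / 256 * (p ^ k * (1 / (8 * real d ^ 2) / 54))"
        unfolding y_pow[symmetric] by (simp add: field_simps)
      also have "\<dots> \<le> N * (p ^ k * (g / 54))"
        using N_ge g_ge p N0 by (intro mult_mono mult_left_mono divide_right_mono) auto
      also have "\<dots> \<le> E_rgg k n d p" by (rule R(1))
      finally show ?thesis .
    qed
    have E_le: "E_rgg k n d p \<le> K * (y ^ k * l ^ 3 / real d ^ 2)"
    proof -
      have "E_rgg k n d p \<le> N * (1024 * g * (2 * p) ^ k)" by (rule R(2))
      also have "\<dots> \<le> real n ^ k * (1024 * g * (2 * p) ^ k)"
        using N_le g0 p by (intro mult_right_mono) auto
      also have "\<dots> = 1024 * 2 ^ k * (y ^ k * g)"
        unfolding y_pow[symmetric] by (simp add: power_mult_distrib)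
      also have "\<dots> \<le> 1024 * 16 * (y ^ k * (l ^ 3 / real d ^ 2))"
        using two_k yk0 g0 g_le by (intro mult_mono) auto
      also have "\<dots> \<le> K * (y ^ k * (l ^ 3 / real d ^ 2))"
        using K0 yk0 l0 by (intro mult_right_mono) (auto simp: K_def)
      finally show ?thesis by simp
    qed
    have V_le: "Var_rgg k n d p \<le> K * (y ^ k + y ^ (2 * k - 2) * l ^ 3 / real d ^ 2)"
    proof -
      have c1: "(2 ^ 2 ^ (2 * k)) ^ 2 \<le> K0"
        unfolding K0_def using k by (intro power_mono power_increasing) auto
      have c2: "real (2 * k) \<le> 8" using k by auto
      have c3: "(2::real) ^ (2 * k - 2) \<le> 64" using k by auto
      have yk2: "0 \<le> y ^ (2 * k - 2)" using y1 by simp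
      have "(real n * (2 * p)) ^ (2 * k - 2) = 2 ^ (2 * k - 2) * y ^ (2 * k - 2)"
        unfolding power_mult_distrib[symmetric] y_def by (simp add: mult_ac)
      also have "\<dots> \<le> 64 * y ^ (2 * k - 2)" using c3 yk2 by (intro mult_right_mono)
      finally have c4: "(real n * (2 * p)) ^ (2 * k - 2) \<le> 64 * y ^ (2 * k - 2)" .
      have "Var_rgg k n d p \<le> N * p ^ k
        + 1024 * g * ((2 ^ 2 ^ (2 * k)) ^ 2 * (real (2 * k) * (real n * (2 * p)) ^ (2 * k - 2)))"
        by (rule R(3))
      also have "\<dots> \<le> real n ^ k * p ^ k + 1024 * (l ^ 3 / real d ^ 2) * (K0 * (8 * (64 * y ^ (2 * k - 2))))"
        using N_le p g_le g0 c1 c2 c4 K0 yk2 l0 by (intro add_mono mult_mono mult_nonneg_nonneg) auto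
      also have "\<dots> = y ^ k + 524288 * K0 * (y ^ (2 * k - 2) * l ^ 3 / real d ^ 2)"
        unfolding y_pow by simp
      also have "\<dots> \<le> K * y ^ k + K * (y ^ (2 * k - 2) * l ^ 3 / real d ^ 2)"
      proof (rule add_mono)
        show "y ^ k \<le> K * y ^ k" using yk0 K0 mult_right_mono[of 1 K "y ^ k"] by (simp add: K_def)
        show "524288 * K0 * (y ^ (2 * k - 2) * l ^ 3 / real d ^ 2) \<le> K * (y ^ (2 * k - 2) * l ^ 3 / real d ^ 2)"
          using yk2 l0 K0 by (intro mult_right_mono) (auto simp: K_def)
      qed
      finally show ?thesis by (simp only: distrib_left)
    qed
    have V_nonneg: "0 \<le> Var_rgg k n d p"
      unfolding Var_rgg_def var_of_def by (intro integral_nonneg_AE AE_I2) simp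
    have p0: "0 \<le> p" using p by simp
    have er: "Var_er k n p = N * (p * (1 - p)) ^ k"
      unfolding N_def by (rule Var_er_eq[OF k p0 p(2)])
    have er_le: "Var_er k n p \<le> y ^ k"
    proof -
      have "(p * (1 - p)) ^ k \<le> p ^ k" using p by (intro power_mono) (auto simp: mult_left_le)
      then show ?thesis unfolding er y_pow[symmetric] using N_le p by (intro mult_mono) auto
    qed
    have er_ge: "y ^ k / K \<le> Var_er k n p"
    proof -
      have "y ^ k / K \<le> y ^ k / 4096" using yk0 K0 by (intro divide_left_mono) (auto simp: K_def)
      also have "\<dots> = real n ^ k / 256 * (p ^ k / 16)" unfolding y_pow[symmetric] by simp
      also have "\<dots> \<le> N * (p * (1 - p)) ^ k"
      proof (rule mult_mono[OF N_ge _ N0])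
        have "p ^ k / 16 \<le> p ^ k / 2 ^ k" using two_k p by (intro divide_left_mono) auto
        also have "\<dots> = (p / 2) ^ k" by (simp add: power_divide)
        also have "\<dots> \<le> (p * (1 - p)) ^ k"
          using p mult_left_mono[of "1/2" "1 - p" p] by (intro power_mono) auto
        finally show "p ^ k / 16 \<le> (p * (1 - p)) ^ k" .
        show "0 \<le> p ^ k / 16" using p by simp
      qed
      finally show ?thesis unfolding er .
    qed
    show "moments_within K k n d p"
      using E_ge E_le V_nonneg V_le er_le er_ge unfolding moments_within_def y_def l_def by blast
  qed
qed

section \<open>From bounds at fixed parameters to the two sides of the threshold\<close>

lemma assumption_A_eventually:
  assumes "assumption_A \<delta> \<epsilon> p d" "\<delta> > 0" "\<epsilon> > 0"
  shows "\<forall>\<^sub>F n in sequentially. sparse_regime n (d n) (p n)"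
proof -
  \<comment> \<open>The bound \<open>d >= n ^ \<delta>\<close> beats every power of
    \<open>ln n\<close>; the bound on \<open>p\<close> gives
    \<open>n p >= n ^ \<epsilon> >= 1\<close>.\<close>
  have e1: "\<forall>\<^sub>F n in sequentially. ln (real n) / real n powr \<delta> \<le> 1 / 54"
    using assms(2) by real_asymp
  have e2: "\<forall>\<^sub>F n in sequentially. 512 * ln (real n) ^ 3 / (real n powr \<delta>) ^ 2 \<le> 1"
    using assms(2) by real_asymp
  have e3: "\<forall>\<^sub>F n in sequentially. 1 \<le> ln (real n)" by real_asymp
  have e4: "\<forall>\<^sub>F n in sequentially. 4 \<le> n" by (rule eventually_ge_at_top)
  from assms(1)[unfolded assumption_A_def] e1 e2 e3 e4 show ?thesis
  proof eventually_elim
    case (elim n)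
    have n: "1 \<le> real n" using elim by simp
    have "1 \<le> real n powr \<delta>" using n assms(2) by (intro ge_one_powr_ge_zero) auto
    then have d: "1 \<le> real (d n)" and pd: "0 < real n powr \<delta>" using elim by linarith+
    have "0 < real n powr (-1 + \<epsilon>)" using n by simp
    then have p: "0 < p n" using elim by linarith
    have "1 \<le> real n powr \<epsilon>" using n assms(3) by (intro ge_one_powr_ge_zero) auto
    also have "\<dots> = real n * real n powr (-1 + \<epsilon>)" using n by (simp add: powr_diff)
    also have "\<dots> \<le> real n * p n" using elim by (intro mult_left_mono) auto
    finally have np: "1 \<le> real n * p n" .
    have "ln (real n) / real (d n) \<le> ln (real n) / real n powr \<delta>"
      using elim pd d by (intro divide_left_mono) auto
    then have s1: "ln (real n) / real (d n) \<le> 1 / 54" using elim(2) by (rule order_trans)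
    have "512 * ln (real n) ^ 3 / real (d n) ^ 2 \<le> 512 * ln (real n) ^ 3 / (real n powr \<delta>) ^ 2"
      using elim pd d by (intro divide_left_mono power_mono) auto
    then have s2: "512 * ln (real n) ^ 3 / real (d n) ^ 2 \<le> 1" using elim(3) by (rule order_trans)
    have "1 \<le> d n" "p n \<le> 1/2" "4 \<le> n" "1 \<le> ln (real n)" using elim d by auto
    then show ?case unfolding sparse_regime_def using s1 s2 p np by blast
  qed
qed

text \<open>\<open>z\<close> stands for \<open>(np) ^ (k / 4)\<close>, given by its fourth power so
  that both cycles share one argument. The equation for \<open>z ^ 4\<close> controls the variance
  term \<open>(np) ^ k\<close>, and \<open>z <= np\<close> the term from linked pairs.\<close>

lemma test_succeeds_below_threshold:
  fixes p z :: "nat \<Rightarrow> real"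
  assumes A: "assumption_A \<delta> \<epsilon> p d" "\<delta> > 0" "\<epsilon> > 0" and k: "k = 3 \<or> k = 4"
    and z: "\<forall>\<^sub>F n in sequentially. 0 \<le> z n \<and> z n ^ 4 = (real n * p n) ^ k \<and> z n \<le> real n * p n"
    and small: "(\<lambda>n. real (d n) * ln (real n) ^ 2) \<in> o(z)"
  shows "test_succeeds k p d"
  unfolding test_succeeds_def
proof (rule landau_o.smallI)
  fix c :: real assume c: "0 < c"
  obtain K :: real where K: "1 \<le> K"
    and bounds: "\<forall>k n d p. k = 3 \<or> k = 4 \<longrightarrow> sparse_regime n d p \<longrightarrow> moments_within K k n d p"
    using moment_bounds by (elim exE conjE)
  \<comment> \<open>The estimate will end in \<open>V <= (2 K b) ^ 2 * Q\<close>, and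
    \<open>2 K b <= c / K\<close> matches the \<open>K\<close> in the lower bound of the mean. The
    cap 1 gives \<open>b ^ 4 <= b ^ 2\<close>.\<close>
  define b where "b = min 1 (c / (2 * K\<^sup>2))"
  have b: "0 < b" "b \<le> 1" "b \<le> c / (2 * K\<^sup>2)" using c K by (auto simp: b_def)
  have "\<forall>\<^sub>F n in sequentially. norm (real (d n) * ln (real n) ^ 2) \<le> b * norm (z n)"
    by (rule landau_o.smallD[OF small b(1)])
  with assumption_A_eventually[OF A] z
  show "\<forall>\<^sub>F n in sequentially. norm (sqrt (Var_er k n (p n) + Var_rgg k n (d n) (p n)))
      \<le> c * norm \<bar>E_rgg k n (d n) (p n)\<bar>"
  proof eventually_elim
    case (elim n)
    define y where "y = real n * p n"
    define l where "l = ln (real n)"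
    define D where "D = real (d n)"
    define E where "E = E_rgg k n (d n) (p n)"
    define V where "V = Var_er k n (p n) + Var_rgg k n (d n) (p n)"
    have y1: "1 \<le> y" and l1: "1 \<le> l" and D1: "1 \<le> D" and z0: "0 \<le> z n" "z n ^ 4 = y ^ k" "z n \<le> y"
      and Dl: "D * l ^ 2 \<le> b * z n"
      using elim by (auto simp: y_def l_def D_def sparse_regime_def)
    have B: "y ^ k / (K * D ^ 2) \<le> E" "0 \<le> Var_rgg k n (d n) (p n)"
      "Var_rgg k n (d n) (p n) \<le> K * (y ^ k + y ^ (2 * k - 2) * l ^ 3 / D ^ 2)"
      "Var_er k n (p n) \<le> y ^ k" "y ^ k / K \<le> Var_er k n (p n)"
      using bounds[rule_format, OF k elim(1)] unfolding moments_within_def y_def l_def D_def E_def by blast+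
    have "D \<le> D * l ^ 2" using l1 D1 by simp
    then have "D \<le> b * z n" using Dl by linarith
    then have "D ^ 4 \<le> (b * z n) ^ 4" using D1 by (intro power_mono) auto
    also have "\<dots> = b ^ 4 * y ^ k" by (simp add: power_mult_distrib z0)
    also have "\<dots> \<le> b ^ 2 * y ^ k" using b y1 by (intro mult_right_mono power_decreasing) auto
    finally have D4: "D ^ 4 \<le> b ^ 2 * y ^ k" .
    \<comment> \<open>The two logarithms of the hypothesis, squared, absorb the \<open>l ^ 3\<close>
      of the variance bound.\<close>
    have "D ^ 2 * l ^ 3 \<le> (D * l ^ 2) ^ 2"
    proof -
      have "l ^ 3 \<le> l ^ 4" using l1 by (intro power_increasing) auto
      then show ?thesis using D1 by (simp add: power_mult_distrib power_mult[symmetric])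
    qed
    also have "\<dots> \<le> (b * y) ^ 2"
    proof (rule power_mono)
      show "D * l ^ 2 \<le> b * y" using Dl z0(3) b(1) mult_left_mono[of "z n" y b] by linarith
    qed (use D1 in simp)
    also have "\<dots> = b ^ 2 * y ^ 2" by (simp add: power_mult_distrib)
    finally have D2: "D ^ 2 * l ^ 3 \<le> b ^ 2 * y ^ 2" .
    have "2 * k - 2 + 2 = 2 * k" "k + k = 2 * k" using k by auto
    then have yy: "y ^ (2 * k - 2) * y ^ 2 = y ^ (2 * k)" "y ^ k * y ^ k = y ^ (2 * k)"
      by (simp_all only: power_add[symmetric])
    have D0: "0 < D ^ 4" "0 < D ^ 2" "D ^ 4 = D ^ 2 * D ^ 2" using D1 by (auto simp: power_add[symmetric])
    have "y ^ k * D ^ 4 \<le> y ^ k * (b ^ 2 * y ^ k)" using D4 y1 by (intro mult_left_mono) auto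
    then have t1: "y ^ k \<le> b ^ 2 * y ^ (2 * k) / D ^ 4"
      unfolding yy(2)[symmetric] pos_le_divide_eq[OF D0(1)] by (simp only: mult_ac)
    have "y ^ (2 * k - 2) * (D ^ 2 * l ^ 3) \<le> y ^ (2 * k - 2) * (b ^ 2 * y ^ 2)"
      using D2 y1 by (intro mult_left_mono) auto
    also have "\<dots> = b ^ 2 * y ^ (2 * k)" unfolding yy(1)[symmetric] by (simp only: mult_ac)
    finally have "y ^ (2 * k - 2) * l ^ 3 * D ^ 2 \<le> b ^ 2 * y ^ (2 * k)" by (simp only: mult_ac)
    then have "y ^ (2 * k - 2) * l ^ 3 * D ^ 2 / D ^ 4 \<le> b ^ 2 * y ^ (2 * k) / D ^ 4"
      using D0(1) by (intro divide_right_mono) auto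
    moreover have "y ^ (2 * k - 2) * l ^ 3 * D ^ 2 / D ^ 4 = y ^ (2 * k - 2) * l ^ 3 / D ^ 2"
      unfolding D0(3) mult_divide_mult_cancel_right[OF less_imp_neq[OF D0(2), symmetric]] ..
    ultimately have t2: "y ^ (2 * k - 2) * l ^ 3 / D ^ 2 \<le> b ^ 2 * y ^ (2 * k) / D ^ 4" by simp
    \<comment> \<open>\<open>Q / K ^ 2\<close> is the square of the lower bound for the
      mean.\<close>
    define Q where "Q = y ^ (2 * k) / D ^ 4"
    have Q0: "0 \<le> Q" using y1 D0(1) by (simp add: Q_def)
    have "V \<le> y ^ k + K * (y ^ k + y ^ (2 * k - 2) * l ^ 3 / D ^ 2)"
      using B by (simp add: V_def)
    also have "\<dots> \<le> b ^ 2 * Q + K * (b ^ 2 * Q + b ^ 2 * Q)"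
      using t1 t2 K unfolding Q_def by (intro add_mono mult_left_mono) auto
    also have "\<dots> \<le> K * (b ^ 2 * Q) + K * (b ^ 2 * Q + b ^ 2 * Q)"
      using K Q0 mult_right_mono[of 1 K "b ^ 2 * Q"] by (simp add: mult_ac)
    also have "\<dots> = 3 * K * b ^ 2 * Q" by simp
    also have "\<dots> \<le> 4 * K ^ 2 * b ^ 2 * Q"
      using K Q0 mult_mono[of 3 4 K "K ^ 2"] self_le_power[of K 2] by (intro mult_right_mono) auto
    also have "\<dots> = (2 * K * b) ^ 2 * Q" by (simp add: power_mult_distrib)
    also have "\<dots> \<le> (c / K) ^ 2 * Q"
    proof (intro mult_right_mono power_mono Q0)
      have "2 * K * b \<le> 2 * K * (c / (2 * K\<^sup>2))" using b K by (intro mult_left_mono) auto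
      also have "\<dots> = c / K" using K by (simp add: power2_eq_square)
      finally show "2 * K * b \<le> c / K" .
    qed (use K b in simp)
    also have "\<dots> = (c * (y ^ k / (K * D ^ 2))) ^ 2"
      unfolding Q_def D0(3) yy(2)[symmetric] power2_eq_square
      using K D1 by (simp add: field_simps)
    also have "\<dots> \<le> (c * E) ^ 2"
      using B(1) c K y1 D1 by (intro power_mono mult_left_mono) auto
    finally have "V \<le> (c * E) ^ 2" .
    moreover have E0: "0 \<le> E"
      by (rule order_trans[OF _ B(1)]) (use y1 K D1 in simp)
    ultimately have "sqrt V \<le> c * E" using c by (intro real_le_lsqrt) auto
    moreover have "0 \<le> V" using B y1 K by (auto simp: V_def intro!: add_nonneg_nonneg order_trans[OF _ B(5)])
    ultimately show ?case using E0 unfolding E_def V_def by simp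
  qed
qed

text \<open>The Erdos-Renyi variance, at least \<open>y ^ k / K\<close>, already dominates the
  squared mean. The upper bound of the latter carries \<open>l ^ 6\<close>, and the fourth power of
  \<open>z * l ^ 2\<close> supplies \<open>l ^ 8\<close>.\<close>

lemma test_fails_above_threshold:
  fixes p z :: "nat \<Rightarrow> real"
  assumes A: "assumption_A \<delta> \<epsilon> p d" "\<delta> > 0" "\<epsilon> > 0" and k: "k = 3 \<or> k = 4"
    and z: "\<forall>\<^sub>F n in sequentially. 0 \<le> z n \<and> z n ^ 4 = (real n * p n) ^ k \<and> z n \<le> real n * p n"
    and large: "(\<lambda>n. z n * ln (real n) ^ 2) \<in> o(\<lambda>n. real (d n))"
  shows "test_fails k p d"
  unfolding test_fails_def
proof (rule landau_o.smallI)
  fix c :: real assume c: "0 < c"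
  obtain K :: real where K: "1 \<le> K"
    and bounds: "\<forall>k n d p. k = 3 \<or> k = 4 \<longrightarrow> sparse_regime n d p \<longrightarrow> moments_within K k n d p"
    using moment_bounds by (elim exE conjE)
  define b where "b = min 1 (c / K\<^sup>2)"
  have b: "0 < b" "b \<le> 1" "b \<le> c / K\<^sup>2" using c K by (auto simp: b_def)
  have "\<forall>\<^sub>F n in sequentially. norm (z n * ln (real n) ^ 2) \<le> b * norm (real (d n))"
    by (rule landau_o.smallD[OF large b(1)])
  with assumption_A_eventually[OF A] z
  show "\<forall>\<^sub>F n in sequentially. norm \<bar>E_rgg k n (d n) (p n)\<bar>
      \<le> c * norm (sqrt (Var_er k n (p n) + Var_rgg k n (d n) (p n)))"
  proof eventually_elim
    case (elim n)
    define y where "y = real n * p n"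
    define l where "l = ln (real n)"
    define D where "D = real (d n)"
    define E where "E = E_rgg k n (d n) (p n)"
    define V where "V = Var_er k n (p n) + Var_rgg k n (d n) (p n)"
    have y1: "1 \<le> y" and l1: "1 \<le> l" and D1: "1 \<le> D" and z0: "0 \<le> z n" "z n ^ 4 = y ^ k"
      and zl: "z n * l ^ 2 \<le> b * D"
      using elim by (auto simp: y_def l_def D_def sparse_regime_def)
    have B: "y ^ k / (K * D ^ 2) \<le> E" "E \<le> K * (y ^ k * l ^ 3 / D ^ 2)" "y ^ k / K \<le> V"
      using bounds[rule_format, OF k elim(1)] unfolding moments_within_def y_def l_def D_def E_def V_def by (blast, blast, linarith)
    have E0: "0 \<le> E"
      by (rule order_trans[OF _ B(1)]) (use y1 K D1 in simp)
    have D0: "0 < D ^ 4" "0 < D ^ 2" "D ^ 4 = D ^ 2 * D ^ 2" using D1 by (auto simp: power_add[symmetric])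
    have "y ^ k * l ^ 6 \<le> y ^ k * l ^ 8" using l1 y1 by (intro mult_left_mono power_increasing) auto
    also have "\<dots> = (z n * l ^ 2) ^ 4" by (simp add: power_mult_distrib z0(2) power_mult[symmetric])
    also have "\<dots> \<le> (b * D) ^ 4" using zl z0 l1 by (intro power_mono) auto
    also have "\<dots> = b ^ 4 * D ^ 4" by (simp add: power_mult_distrib)
    also have "\<dots> \<le> b ^ 2 * D ^ 4" using b D0(1) by (intro mult_right_mono power_decreasing) auto
    also have "\<dots> \<le> (c / K\<^sup>2) ^ 2 * D ^ 4" using b D0(1) by (intro mult_right_mono power_mono) auto
    finally have yl: "y ^ k * l ^ 6 \<le> (c / K\<^sup>2) ^ 2 * D ^ 4" .
    have "E ^ 2 \<le> (K * (y ^ k * l ^ 3 / D ^ 2)) ^ 2" using B(2) E0 by (intro power_mono) auto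
    also have "\<dots> = K ^ 2 * y ^ k * (y ^ k * l ^ 6) / D ^ 4"
      unfolding D0(3) by (simp add: power2_eq_square flip: power_add)
    also have "\<dots> \<le> K ^ 2 * y ^ k * ((c / K\<^sup>2) ^ 2 * D ^ 4) / D ^ 4"
      using yl y1 D0(1) by (intro divide_right_mono mult_left_mono) auto
    also have "\<dots> = c ^ 2 * (y ^ k / K) / K"
      using D0(1) K by (simp add: power_divide power2_eq_square)
    also have "\<dots> \<le> c ^ 2 * (y ^ k / K) / 1"
      using K y1 by (intro divide_left_mono) auto
    also have "\<dots> \<le> c ^ 2 * V" unfolding div_by_1 using B(3) by (rule mult_left_mono) simp
    finally have E2: "E ^ 2 \<le> c ^ 2 * V" .
    have V0: "0 \<le> V" by (rule order_trans[OF _ B(3)]) (use y1 K in simp)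
    have "E \<le> sqrt (c ^ 2 * V)" using E2 by (rule real_le_rsqrt)
    also have "\<dots> = c * sqrt V" using c by (simp add: real_sqrt_mult)
    finally show ?case using E0 V0 unfolding E_def V_def by simp
  qed
qed

theorem theorem1p3:
  fixes \<delta> \<epsilon> :: real
  assumes "\<delta> > 0" and "\<epsilon> > 0"
  shows "\<exists>C::nat. \<forall>(p :: nat \<Rightarrow> real) (d :: nat \<Rightarrow> nat). assumption_A \<delta> \<epsilon> p d \<longrightarrow>
      (((\<lambda>n. real (d n) * ln (real n) ^ C) \<in> o(\<lambda>n. real n * p n) \<longrightarrow> test_succeeds 4 p d) \<and>
       ((\<lambda>n. real n * p n * ln (real n) ^ C) \<in> o(\<lambda>n. real (d n)) \<longrightarrow> test_fails 4 p d) \<and>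
       ((\<lambda>n. real (d n) * ln (real n) ^ C) \<in> o(\<lambda>n. (real n * p n) powr (3/4)) \<longrightarrow> test_succeeds 3 p d) \<and>
       ((\<lambda>n. (real n * p n) powr (3/4) * ln (real n) ^ C) \<in> o(\<lambda>n. real (d n)) \<longrightarrow> test_fails 3 p d))"
proof (rule exI[of _ 2], intro allI impI)
  fix p :: "nat \<Rightarrow> real" and d :: "nat \<Rightarrow> nat"
  assume A: "assumption_A \<delta> \<epsilon> p d"
  have np: "\<forall>\<^sub>F n in sequentially. 1 \<le> real n * p n"
    using assumption_A_eventually[OF A assms] by eventually_elim (simp add: sparse_regime_def)
  \<comment> \<open>For the 4-cycle \<open>z\<close> is \<open>np\<close> itself, so both variance
    terms give the same condition; for the triangle \<open>np >= 1\<close> yields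
    \<open>z <= np\<close>.\<close>
  have z4: "\<forall>\<^sub>F n in sequentially. 0 \<le> real n * p n \<and> (real n * p n) ^ 4 = (real n * p n) ^ 4
      \<and> real n * p n \<le> real n * p n"
    using np by eventually_elim simp
  have z3: "\<forall>\<^sub>F n in sequentially. 0 \<le> (real n * p n) powr (3/4)
      \<and> ((real n * p n) powr (3/4)) ^ 4 = (real n * p n) ^ 3
      \<and> (real n * p n) powr (3/4) \<le> real n * p n"
    using np
  proof eventually_elim
    case (elim n)
    define y where "y = real n * p n"
    have y: "1 \<le> y" using elim by (simp add: y_def)
    have "(y powr (3/4)) ^ 4 = y powr (real 3)" using y by (simp add: powr_power)
    also have "\<dots> = y ^ 3" using y by (intro powr_realpow) simp
    finally have "(y powr (3/4)) ^ 4 = y ^ 3" .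
    moreover have "y powr (3/4) \<le> y powr 1" using y by (intro powr_mono) auto
    ultimately show ?case using y unfolding y_def by simp
  qed
  show "((\<lambda>n. real (d n) * ln (real n) ^ 2) \<in> o(\<lambda>n. real n * p n) \<longrightarrow> test_succeeds 4 p d) \<and>
       ((\<lambda>n. real n * p n * ln (real n) ^ 2) \<in> o(\<lambda>n. real (d n)) \<longrightarrow> test_fails 4 p d) \<and>
       ((\<lambda>n. real (d n) * ln (real n) ^ 2) \<in> o(\<lambda>n. (real n * p n) powr (3/4)) \<longrightarrow> test_succeeds 3 p d) \<and>
       ((\<lambda>n. (real n * p n) powr (3/4) * ln (real n) ^ 2) \<in> o(\<lambda>n. real (d n)) \<longrightarrow> test_fails 3 p d)"
    using test_succeeds_below_threshold[OF A assms disjI2[OF refl] z4]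
      test_fails_above_threshold[OF A assms disjI2[OF refl] z4]
      test_succeeds_below_threshold[OF A assms disjI1[OF refl] z3]
      test_fails_above_threshold[OF A assms disjI1[OF refl] z3]
    by blast
qed

end
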